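(* Let $\mathbf{K}$ be a commutative ring, let $n,m\ge 1$ be integers, and let $\mathrm{G}=\mathrm{GL}(n,\mathbf{K})$. Let $A$, $A_P$, $D$, $\Delta:A\to D$ and $\Delta':A_P\to D$ be respectively the coordinate ring of $m$ generic $n\times n$ matrices, the coordinate ring of $m$ generic commuting $n\times n$ matrices, the polynomial ring $\mathbf{K}[x_{ik}: 1\le i\le n,\,1\le k\le m]$, and the homomorphisms given by restriction to diagonal matrices. Then: (1) The restriction of $\Delta$ to $A^{\mathrm{G}}$ is a surjection onto $D^{\mathfrak{S}_n}$ $(\cong \mathrm{TS}^nP)$. The same holds for the restriction of $\Delta'$ to $A_P^{\mathrm{G}}$. (2) When $\mathbf{K}$ is a characteristic zero field, the restriction of $\Delta'$ to $A_P^{\mathrm{G}}$ gives an isomorphism $A_P^{\mathrm{G}}\cong D^{\mathfrak{S}_n}$. (3) Let $N_P$ denote the nilradical of $A_P$. When $\mathbf{K}$ is an infinite field of arbitrary characteristic, $\Delta'$ induces an isomorphism between $(A_P/N_P)^{\mathrm{G}}$ and $D^{\mathfrak{S}_n}$.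
   Context: $P=\mathbf{K}[y_1,\dots,y_m]$. $A=\mathbf{K}[\xi_{kij}]$ is the polynomial ring in the variables $\xi_{kij}$, $1\le i,j\le n$, $1\le k\le m$, and $\xi_k=(\xi_{kij})_{i,j}$ is the $k$-th generic matrix. $A_P$ is the quotient of $A$ by the ideal generated by all entries of the matrices $\xi_k\xi_h-\xi_h\xi_k$, $1\le k,h\le m$; $\xi'_{kij}$ denotes the class of $\xi_{kij}$. The group $\mathrm{G}=\mathrm{GL}(n,\mathbf{K})$ acts on $A$ by $\mathbf{K}$-algebra automorphisms: $g\in\mathrm{G}$ maps $\xi_{kij}$ to the $(i,j)$ entry of $g^{-1}\xi_k g$. The ideal defining $A_P$ is stable, so $\mathrm{G}$ also acts on $A_P$, and hence on $A_P/N_P$. Superscript $\mathrm{G}$ denotes the subring of invariants. The symmetric group $\mathfrak{S}_n$ acts on $D=\mathbf{K}[x_{ik}:1\le i\le n,\ 1\le k\le m]$ by $\sigma(x_{ik})=x_{\sigma(i)k}$; $D^{\mathfrak{S}_n}$ is the ring of invariants (the ring of multisymmetric functions). $\mathrm{TS}^nP=(P^{\otimes n})^{\mathfrak{S}_n}$, where $\mathfrak{S}_n$ permutes the factors of the tensor power over $\mathbf{K}$; the $\mathfrak{S}_n$-equivariant isomorphism $D\to P^{\otimes n}$, $x_{ik}\mapsto 1^{\otimes i-1}\otimes y_k\otimes 1^{\otimes n-i}$, gives $D^{\mathfrak{S}_n}\cong\mathrm{TS}^nP$. $\Delta:A\to D$ is the surjective $\mathbf{K}$-algebra homomorphism with $\Delta(\xi_{kij})=0$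 if $i\ne j$ and $\Delta(\xi_{kii})=x_{ik}$. It factors through the surjective $\mathbf{K}$-algebra homomorphism $\Delta':A_P\to D$ with $\Delta'(\xi'_{kij})=0$ if $i\neq j$ and $\Delta'(\xi'_{kii})=x_{ik}$. When $\mathbf{K}$ is a field, $D$ is reduced, so $\Delta'$ factors through a homomorphism $A_P/N_P\to D$; this is the homomorphism meant by "induces" in (3). *)

theory Defs
  imports
    "HOL-Analysis.Analysis"
    "HOL-Library.Poly_Mapping"
    "HOL-Algebra.QuotRing"
    "HOL-Algebra.Algebraic_Closure_Type"
begin

section \<open>Polynomial rings\<close>

text \<open>
  Polynomials in variables of type \<open>'v\<close>: finitely supported functions from exponent vectors to
  coefficients, with the convolution product supplied by the type class instances of
  \<^theory>\<open>HOL-Library.Poly_Mapping\<close>.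
\<close>
type_synonym ('v, 'k) mpoly = "('v \<Rightarrow>\<^sub>0 nat) \<Rightarrow>\<^sub>0 'k"

definition Const :: "'k \<Rightarrow> 'a::zero \<Rightarrow>\<^sub>0 'k::zero" where
  "Const c = Poly_Mapping.single 0 c"

definition Var :: "'v \<Rightarrow> ('v, 'k::zero_neq_one) mpoly" where
  "Var v = Poly_Mapping.single (Poly_Mapping.single v 1) 1"

text \<open>
  The homomorphism that sends the variable \<open>v\<close> to \<open>f v\<close> and maps coefficients through \<open>\<iota>\<close>.
\<close>
definition subst :: "('k::zero \<Rightarrow> 'b::comm_ring_1) \<Rightarrow> ('v \<Rightarrow> 'b) \<Rightarrow> ('v, 'k) mpoly \<Rightarrow> 'b" where
  "subst \<iota> f p =
     (\<Sum>t\<in>Poly_Mapping.keys p. \<iota> (Poly_Mapping.lookup p t) *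
        (\<Prod>v\<in>Poly_Mapping.keys t. f v ^ Poly_Mapping.lookup t v))"


section \<open>Invariants, algebra homomorphisms, quotients\<close>

definition fixed_ring ::
  "'g set \<Rightarrow> ('g \<Rightarrow> 'a \<Rightarrow> 'a) \<Rightarrow> ('a, 'z) ring_scheme \<Rightarrow> ('a, 'z) ring_scheme" where
  "fixed_ring G act R = R\<lparr>carrier := {x \<in> carrier R. \<forall>g\<in>G. act g x = x}\<rparr>"

text \<open>
  Algebra homomorphisms and isomorphisms over a common coefficient ring, which is given through
  its structure maps \<open>i\<close> into \<open>R\<close> and \<open>j\<close> into \<open>S\<close>.
\<close>
definition alg_hom ::
  "('k \<Rightarrow> 'a) \<Rightarrow> ('a, 'y) ring_scheme \<Rightarrow> ('k \<Rightarrow> 'b) \<Rightarrow> ('b, 'z) ring_scheme \<Rightarrow> ('a \<Rightarrow> 'b) set" where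
  "alg_hom i R j S = {h \<in> ring_hom R S. \<forall>c. h (i c) = j c}"

definition alg_iso ::
  "('k \<Rightarrow> 'a) \<Rightarrow> ('a, 'y) ring_scheme \<Rightarrow> ('k \<Rightarrow> 'b) \<Rightarrow> ('b, 'z) ring_scheme \<Rightarrow> ('a \<Rightarrow> 'b) set" where
  "alg_iso i R j S = {h \<in> ring_iso R S. \<forall>c. h (i c) = j c}"

definition nilradical :: "('a, 'z) ring_scheme \<Rightarrow> 'a set" where
  "nilradical R = {x \<in> carrier R. \<exists>n::nat. x [^]\<^bsub>R\<^esub> n = \<zero>\<^bsub>R\<^esub>}"

text \<open>
  The map on cosets induced by \<open>h\<close>: if \<open>h\<close> vanishes on the ideal, the image \<open>h ` C\<close> of a coset
  \<open>C\<close> is a singleton. Likewise, an automorphism \<open>h\<close> that stabilises the ideal acts on the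
  quotient ring by the set image \<open>C \<mapsto> h ` C\<close>.
\<close>
definition on_cosets :: "('a \<Rightarrow> 'b) \<Rightarrow> 'a set \<Rightarrow> 'b" where
  "on_cosets h C = the_elem (h ` C)"


section \<open>Generic matrices\<close>

text \<open>
  The type \<open>'n\<close> indexes rows and columns and \<open>'m\<close> indexes the matrices; the variable
  \<open>(k, i, j)\<close> is the entry \<open>\<xi>\<^sub>k\<^sub>i\<^sub>j\<close>.
\<close>
type_synonym ('n, 'm, 'k) gen_poly = "('m \<times> 'n \<times> 'n, 'k) mpoly"

definition A_ring :: "('n::finite, 'm::finite, 'k::comm_ring_1) gen_poly ring" where
  "A_ring = ring_of_type_algebra"

definition generic_matrix :: "'m \<Rightarrow> (('n::finite, 'm, 'k::comm_ring_1) gen_poly)^'n^'n" where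
  "generic_matrix k = (\<chi> i j. Var (k, i, j))"

definition GL :: "('k::comm_ring_1^'n^'n) set" where
  "GL = {g. invertible g}"

definition GL_act ::
  "'k^'n^'n \<Rightarrow> ('n::finite, 'm::finite, 'k::comm_ring_1) gen_poly \<Rightarrow> ('n, 'm, 'k) gen_poly" where
  "GL_act g = subst Const (\<lambda>(k, i, j).
     (map_matrix Const (matrix_inv g) ** generic_matrix k ** map_matrix Const g) $ i $ j)"

definition comm_ideal :: "('n::finite, 'm::finite, 'k::comm_ring_1) gen_poly set" where
  "comm_ideal = Idl\<^bsub>A_ring\<^esub>
     {(generic_matrix k ** generic_matrix h - generic_matrix h ** generic_matrix k) $ i $ j
       | k h i j. True}"

definition AP_ring :: "('n::finite, 'm::finite, 'k::comm_ring_1) gen_poly set ring" where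
  "AP_ring = A_ring Quot comm_ideal"

definition AP_const :: "'k \<Rightarrow> ('n::finite, 'm::finite, 'k::comm_ring_1) gen_poly set" where
  "AP_const c = comm_ideal +>\<^bsub>A_ring\<^esub> Const c"

definition AP_act ::
  "'k^'n^'n \<Rightarrow> ('n::finite, 'm::finite, 'k::comm_ring_1) gen_poly set \<Rightarrow> ('n, 'm, 'k) gen_poly set"
  where "AP_act g = image (GL_act g)"

definition AP_red_ring :: "('n::finite, 'm::finite, 'k::comm_ring_1) gen_poly set set ring" where
  "AP_red_ring = AP_ring Quot nilradical AP_ring"

definition AP_red_const :: "'k \<Rightarrow> ('n::finite, 'm::finite, 'k::comm_ring_1) gen_poly set set" where
  "AP_red_const c = nilradical AP_ring +>\<^bsub>AP_ring\<^esub> AP_const c"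

definition AP_red_act ::
  "'k^'n^'n \<Rightarrow> ('n::finite, 'm::finite, 'k::comm_ring_1) gen_poly set set
    \<Rightarrow> ('n, 'm, 'k) gen_poly set set"
  where "AP_red_act g = image (AP_act g)"


section \<open>Multisymmetric functions and restriction to diagonal matrices\<close>

type_synonym ('n, 'm, 'k) diag_poly = "('n \<times> 'm, 'k) mpoly"

definition D_ring :: "('n::finite, 'm::finite, 'k::comm_ring_1) diag_poly ring" where
  "D_ring = ring_of_type_algebra"

definition Sym :: "('n \<Rightarrow> 'n) set" where
  "Sym = {\<sigma>. \<sigma> permutes UNIV}"

definition Sym_act ::
  "('n \<Rightarrow> 'n) \<Rightarrow> ('n::finite, 'm::finite, 'k::comm_ring_1) diag_poly \<Rightarrow> ('n, 'm, 'k) diag_poly" where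
  "Sym_act \<sigma> = subst Const (\<lambda>(i, k). Var (\<sigma> i, k))"

definition Delta ::
  "('n::finite, 'm::finite, 'k::comm_ring_1) gen_poly \<Rightarrow> ('n, 'm, 'k) diag_poly" where
  "Delta = subst Const (\<lambda>(k, i, j). if i = j then Var (i, k) else 0)"

definition Delta_P ::
  "('n::finite, 'm::finite, 'k::comm_ring_1) gen_poly set \<Rightarrow> ('n, 'm, 'k) diag_poly" where
  "Delta_P = on_cosets Delta"

definition Delta_red ::
  "('n::finite, 'm::finite, 'k::comm_ring_1) gen_poly set set \<Rightarrow> ('n, 'm, 'k) diag_poly" where
  "Delta_red = on_cosets Delta_P"


section \<open>Symmetric tensors\<close>

text \<open>
  The tensor power \<open>P\<^sup>\<otimes>\<^sup>n\<close> of a commutative algebra \<open>P\<close> is the free module on the families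
  \<open>(p\<^sub>i)\<close> in \<open>P\<close> indexed by \<open>'n\<close>, modulo the multilinearity relations. To obtain its
  product, the families are turned into a monoid, written additively, under componentwise
  multiplication; the free module is then the monoid algebra, and the multilinearity relations
  span an ideal of it because their set is stable under multiplication by families.
\<close>
datatype ('i, 'a) family = Family (entry: "'i \<Rightarrow> 'a")

instantiation family :: (type, comm_monoid_mult) comm_monoid_add
begin

definition zero_family :: "('a, 'b) family" where
  "zero_family = Family (\<lambda>_. 1)"

definition plus_family :: "('a, 'b) family \<Rightarrow> ('a, 'b) family \<Rightarrow> ('a, 'b) family" where
  "plus_family s t = Family (\<lambda>i. entry s i * entry t i)"

instance
  by standard (simp_all add: zero_family_def plus_family_def ac_simps)

end

type_synonym ('n, 'm, 'k) families = "('n, ('m, 'k) mpoly) family \<Rightarrow>\<^sub>0 'k"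

definition families_ring :: "('n::finite, 'm::finite, 'k::comm_ring_1) families ring" where
  "families_ring = ring_of_type_algebra"

definition pure :: "('n \<Rightarrow> ('m, 'k) mpoly) \<Rightarrow> ('n::finite, 'm::finite, 'k::comm_ring_1) families" where
  "pure f = Poly_Mapping.single (Family f) 1"

definition multilinear_ideal :: "('n::finite, 'm::finite, 'k::comm_ring_1) families set" where
  "multilinear_ideal = Idl\<^bsub>families_ring\<^esub>
     ({pure (f(i := p + q)) - (pure (f(i := p)) + pure (f(i := q))) | f i p q. True} \<union>
      {pure (f(i := Const c * p)) - Const c * pure (f(i := p)) | f i c p. True})"

definition tensor_ring :: "('n::finite, 'm::finite, 'k::comm_ring_1) families set ring" where
  "tensor_ring = families_ring Quot multilinear_ideal"

definition tensor_const :: "'k \<Rightarrow> ('n::finite, 'm::finite, 'k::comm_ring_1) families set" where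
  "tensor_const c = multilinear_ideal +>\<^bsub>families_ring\<^esub> Const c"

text \<open>The factor in position \<open>i\<close> is moved to position \<open>\<sigma> i\<close>.\<close>
definition families_act ::
  "('n \<Rightarrow> 'n) \<Rightarrow> ('n::finite, 'm::finite, 'k::comm_ring_1) families \<Rightarrow> ('n, 'm, 'k) families" where
  "families_act \<sigma> z =
     (\<Sum>t\<in>Poly_Mapping.keys z.
        Poly_Mapping.single (Family (entry t \<circ> inv_into UNIV \<sigma>)) (Poly_Mapping.lookup z t))"

definition tensor_act ::
  "('n \<Rightarrow> 'n) \<Rightarrow> ('n::finite, 'm::finite, 'k::comm_ring_1) families set
    \<Rightarrow> ('n, 'm, 'k) families set" where
  "tensor_act \<sigma> = image (families_act \<sigma>)"

definition TS_ring :: "('n::finite, 'm::finite, 'k::comm_ring_1) families set ring" where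
  "TS_ring = fixed_ring Sym tensor_act tensor_ring"

text \<open>The algebra homomorphism with \<open>x\<^sub>i\<^sub>k \<mapsto> 1 \<otimes> \<dots> \<otimes> 1 \<otimes> y\<^sub>k \<otimes> 1 \<otimes> \<dots> \<otimes> 1\<close>, \<open>y\<^sub>k\<close> in position \<open>i\<close>.\<close>
definition to_tensor ::
  "('n::finite, 'm::finite, 'k::comm_ring_1) diag_poly \<Rightarrow> ('n, 'm, 'k) families set" where
  "to_tensor p = multilinear_ideal +>\<^bsub>families_ring\<^esub>
     subst Const (\<lambda>(i, k). pure ((\<lambda>_. 1)(i := Var k))) p"


section \<open>The rings of invariants\<close>

abbreviation A_inv :: "('n::finite, 'm::finite, 'k::comm_ring_1) gen_poly ring" where
  "A_inv \<equiv> fixed_ring GL GL_act A_ring"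

abbreviation AP_inv :: "('n::finite, 'm::finite, 'k::comm_ring_1) gen_poly set ring" where
  "AP_inv \<equiv> fixed_ring GL AP_act AP_ring"

abbreviation AP_red_inv :: "('n::finite, 'm::finite, 'k::comm_ring_1) gen_poly set set ring" where
  "AP_red_inv \<equiv> fixed_ring GL AP_red_act AP_red_ring"

abbreviation D_inv :: "('n::finite, 'm::finite, 'k::comm_ring_1) diag_poly ring" where
  "D_inv \<equiv> fixed_ring Sym Sym_act D_ring"

end

theory Submission
  imports Defs "HOL-Library.Function_Algebras"
begin

no_notation fps_nth (infixl \<open>$\<close> 75)
unbundle no m_inv_syntax

text \<open>
  Part (1): for an exponent family \<open>a\<close> let \<open>e\<^sub>a\<close> be the sum, over the distinct rearrangements \<open>b\<close> of \<open>a\<close>, of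
  the determinants whose row \<open>i\<close> is row \<open>i\<close> of the monomial in the generic matrices with exponents
  \<open>b i\<close>. These are coefficients of a polarised determinant, hence invariant over any commutative ring,
  and \<open>\<Delta>\<close> maps them to the monomial symmetric sums, which span the multisymmetric functions.

  Part (2): an invariant modulo commutators is killed by the Lie algebra modulo commutators. The
  operators of the Lie algebra on tensors are integral and their set is closed under transposition,
  so positivity of sums of squares over the rationals replaces complete reducibility and lifts it to
  a genuine invariant tensor. By the first fundamental theorem, proved with a Casimir operator, the
  invariant is a combination of products of traces. On these, polarised determinants provide \<open>n!\<close>
  times a left inverse of \<open>\<Delta>\<close> modulo commutators.

  Part (3): if no power of \<open>f\<close> lies in the commutator ideal, the Nullstellensatz yields commuting
  matrices over the algebraic closure at which \<open>f\<close> does not vanish. As the field is infinite,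
  invariance of \<open>f\<close> at this point extends to the general linear group of the closure. The matrices
  can be triangularised simultaneously, and the torus degenerates them to their diagonal, where the
  value of \<open>f\<close> is determined by \<open>\<Delta> f\<close>.
\<close>

text \<open>Surjectivity is the same in all three parts, since a genuine invariant of the polynomial
  ring stays invariant in every quotient; what (2) and (3) add is injectivity. In (2) the commutator
  ideal is not known to be radical, so membership in it cannot be tested at points, and a class that
  is invariant in the quotient need not come with an invariant representative. Both difficulties are
  met on coefficient vectors: membership follows from an explicit congruence between n! f and a
  polynomial built from \<open>Delta f\<close>, and the representative comes from solving a linear
  system with an integral symmetric matrix. The Lie algebra is reached from the group through the
  elements 1 + s x with x of square zero, whose inverse 1 - s x is again polynomial in s, so that
  the derivation is a coefficient of a polynomial whose values all lie in the ideal. In (3)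
  nilpotents are discarded, points suffice and no integer is inverted, so the characteristic is
  arbitrary.\<close>

locale rhom =
  fixes \<phi> :: "'a::comm_ring_1 \<Rightarrow> 'b::comm_ring_1"
  assumes one: "\<phi> 1 = 1"
    and add: "\<phi> (x + y) = \<phi> x + \<phi> y"
    and mult: "\<phi> (x * y) = \<phi> x * \<phi> y"
begin

lemma zero: "\<phi> 0 = 0"
  using add[of 0 0] by simp

lemma uminus: "\<phi> (- x) = - \<phi> x"
  using add[of x "- x"] zero by (simp add: eq_neg_iff_add_eq_0 add.commute)

lemma diff: "\<phi> (x - y) = \<phi> x - \<phi> y"
  using add[of x "- y"] uminus by simp

lemma sum: "\<phi> (\<Sum>i\<in>S. f i) = (\<Sum>i\<in>S. \<phi> (f i))"
  by (induction S rule: infinite_finite_induct) (simp_all add: zero add)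

lemma prod: "\<phi> (\<Prod>i\<in>S. f i) = (\<Prod>i\<in>S. \<phi> (f i))"
  by (induction S rule: infinite_finite_induct) (simp_all add: one mult)

lemma power: "\<phi> (x ^ n) = \<phi> x ^ n"
  by (induction n) (simp_all add: one mult)

lemma of_nat: "\<phi> (of_nat n) = of_nat n"
  by (induction n) (simp_all add: zero one add)

lemma of_int: "\<phi> (of_int n) = of_int n"
  by (cases n) (simp_all add: of_nat uminus one diff)

lemma det: "\<phi> (det M) = det (map_matrix \<phi> M)" for M :: "'a^'n^'n"
  by (simp add: det_def sum mult prod of_int map_matrix_def)

lemma map_matrix_mult:
  "map_matrix \<phi> (M ** N) = map_matrix \<phi> M ** map_matrix \<phi> N" for M :: "'a^'n^'m"
  by (simp add: map_matrix_def matrix_matrix_mult_def vec_eq_iff sum mult)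

lemma map_matrix_one: "map_matrix \<phi> (mat 1) = (mat 1 :: 'b^'n^'n)"
  by (simp add: map_matrix_def mat_def vec_eq_iff one zero)

lemma map_matrix_diff: "map_matrix \<phi> (M - N) = map_matrix \<phi> M - map_matrix \<phi> N"
  by (simp add: map_matrix_def vec_eq_iff diff)

lemma map_matrix_add: "map_matrix \<phi> (M + N) = map_matrix \<phi> M + map_matrix \<phi> N"
  by (simp add: map_matrix_def vec_eq_iff add)

end

lemma rhom_comp: "rhom \<phi> \<Longrightarrow> rhom \<psi> \<Longrightarrow> rhom (\<psi> \<circ> \<phi>)"
  by (simp add: rhom_def)

lemma map_matrix_nth [simp]: "map_matrix \<phi> M $ i $ j = \<phi> (M $ i $ j)"
  by (simp add: map_matrix_def)

lemma map_matrix_map_matrix: "map_matrix \<psi> (map_matrix \<phi> M) = map_matrix (\<psi> \<circ> \<phi>) M"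
  by (simp add: vec_eq_iff)

section \<open>Monoid algebras and substitution\<close>

lemma poly_mapping_sum_single:
  fixes p :: "'a \<Rightarrow>\<^sub>0 'b::comm_monoid_add"
  assumes "finite S" "Poly_Mapping.keys p \<subseteq> S"
  shows "p = (\<Sum>t\<in>S. Poly_Mapping.single t (Poly_Mapping.lookup p t))"
proof (rule poly_mapping_eqI)
  fix k
  show "Poly_Mapping.lookup p k =
    Poly_Mapping.lookup (\<Sum>t\<in>S. Poly_Mapping.single t (Poly_Mapping.lookup p t)) k"
    using assms by (auto simp: lookup_sum lookup_single when_def in_keys_iff)
qed

lemma Const_rhom: "rhom (Const :: 'k::comm_ring_1 \<Rightarrow> ('a::comm_monoid_add \<Rightarrow>\<^sub>0 'k))"
  by unfold_locales (simp_all add: Const_def single_add mult_single)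

lemma single_eq_Const_mult:
  "Poly_Mapping.single t c = Const c * Poly_Mapping.single (t :: 'a::comm_monoid_add) (1 :: 'k::comm_ring_1)"
  by (simp add: Const_def mult_single)

lemma Const_1 [simp]: "Const (1 :: 'k::comm_ring_1) = (1 :: 'a::comm_monoid_add \<Rightarrow>\<^sub>0 'k)"
  and Const_0 [simp]: "Const (0 :: 'k) = (0 :: 'a \<Rightarrow>\<^sub>0 'k)"
  by (simp_all add: Const_def)

lemma lookup_Const_mult:
  "Poly_Mapping.lookup (Const c * p) (t :: 'a::comm_monoid_add) = (c :: 'k::comm_ring_1) * Poly_Mapping.lookup p t"
proof -
  have "Const c * p = Poly_Mapping.map ((*) c) p"
    by (simp add: Const_def mult_map_scale_conv_mult)
  then show ?thesis
    by (simp add: Poly_Mapping.map.rep_eq when_def)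
qed

text \<open>The linear extension of \<theta> from the monoid basis. It is kept apart from
  \<open>subst\<close> because it also serves the algebra of families, whose basis is not made of
  exponent vectors, and the map \<open>polarise\<close>, for which \<theta> is not
  multiplicative.\<close>

definition lift :: "('k \<Rightarrow> 'b) \<Rightarrow> ('a \<Rightarrow> 'b) \<Rightarrow> ('a \<Rightarrow>\<^sub>0 'k::comm_ring_1) \<Rightarrow> 'b::comm_ring_1" where
  "lift \<iota> \<theta> p = (\<Sum>t\<in>Poly_Mapping.keys p. \<iota> (Poly_Mapping.lookup p t) * \<theta> t)"

lemma lift_superset:
  assumes "\<iota> 0 = 0" "Poly_Mapping.keys p \<subseteq> S" "finite S"
  shows "lift \<iota> \<theta> p = (\<Sum>t\<in>S. \<iota> (Poly_Mapping.lookup p t) * \<theta> t)"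
  unfolding lift_def using assms by (intro sum.mono_neutral_left) (auto simp: in_keys_iff)

lemma lift_single:
  assumes "\<iota> 0 = 0"
  shows "lift \<iota> \<theta> (Poly_Mapping.single t c) = \<iota> c * \<theta> t"
  by (subst lift_superset[of \<iota> _ "{t}"]) (simp_all add: assms)

lemma lift_add:
  assumes "\<And>x y. \<iota> (x + y) = \<iota> x + \<iota> y"
  shows "lift \<iota> \<theta> (p + q) = lift \<iota> \<theta> p + lift \<iota> \<theta> q"
proof -
  have 0: "\<iota> 0 = 0"
    using assms[of 0 0] by simp
  define S where "S = Poly_Mapping.keys p \<union> Poly_Mapping.keys q"
  have "finite S" "Poly_Mapping.keys p \<subseteq> S" "Poly_Mapping.keys q \<subseteq> S"
    "Poly_Mapping.keys (p + q) \<subseteq> S"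
    using Poly_Mapping.keys_add[of p q] by (auto simp: S_def)
  then show ?thesis
    by (simp add: lift_superset[of \<iota> _ S, OF 0] lookup_add assms distrib_right sum.distrib)
qed

lemma lift_0: "lift \<iota> \<theta> 0 = 0"
  by (simp add: lift_def)

lemma lift_sum:
  assumes "\<And>x y. \<iota> (x + y) = \<iota> x + \<iota> y"
  shows "lift \<iota> \<theta> (\<Sum>i\<in>S. f i) = (\<Sum>i\<in>S. lift \<iota> \<theta> (f i))"
  by (induction S rule: infinite_finite_induct) (simp_all add: lift_0 lift_add assms)

lemma lift_rhom:
  fixes \<theta> :: "'a::comm_monoid_add \<Rightarrow> 'b::comm_ring_1"
  assumes \<iota>: "rhom \<iota>" and \<theta>: "\<theta> 0 = 1" "\<And>s t. \<theta> (s + t) = \<theta> s * \<theta> t"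
  shows "rhom (lift \<iota> \<theta>)"
proof
  interpret \<iota>: rhom \<iota> by fact
  have "(1 :: 'a \<Rightarrow>\<^sub>0 _) = Poly_Mapping.single 0 1"
    by simp
  then show "lift \<iota> \<theta> 1 = 1"
    by (metis lift_single \<iota>.zero \<iota>.one \<theta>(1) mult_1)
  fix p q
  show "lift \<iota> \<theta> (p + q) = lift \<iota> \<theta> p + lift \<iota> \<theta> q"
    by (simp add: lift_add \<iota>.add)
  have "p * q = (\<Sum>s\<in>Poly_Mapping.keys p. \<Sum>t\<in>Poly_Mapping.keys q.
      Poly_Mapping.single (s + t) (Poly_Mapping.lookup p s * Poly_Mapping.lookup q t))"
    by (subst poly_mapping_sum_single[of "Poly_Mapping.keys p" p], simp, simp,
        subst poly_mapping_sum_single[of "Poly_Mapping.keys q" q], simp, simp)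
       (simp add: sum_product mult_single)
  then show "lift \<iota> \<theta> (p * q) = lift \<iota> \<theta> p * lift \<iota> \<theta> q"
    by (simp add: lift_sum \<iota>.add lift_single \<iota>.zero \<iota>.mult \<theta> lift_def[of \<iota> \<theta> p]
        lift_def[of \<iota> \<theta> q] sum_product mult_ac)
qed

definition mono_eval :: "('v \<Rightarrow> 'b::comm_ring_1) \<Rightarrow> ('v \<Rightarrow>\<^sub>0 nat) \<Rightarrow> 'b" where
  "mono_eval f t = (\<Prod>v\<in>Poly_Mapping.keys t. f v ^ Poly_Mapping.lookup t v)"

lemma subst_eq_lift: "subst \<iota> f = lift \<iota> (mono_eval f)"
  by (simp add: fun_eq_iff subst_def lift_def mono_eval_def)

lemma mono_eval_superset:
  assumes "finite S" "Poly_Mapping.keys t \<subseteq> S"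
  shows "mono_eval f t = (\<Prod>v\<in>S. f v ^ Poly_Mapping.lookup t v)"
  unfolding mono_eval_def using assms by (intro prod.mono_neutral_left) (auto simp: in_keys_iff)

lemma mono_eval_0 [simp]: "mono_eval f 0 = 1"
  by (simp add: mono_eval_def)

lemma mono_eval_add: "mono_eval f (s + t) = mono_eval f s * mono_eval f t"
proof -
  define S where "S = Poly_Mapping.keys s \<union> Poly_Mapping.keys t"
  have "finite S" "Poly_Mapping.keys s \<subseteq> S" "Poly_Mapping.keys t \<subseteq> S"
    "Poly_Mapping.keys (s + t) \<subseteq> S"
    using Poly_Mapping.keys_add[of s t] by (auto simp: S_def)
  then show ?thesis
    by (simp add: mono_eval_superset[of S] lookup_add power_add prod.distrib)
qed

lemma mono_eval_single: "mono_eval f (Poly_Mapping.single v n) = f v ^ n"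
  by (subst mono_eval_superset[of "{v}"]) simp_all

lemma subst_rhom: "rhom \<iota> \<Longrightarrow> rhom (subst \<iota> f)"
  unfolding subst_eq_lift by (rule lift_rhom) (simp_all add: mono_eval_add)

lemma subst_Const [simp]: "rhom \<iota> \<Longrightarrow> subst \<iota> f (Const c) = \<iota> c"
  by (simp add: subst_eq_lift Const_def lift_single rhom.zero)

lemma subst_Var [simp]: "rhom \<iota> \<Longrightarrow> subst \<iota> f (Var v) = f v"
  by (simp add: subst_eq_lift Var_def lift_single rhom.zero rhom.one mono_eval_single)

lemma single_Suc_eq_mult_Var:
  "Poly_Mapping.single (t + Poly_Mapping.single v (1::nat)) (c :: 'k::comm_ring_1) =
    Poly_Mapping.single t c * Var v"
  by (simp add: Var_def mult_single)

lemma exponent_induct [case_names 0 Suc]: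
  fixes t :: "'v \<Rightarrow>\<^sub>0 nat"
  assumes "P 0" and step: "\<And>t v. P t \<Longrightarrow> P (t + Poly_Mapping.single v 1)"
  shows "P t"
proof (induction "\<Sum>v\<in>Poly_Mapping.keys t. Poly_Mapping.lookup t v" arbitrary: t)
  case 0
  then have "t = 0"
    by (auto simp: in_keys_iff intro!: poly_mapping_eqI)
  then show ?case
    using assms by simp
next
  case (Suc n)
  then obtain v where v: "v \<in> Poly_Mapping.keys t"
    by (metis old.nat.distinct(2) sum.neutral)
  define u where "u = t - Poly_Mapping.single v 1"
  have t: "t = u + Poly_Mapping.single v 1"
    using v by (intro poly_mapping_eqI)
      (auto simp: u_def lookup_add lookup_minus lookup_single when_def in_keys_iff)
  have sub: "Poly_Mapping.keys u \<subseteq> Poly_Mapping.keys t"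
    by (auto simp: t in_keys_iff lookup_add)
  have "(\<Sum>w\<in>Poly_Mapping.keys t. Poly_Mapping.lookup t w) =
      (\<Sum>w\<in>Poly_Mapping.keys t. Poly_Mapping.lookup u w + (if w = v then 1 else 0))"
    by (rule sum.cong) (auto simp: t lookup_add lookup_single when_def)
  also have "\<dots> = (\<Sum>w\<in>Poly_Mapping.keys t. Poly_Mapping.lookup u w) + 1"
    using v by (simp add: sum.distrib)
  also have "(\<Sum>w\<in>Poly_Mapping.keys t. Poly_Mapping.lookup u w) =
      (\<Sum>w\<in>Poly_Mapping.keys u. Poly_Mapping.lookup u w)"
    using sub by (intro sum.mono_neutral_right) (auto simp: in_keys_iff)
  finally have "n = (\<Sum>w\<in>Poly_Mapping.keys u. Poly_Mapping.lookup u w)"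
    using Suc.hyps(2) by simp
  then have "P u"
    by (rule Suc.hyps(1))
  then show ?case
    unfolding t by (rule step)
qed

lemma mpoly_induct [case_names Const add Var]:
  fixes p :: "('v, 'k::comm_ring_1) mpoly"
  assumes "\<And>c. P (Const c)" and "\<And>p q. P p \<Longrightarrow> P q \<Longrightarrow> P (p + q)"
    and "\<And>p v. P p \<Longrightarrow> P (p * Var v)"
  shows "P p"
proof -
  have single: "P (Poly_Mapping.single t c)" for t c
    using assms(1)[of c]
  proof (induction t rule: exponent_induct)
    case 0
    then show ?case by (simp add: Const_def)
  next
    case (Suc t v)
    then show ?case
      by (simp only: single_Suc_eq_mult_Var assms(3))
  qed
  have "P (\<Sum>t\<in>S. Poly_Mapping.single t (Poly_Mapping.lookup p t))" if "finite S" for S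
    using that
  proof (induction S)
    case empty
    then show ?case
      using assms(1)[of 0] by simp
  next
    case (insert t S)
    then show ?case
      by (simp add: assms(2) single)
  qed
  then have "P (\<Sum>t\<in>Poly_Mapping.keys p. Poly_Mapping.single t (Poly_Mapping.lookup p t))"
    by simp
  then show ?thesis
    using poly_mapping_sum_single[of "Poly_Mapping.keys p" p] by simp
qed

lemma mpoly_hom_eqI:
  fixes \<phi> :: "('v, 'k::comm_ring_1) mpoly \<Rightarrow> 'b::comm_ring_1"
  assumes "rhom \<phi>" "rhom \<psi>" and "\<And>c. \<phi> (Const c) = \<psi> (Const c)" "\<And>v. \<phi> (Var v) = \<psi> (Var v)"
  shows "\<phi> = \<psi>"
proof
  fix p
  show "\<phi> p = \<psi> p"
    by (induction p rule: mpoly_induct) (simp_all add: assms rhom.add rhom.mult)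
qed

section \<open>Quotients of rings given by types\<close>

abbreviation (input) type_ring :: "'a::comm_ring_1 ring" where
  "type_ring \<equiv> ring_of_type_algebra"

lemma type_ring_simps [simp]:
  "carrier type_ring = UNIV" "mult type_ring = (*)" "one type_ring = 1"
  "zero type_ring = 0" "add type_ring = (+)"
  by (simp_all add: ring_of_type_algebra_def)

lemma type_ring_cring: "cring (type_ring :: 'a::comm_ring_1 ring)"
  by (rule cring_from_type_algebra)

lemma type_ring_a_inv [simp]: "a_inv type_ring x = - (x :: 'a::comm_ring_1)"
proof -
  interpret R: cring "type_ring :: 'a ring"
    by (rule type_ring_cring)
  show ?thesis
    using R.minus_equality[of "- x" x] by simp
qed

lemma idealI_type:
  assumes "0 \<in> J" "\<And>x y. x \<in> J \<Longrightarrow> y \<in> J \<Longrightarrow> x + y \<in> J" "\<And>x r. x \<in> J \<Longrightarrow> r * x \<in> J"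
  shows "ideal J (type_ring :: 'a::comm_ring_1 ring)"
proof (rule idealI)
  show "Ring.ring (type_ring :: 'a ring)"
    by (rule ring_from_type_algebra)
  show "subgroup J (add_monoid (type_ring :: 'a ring))"
  proof
    fix x assume "x \<in> J"
    then have "- x \<in> J"
      using assms(3)[of x "- 1"] by simp
    then show "m_inv (add_monoid type_ring) x \<in> J"
      using type_ring_a_inv[of x] by (simp add: a_inv_def)
  qed (use assms in auto)
qed (use assms in \<open>auto simp: mult.commute\<close>)

text \<open>Moves the arithmetic of ideals from ring records to the type class operations; the
  record structure reappears only in the facts about cosets and quotients.\<close>

locale type_ideal =
  fixes J :: "'a::comm_ring_1 set"
  assumes is_ideal: "ideal J type_ring"
begin

lemma zero_mem: "0 \<in> J"
proof -
  interpret ideal J type_ring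
    by (rule is_ideal)
  show ?thesis
    using additive_subgroup.zero_closed[OF is_additive_subgroup] by simp
qed

lemma add_mem: "x \<in> J \<Longrightarrow> y \<in> J \<Longrightarrow> x + y \<in> J"
  using additive_subgroup.a_closed[OF ideal.axioms(1)[OF is_ideal]] by simp

lemma mult_mem: "x \<in> J \<Longrightarrow> r * x \<in> J"
  using ideal.I_l_closed[OF is_ideal] by simp

lemma mult_mem_right: "x \<in> J \<Longrightarrow> x * r \<in> J"
  using ideal.I_r_closed[OF is_ideal] by simp

lemma uminus_mem: "x \<in> J \<Longrightarrow> - x \<in> J"
  using mult_mem[of x "- 1"] by simp

lemma diff_mem: "x \<in> J \<Longrightarrow> y \<in> J \<Longrightarrow> x - y \<in> J"
  using add_mem[of x "- y"] uminus_mem by simp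

lemma sum_mem: "(\<And>i. i \<in> S \<Longrightarrow> f i \<in> J) \<Longrightarrow> sum f S \<in> J"
  by (induction S rule: infinite_finite_induct) (auto simp: zero_mem add_mem)

lemma diff_trans: "x - y \<in> J \<Longrightarrow> y - z \<in> J \<Longrightarrow> x - z \<in> J"
  using add_mem[of "x - y" "y - z"] by simp

lemma diff_sym: "x - y \<in> J \<Longrightarrow> y - x \<in> J"
  using uminus_mem[of "x - y"] by simp

lemma mem_cong: "x - y \<in> J \<Longrightarrow> x \<in> J \<longleftrightarrow> y \<in> J"
  using diff_mem[of x "x - y"] add_mem[of "x - y" y] by auto

lemma diff_mult: "x - y \<in> J \<Longrightarrow> x' - y' \<in> J \<Longrightarrow> x * x' - y * y' \<in> J"
  using add_mem[OF mult_mem[of "x' - y'" x] mult_mem[of "x - y" y']]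
  by (simp add: algebra_simps)

lemma diff_prod: "(\<And>i. i \<in> S \<Longrightarrow> f i - g i \<in> J) \<Longrightarrow> prod f S - prod g S \<in> J"
  by (induction S rule: infinite_finite_induct) (auto simp: zero_mem diff_mult)

lemma diff_sum: "(\<And>i. i \<in> S \<Longrightarrow> f i - g i \<in> J) \<Longrightarrow> sum f S - sum g S \<in> J"
  using sum_mem[of S "\<lambda>i. f i - g i"] by (simp add: sum_subtractf)

lemma diff_det:
  fixes M N :: "'a^'n^'n"
  assumes "\<And>i j. M $ i $ j - N $ i $ j \<in> J"
  shows "det M - det N \<in> J"
  unfolding det_def
  by (intro diff_sum diff_mult diff_prod assms) (simp add: zero_mem)

abbreviation coset :: "'a \<Rightarrow> 'a set" where
  "coset x \<equiv> J +>\<^bsub>type_ring\<^esub> x"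

lemma mem_coset: "y \<in> coset x \<longleftrightarrow> y - x \<in> J"
  by (auto simp: a_r_coset_def r_coset_def) (metis add_diff_cancel diff_add_cancel)

lemma coset_eq_iff: "coset x = coset y \<longleftrightarrow> x - y \<in> J"
proof
  assume "coset x = coset y"
  then have "x \<in> coset y"
    using mem_coset[of x x] zero_mem by simp
  then show "x - y \<in> J"
    by (simp add: mem_coset)
next
  assume "x - y \<in> J"
  then have "y - x \<in> J"
    using uminus_mem by fastforce
  show "coset x = coset y"
    using add_mem[OF _ \<open>x - y \<in> J\<close>] add_mem[OF _ \<open>y - x \<in> J\<close>] by (auto simp: mem_coset) fastforce+
qed

lemma quot_carrier: "carrier (type_ring Quot J) = range coset"
  by (auto simp: FactRing_def A_RCOSETS_def RCOSETS_def a_r_coset_def)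

lemma quot_mult: "mult (type_ring Quot J) (coset x) (coset y) = coset (x * y)"
proof -
  interpret ideal J type_ring
    by (rule is_ideal)
  show ?thesis
    using rcoset_mult_add[of x y] by (simp add: FactRing_simps)
qed

lemma quot_add: "add (type_ring Quot J) (coset x) (coset y) = coset (x + y)"
proof -
  interpret ideal J type_ring
    by (rule is_ideal)
  show ?thesis
    using a_rcos_sum[of x y] by (simp add: FactRing_simps)
qed

lemma quot_one: "one (type_ring Quot J) = coset 1"
  by (simp add: FactRing_simps)

lemma quot_zero: "zero (type_ring Quot J) = coset 0"
proof -
  have "coset 0 = J"
    by (auto simp: mem_coset)
  then show ?thesis
    by (simp add: FactRing_simps)
qed

lemma quot_pow: "coset x [^]\<^bsub>type_ring Quot J\<^esub> (n::nat) = coset (x ^ n)"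
proof -
  interpret Q: cring "type_ring Quot J"
    by (rule ideal.quotient_is_cring[OF is_ideal type_ring_cring])
  show ?thesis
  proof (induction n)
    case 0
    show ?case
      by (simp only: Q.nat_pow_0 quot_one power_0)
  next
    case (Suc n)
    then show ?case
      by (simp only: Q.nat_pow_Suc quot_mult power_Suc2)
  qed
qed

lemma on_cosets_coset:
  assumes "\<And>y. y - x \<in> J \<Longrightarrow> h y = h x"
  shows "on_cosets h (coset x) = h x"
proof -
  have "h ` coset x = {h x}"
  proof (intro equalityI subsetI)
    fix z assume "z \<in> h ` coset x"
    then obtain y where "y - x \<in> J" "z = h y"
      by (auto simp: mem_coset)
    then show "z \<in> {h x}"
      using assms[of y] by simp
  next
    have "x \<in> coset x"
      by (simp add: mem_coset zero_mem)
    then show "z \<in> h ` coset x" if "z \<in> {h x}" for z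
      using that by blast
  qed
  then show ?thesis
    by (simp add: on_cosets_def)
qed

text \<open>Stability of \<open>J\<close> under \<phi> gives only one inclusion; the other one comes
  from the inverse \<psi>, which has to preserve \<open>J\<close> as well.\<close>

lemma image_coset:
  assumes "rhom \<phi>" "\<And>x. \<phi> (\<psi> x) = x" "\<And>x. x \<in> J \<Longrightarrow> \<phi> x \<in> J" "\<And>x. x \<in> J \<Longrightarrow> \<psi> x \<in> J"
    "rhom \<psi>" "\<And>x. \<psi> (\<phi> x) = x"
  shows "\<phi> ` coset x = coset (\<phi> x)"
proof (intro equalityI subsetI)
  fix y assume "y \<in> \<phi> ` coset x"
  then show "y \<in> coset (\<phi> x)"
    using assms(3) by (auto simp: mem_coset rhom.diff[OF assms(1), symmetric])
next
  fix y assume "y \<in> coset (\<phi> x)"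
  then have "\<psi> y \<in> coset x"
    using assms(4)[of "y - \<phi> x"] by (simp add: mem_coset rhom.diff[OF assms(5)] assms(6))
  then show "y \<in> \<phi> ` coset x"
    using assms(2)[of y] by (metis imageI)
qed

end

section \<open>Monomials in matrices\<close>

primrec mpow :: "'a::comm_ring_1^'n^'n \<Rightarrow> nat \<Rightarrow> 'a^'n^'n" where
  "mpow M 0 = mat 1"
| "mpow M (Suc n) = M ** mpow M n"

primrec list_monomial :: "('m \<Rightarrow> 'a::comm_ring_1^'n^'n) \<Rightarrow> ('m \<Rightarrow> nat) \<Rightarrow> 'm list \<Rightarrow> 'a^'n^'n" where
  "list_monomial U e [] = mat 1"
| "list_monomial U e (k # ks) = mpow (U k) (e k) ** list_monomial U e ks"

definition enumeration :: "'m::finite list" where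
  "enumeration = (SOME ks. distinct ks \<and> set ks = UNIV)"

lemma enumeration: "distinct (enumeration :: 'm::finite list)" "set enumeration = (UNIV :: 'm set)"
proof -
  obtain ks :: "'m list" where "set ks = UNIV \<and> distinct ks"
    using finite_distinct_list[of "UNIV :: 'm set"] by auto
  then have "distinct (enumeration :: 'm list) \<and> set enumeration = (UNIV :: 'm set)"
    unfolding enumeration_def by (intro someI_ex[of "\<lambda>ks. distinct ks \<and> set ks = UNIV"]) blast
  then show "distinct (enumeration :: 'm list)" "set enumeration = (UNIV :: 'm set)"
    by simp_all
qed

text \<open>The matrices need not commute; their product is taken in a fixed order.\<close>
definition monomial :: "('m::finite \<Rightarrow> 'a::comm_ring_1^'n^'n) \<Rightarrow> ('m \<Rightarrow> nat) \<Rightarrow> 'a^'n^'n" where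
  "monomial U e = list_monomial U e enumeration"

lemma map_matrix_monomial:
  fixes U :: "'m::finite \<Rightarrow> 'a::comm_ring_1^'d^'d"
  assumes "rhom \<phi>"
  shows "map_matrix \<phi> (monomial U e) = monomial (\<lambda>k. map_matrix \<phi> (U k)) e"
proof -
  interpret rhom \<phi> by fact
  have pow: "map_matrix \<phi> (mpow M n) = mpow (map_matrix \<phi> M) n" for M :: "'a^'d^'d" and n
    by (induction n) (simp_all add: map_matrix_one map_matrix_mult)
  have "map_matrix \<phi> (list_monomial U e ks) = list_monomial (\<lambda>k. map_matrix \<phi> (U k)) e ks" for ks
    by (induction ks) (simp_all add: map_matrix_one map_matrix_mult pow)
  then show ?thesis
    by (simp add: monomial_def)
qed

lemma conj_mult:
  fixes g h :: "'a::comm_ring_1^'n^'n"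
  assumes "g ** h = mat 1"
  shows "(h ** M ** g) ** (h ** N ** g) = h ** (M ** N) ** g"
proof -
  have "(h ** M ** g) ** (h ** N ** g) = h ** M ** (g ** h) ** N ** g"
    by (simp add: matrix_mul_assoc)
  then show ?thesis
    by (simp add: assms matrix_mul_assoc)
qed

lemma monomial_conj:
  fixes g h :: "'a::comm_ring_1^'n^'n"
  assumes "g ** h = mat 1" "h ** g = mat 1"
  shows "monomial (\<lambda>k. h ** U k ** g) e = h ** monomial U e ** g"
proof -
  have pow: "mpow (h ** M ** g) n = h ** mpow M n ** g" for M n
    by (induction n) (simp_all add: assms conj_mult)
  have "list_monomial (\<lambda>k. h ** U k ** g) e ks = h ** list_monomial U e ks ** g" for ks
    by (induction ks) (simp_all add: assms conj_mult pow)
  then show ?thesis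
    by (simp add: monomial_def)
qed

definition diag_mat :: "('n \<Rightarrow> 'a::zero) \<Rightarrow> 'a^'n^'n" where
  "diag_mat d = (\<chi> i j. if i = j then d i else 0)"

lemma diag_mat_mult: "diag_mat c ** diag_mat d = (diag_mat (\<lambda>i. c i * d i) :: 'a::comm_ring_1^'n^'n)"
  by (simp add: diag_mat_def matrix_matrix_mult_def vec_eq_iff if_distrib[of "\<lambda>x. x * _"] cong: if_cong)

lemma diag_mat_one: "diag_mat (\<lambda>_. 1) = (mat 1 :: 'a::comm_ring_1^'n^'n)"
  by (simp add: diag_mat_def mat_def)

lemma monomial_diag:
  fixes d :: "'m::finite \<Rightarrow> 'n::finite \<Rightarrow> 'a::comm_ring_1"
  shows "monomial (\<lambda>k. diag_mat (d k)) e = diag_mat (\<lambda>i. \<Prod>k\<in>UNIV. d k i ^ e k)"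
proof -
  have pow: "mpow (diag_mat c) n = diag_mat (\<lambda>i. c i ^ n)" for c :: "'n \<Rightarrow> 'a" and n
    by (induction n) (simp_all add: diag_mat_one diag_mat_mult)
  have "list_monomial (\<lambda>k. diag_mat (d k)) e ks = diag_mat (\<lambda>i. \<Prod>k\<leftarrow>ks. d k i ^ e k)" for ks
    by (induction ks) (simp_all add: diag_mat_one diag_mat_mult pow)
  moreover have "(\<Prod>k\<leftarrow>enumeration. d k i ^ e k) = (\<Prod>k\<in>UNIV. d k i ^ e k)" for i
    using prod.distinct_set_conv_list[OF enumeration(1), of "\<lambda>k. d k i ^ e k"]
    by (simp only: enumeration(2))
  ultimately show ?thesis
    by (simp add: monomial_def)
qed

section \<open>Invariants from polarised determinants\<close>

text \<open>Fixed points have an assumption of their own because \<open>F x = - F x\<close> does not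
  imply \<open>F x = 0\<close> in characteristic two.\<close>

lemma sum_involution_zero:
  fixes F :: "'b \<Rightarrow> 'a::ab_group_add"
  assumes "finite S" "\<And>x. x \<in> S \<Longrightarrow> \<tau> x \<in> S" "\<And>x. x \<in> S \<Longrightarrow> \<tau> (\<tau> x) = x"
    "\<And>x. x \<in> S \<Longrightarrow> F (\<tau> x) = - F x" "\<And>x. x \<in> S \<Longrightarrow> \<tau> x = x \<Longrightarrow> F x = 0"
  shows "sum F S = 0"
  using assms
proof (induction S rule: finite_psubset_induct)
  case (psubset S)
  show ?case
  proof (cases "S = {}")
    case False
    then obtain x where x: "x \<in> S"
      by blast
    define S' where "S' = S - {x, \<tau> x}"
    have S: "S = {x, \<tau> x} \<union> S'" "{x, \<tau> x} \<inter> S' = {}"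
      using x psubset.prems(1) by (auto simp: S'_def)
    have closed: "\<tau> y \<in> S'" if "y \<in> S'" for y
      using that psubset.prems(1,2) x unfolding S'_def by (metis Diff_iff insert_iff empty_iff)
    have "sum F S' = 0"
      by (rule psubset.IH) (use x closed psubset.prems in \<open>auto simp: S'_def\<close>)
    moreover have "sum F {x, \<tau> x} = 0"
      using psubset.prems(3,4)[OF x] by (cases "\<tau> x = x") auto
    moreover have "finite S'"
      using psubset.hyps by (simp add: S'_def)
    then have "sum F ({x, \<tau> x} \<union> S') = sum F {x, \<tau> x} + sum F S'"
      using S(2) by (intro sum.union_disjoint) auto
    then have "sum F S = sum F {x, \<tau> x} + sum F S'"
      using S(1) by argo
    ultimately show ?thesis
      by simp
  qed simp
qed

text \<open>As a function of the row choice \<open>f\<close> the sum is alternating. A permutation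
  \<open>f\<close> is absorbed by reindexing \<open>b\<close>. If \<open>f i = f j\<close> with i
  and j distinct, the transposition of i and j leaves \<open>f\<close> unchanged and reverses the
  sign of each determinant, so \<open>b\<close> cancels against \<open>b \<circ> \<tau>\<close>;
  where these coincide, two rows are equal.\<close>

lemma sum_det_rows:
  fixes N :: "'b \<Rightarrow> 'a::comm_ring_1^'n^'n"
  assumes "finite S" and closed: "\<And>b \<sigma>. b \<in> S \<Longrightarrow> \<sigma> permutes UNIV \<Longrightarrow> b \<circ> \<sigma> \<in> S"
  shows "(\<Sum>b\<in>S. det (\<chi> i. N (b i) $ f i)) =
    (if f permutes UNIV then of_int (sign f) * (\<Sum>b\<in>S. det (\<chi> i. N (b i) $ i)) else 0)"
proof (cases "f permutes UNIV")
  case True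
  have "(\<Sum>b\<in>S. det (\<chi> i. N (b i) $ f i)) = (\<Sum>b\<in>S. det (\<chi> i. N ((b \<circ> f) i) $ f i))"
    by (rule sum.reindex_bij_witness[of _ "\<lambda>b. b \<circ> f" "\<lambda>b. b \<circ> inv f"])
      (simp_all add: closed True permutes_inv[OF True] comp_assoc permutes_inv_o[OF True] permutes_inverses[OF True])
  also have "\<dots> = (\<Sum>b\<in>S. of_int (sign f) * det (\<chi> i. N (b i) $ i))"
  proof (rule sum.cong[OF refl])
    fix b
    show "det (\<chi> i. N ((b \<circ> f) i) $ f i) = of_int (sign f) * det (\<chi> i. N (b i) $ i)"
      using det_permute_rows[OF True, of "\<chi> i. N (b i) $ i"] by simp
  qed
  finally show ?thesis
    using True by (simp add: sum_distrib_left)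
next
  case False
  have "\<not> inj f"
  proof
    assume "inj f"
    then have "bij f"
      using finite_UNIV_inj_surj[of f] by (simp add: bij_def)
    then show False
      using False bij_imp_permutes[of f UNIV] by simp
  qed
  then obtain i j where ij: "f i = f j" "i \<noteq> j"
    by (auto simp: inj_def)
  define \<tau> where "\<tau> = Transposition.transpose i j"
  have \<tau>: "\<tau> permutes UNIV" "\<tau> \<circ> \<tau> = id" "f \<circ> \<tau> = f" "sign \<tau> = -1"
    using ij by (auto simp: \<tau>_def permutes_swap_id fun_eq_iff Transposition.transpose_def sign_swap_id)
  have "(\<Sum>b\<in>S. det (\<chi> i. N (b i) $ f i)) = 0"
  proof (rule sum_involution_zero[where \<tau> = "\<lambda>b. b \<circ> \<tau>"])
    show "finite S"
      by fact
    fix b assume b: "b \<in> S"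
    show "b \<circ> \<tau> \<in> S"
      using closed b \<tau> by simp
    show "b \<circ> \<tau> \<circ> \<tau> = b"
      by (simp add: comp_assoc \<tau>)
    have "f (\<tau> i) = f i" for i
      using \<tau>(3) by (metis comp_apply)
    then show "det (\<chi> i. N ((b \<circ> \<tau>) i) $ f i) = - det (\<chi> i. N (b i) $ f i)"
      using det_permute_rows[OF \<tau>(1), of "\<chi> i. N (b i) $ f i"] \<tau>(4) by simp
    assume "b \<circ> \<tau> = b"
    then have "b i = b j"
      by (metis \<tau>_def comp_apply transpose_apply_first)
    then show "det (\<chi> i. N (b i) $ f i) = 0"
      using ij by (intro det_identical_rows[of i j]) (simp_all add: row_def vec_eq_iff)
  qed
  with False show ?thesis
    by simp
qed

text \<open>The rows belong to different matrices, so the determinant is not that of a conjugate.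
  The factor \<open>g\<close> acts on all rows alike and gives \<open>det g\<close>. The factor
  \<open>h\<close> is expanded row by row; by \<open>sum_det_rows\<close> only the permutations
  among the row choices survive and they add up to \<open>det h\<close>.\<close>

lemma sum_det_rows_conj:
  fixes N :: "'b \<Rightarrow> 'a::comm_ring_1^'n^'n"
  assumes S: "finite S" "\<And>b \<sigma>. b \<in> S \<Longrightarrow> \<sigma> permutes UNIV \<Longrightarrow> b \<circ> \<sigma> \<in> S" and hg: "h ** g = mat 1"
  shows "(\<Sum>b\<in>S. det (\<chi> i. (h ** N (b i) ** g) $ i)) = (\<Sum>b\<in>S. det (\<chi> i. N (b i) $ i))"
proof -
  have row: "det (\<chi> i. (h ** N (b i) ** g) $ i) =
      (\<Sum>f\<in>UNIV. (\<Prod>i\<in>UNIV. h $ i $ f i) * det (\<chi> i. N (b i) $ f i)) * det g" for b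
  proof -
    have "(\<chi> i. (h ** N (b i) ** g) $ i) $ i $ j = ((\<chi> i. \<Sum>r\<in>UNIV. h $ i $ r *s N (b i) $ r) ** g) $ i $ j"
      for i j
      by (simp add: matrix_matrix_mult_def)
    then have "(\<chi> i. (h ** N (b i) ** g) $ i) = (\<chi> i. \<Sum>r\<in>UNIV. h $ i $ r *s N (b i) $ r) ** g"
      by (simp only: vec_eq_iff) blast
    then have "det (\<chi> i. (h ** N (b i) ** g) $ i) =
        det (\<chi> i. \<Sum>r\<in>UNIV. h $ i $ r *s N (b i) $ r) * det g"
      by (simp add: det_mul)
    also have "det (\<chi> i. \<Sum>r\<in>UNIV. h $ i $ r *s N (b i) $ r) =
        (\<Sum>f\<in>UNIV. (\<Prod>i\<in>UNIV. h $ i $ f i) * det (\<chi> i. N (b i) $ f i))"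
      by (subst det_linear_rows_sum[OF finite_class.finite_UNIV], subst det_rows_mul) simp
    finally show ?thesis .
  qed
  have "(\<Sum>b\<in>S. det (\<chi> i. (h ** N (b i) ** g) $ i)) =
      (\<Sum>f\<in>UNIV. (\<Prod>i\<in>UNIV. h $ i $ f i) * (\<Sum>b\<in>S. det (\<chi> i. N (b i) $ f i))) * det g"
  proof -
    have "(\<Sum>f\<in>UNIV. (\<Prod>i\<in>UNIV. h $ i $ f i) * (\<Sum>b\<in>S. det (\<chi> i. N (b i) $ f i))) =
        (\<Sum>b\<in>S. \<Sum>f\<in>UNIV. (\<Prod>i\<in>UNIV. h $ i $ f i) * det (\<chi> i. N (b i) $ f i))"
      by (subst sum.swap) (simp add: sum_distrib_left)
    then show ?thesis
      unfolding row by (simp only: sum_distrib_right)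
  qed
  also have "(\<Sum>f\<in>UNIV. (\<Prod>i\<in>UNIV. h $ i $ f i) * (\<Sum>b\<in>S. det (\<chi> i. N (b i) $ f i))) =
      (\<Sum>f | f permutes UNIV. (\<Prod>i\<in>UNIV. h $ i $ f i) * (\<Sum>b\<in>S. det (\<chi> i. N (b i) $ f i)))"
    by (rule sum.mono_neutral_right) (auto simp: sum_det_rows[OF S])
  also have "\<dots> = (\<Sum>f | f permutes UNIV. of_int (sign f) * (\<Prod>i\<in>UNIV. h $ i $ f i) *
      (\<Sum>b\<in>S. det (\<chi> i. N (b i) $ i)))"
    by (rule sum.cong) (simp_all add: sum_det_rows[OF S] mult_ac)
  also have "\<dots> = det h * (\<Sum>b\<in>S. det (\<chi> i. N (b i) $ i))"
    unfolding det_def[of h] by (rule sum_distrib_right[symmetric])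
  also have "det h * (\<Sum>b\<in>S. det (\<chi> i. N (b i) $ i)) * det g =
      det (h ** g) * (\<Sum>b\<in>S. det (\<chi> i. N (b i) $ i))"
    by (simp add: det_mul mult_ac)
  finally show ?thesis
    by (simp add: hg)
qed

text \<open>A set and not a family over all permutations: every rearrangement occurs once, whatever
  the stabiliser of \<open>a\<close>. A sum over all permutations would carry the order of the
  stabiliser as a factor, which may be zero in the coefficient ring.\<close>

definition orbit :: "('n::finite \<Rightarrow> 'b) \<Rightarrow> ('n \<Rightarrow> 'b) set" where
  "orbit a = {a \<circ> \<sigma> | \<sigma>. \<sigma> permutes UNIV}"

lemma orbit_finite: "finite (orbit a)"
proof -
  have "orbit a = (\<lambda>\<sigma>. a \<circ> \<sigma>) ` {\<sigma>. \<sigma> permutes UNIV}"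
    by (auto simp: orbit_def)
  then show ?thesis
    by (simp add: finite_permutations)
qed

lemma orbit_self: "a \<in> orbit a"
  unfolding orbit_def using permutes_id by (metis (mono_tags, lifting) comp_id mem_Collect_eq)

lemma orbit_closed: "b \<in> orbit a \<Longrightarrow> \<sigma> permutes UNIV \<Longrightarrow> b \<circ> \<sigma> \<in> orbit a"
proof -
  assume "b \<in> orbit a" "\<sigma> permutes UNIV"
  then obtain \<tau> where \<tau>: "\<tau> permutes UNIV" "b = a \<circ> \<tau>"
    by (auto simp: orbit_def)
  then have "b \<circ> \<sigma> = a \<circ> (\<tau> \<circ> \<sigma>)" "\<tau> \<circ> \<sigma> permutes UNIV"
    using \<open>\<sigma> permutes UNIV\<close> by (simp_all add: comp_assoc permutes_compose)
  then show "b \<circ> \<sigma> \<in> orbit a"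
    by (auto simp: orbit_def)
qed

definition orbit_det :: "('m::finite \<Rightarrow> 'a::comm_ring_1^'n^'n) \<Rightarrow> ('n \<Rightarrow> 'm \<Rightarrow> nat) \<Rightarrow> 'a" where
  "orbit_det U a = (\<Sum>b\<in>orbit a. det (\<chi> i. monomial U (b i) $ i))"

lemma orbit_det_conj:
  assumes "g ** h = mat 1" "h ** g = mat 1"
  shows "orbit_det (\<lambda>k. h ** U k ** g) a = orbit_det U a"
  unfolding orbit_det_def monomial_conj[OF assms]
  by (rule sum_det_rows_conj[OF orbit_finite orbit_closed assms(2)])

lemma orbit_det_hom:
  assumes "rhom \<phi>"
  shows "\<phi> (orbit_det U a) = orbit_det (\<lambda>k. map_matrix \<phi> (U k)) a"
proof -
  interpret rhom \<phi> by fact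
  have "map_matrix \<phi> (\<chi> i. monomial U (b i) $ i) = (\<chi> i. map_matrix \<phi> (monomial U (b i)) $ i)" for b
    by (simp add: vec_eq_iff)
  then show ?thesis
    by (simp add: orbit_det_def sum det map_matrix_monomial[OF assms])
qed

lemma orbit_det_diag:
  fixes d :: "'m::finite \<Rightarrow> 'n::finite \<Rightarrow> 'a::comm_ring_1"
  shows "orbit_det (\<lambda>k. diag_mat (d k)) a = (\<Sum>b\<in>orbit a. \<Prod>i\<in>UNIV. \<Prod>k\<in>UNIV. d k i ^ b i k)"
proof -
  have "det (\<chi> i. diag_mat (D i) $ i) = (\<Prod>i\<in>UNIV. D i i)" for D :: "'n \<Rightarrow> 'n \<Rightarrow> 'a"
    by (subst det_diagonal) (simp_all add: diag_mat_def)
  then show ?thesis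
    by (simp add: orbit_det_def monomial_diag)
qed

section \<open>The action of the general linear group\<close>

lemma matrix_inv_unique:
  fixes g h :: "'a::comm_ring_1^'n^'n"
  assumes "g ** h = mat 1" "h ** g = mat 1"
  shows "matrix_inv g = h"
proof -
  have "g ** matrix_inv g = mat 1 \<and> matrix_inv g ** g = mat 1"
    unfolding matrix_inv_def by (rule someI[of _ h]) (use assms in simp)
  then show ?thesis
    by (metis assms(2) matrix_mul_assoc matrix_mul_lid matrix_mul_rid)
qed

lemma matrix_inv_GL:
  assumes "g \<in> (GL :: ('k::comm_ring_1^'n^'n) set)"
  shows "g ** matrix_inv g = mat 1" "matrix_inv g ** g = mat 1"
proof -
  obtain h where "g ** h = mat 1" "h ** g = mat 1"
    using assms by (auto simp: GL_def invertible_def)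
  then show "g ** matrix_inv g = mat 1" "matrix_inv g ** g = mat 1"
    using matrix_inv_unique by metis+
qed

lemma GL_I:
  fixes g h :: "'k::comm_ring_1^'n^'n"
  assumes "g ** h = mat 1" "h ** g = mat 1"
  shows "g \<in> GL"
  using assms by (auto simp: GL_def invertible_def)

lemma matrix_inv_in_GL: "g \<in> GL \<Longrightarrow> matrix_inv g \<in> GL"
  using matrix_inv_GL GL_I by metis

lemma matrix_inv_matrix_inv: "g \<in> GL \<Longrightarrow> matrix_inv (matrix_inv g) = g"
  using matrix_inv_GL matrix_inv_unique by metis

lemma GL_act_rhom: "rhom (GL_act g)"
  unfolding GL_act_def by (rule subst_rhom[OF Const_rhom])

lemma GL_act_Const [simp]: "GL_act g (Const c) = Const c"
  by (simp add: GL_act_def Const_rhom)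

lemma GL_act_generic:
  "map_matrix (GL_act g) (generic_matrix k) =
    map_matrix Const (matrix_inv g) ** generic_matrix k ** map_matrix Const g"
  by (simp add: vec_eq_iff generic_matrix_def GL_act_def Const_rhom)

lemma map_Const_inverse:
  assumes "g ** h = mat 1"
  shows "map_matrix Const g ** map_matrix Const h = (mat 1 :: ('a::comm_monoid_add \<Rightarrow>\<^sub>0 'k::comm_ring_1)^'n^'n)"
  using rhom.map_matrix_mult[OF Const_rhom, of g h] rhom.map_matrix_one[OF Const_rhom] assms by metis

lemma map_Const_Const: "map_matrix (GL_act g) (map_matrix Const M) = map_matrix Const M"
  by (simp add: vec_eq_iff)

lemma GL_act_inverse:
  fixes f :: "('n::finite, 'm::finite, 'k::comm_ring_1) gen_poly"
  assumes "g \<in> GL"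
  shows "GL_act g (GL_act (matrix_inv g) f) = f"
proof -
  have "GL_act g \<circ> GL_act (matrix_inv g) = (id :: ('n, 'm, 'k) gen_poly \<Rightarrow> _)"
  proof (rule mpoly_hom_eqI)
    show "rhom (GL_act g \<circ> GL_act (matrix_inv g) :: ('n, 'm, 'k) gen_poly \<Rightarrow> _)"
      by (intro rhom_comp GL_act_rhom)
    show "rhom (id :: ('n, 'm, 'k) gen_poly \<Rightarrow> _)"
      by unfold_locales auto
    fix v :: "'m \<times> 'n \<times> 'n"
    obtain k i j where v: "v = (k, i, j)"
      by (cases v)
    let ?C = "map_matrix Const :: 'k^'n^'n \<Rightarrow> ('n, 'm, 'k) gen_poly^'n^'n"
    have "map_matrix (GL_act g) (map_matrix (GL_act (matrix_inv g)) (generic_matrix k)) =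
        ?C g ** (?C (matrix_inv g) ** generic_matrix k ** ?C g) ** ?C (matrix_inv g)"
      by (simp add: GL_act_generic rhom.map_matrix_mult[OF GL_act_rhom] map_Const_Const
          matrix_inv_matrix_inv[OF assms])
    also have "\<dots> = (?C g ** ?C (matrix_inv g)) ** generic_matrix k ** (?C g ** ?C (matrix_inv g))"
      by (simp add: matrix_mul_assoc)
    also have "\<dots> = generic_matrix k"
      by (simp add: map_Const_inverse matrix_inv_GL[OF assms])
    finally have "map_matrix (GL_act g) (map_matrix (GL_act (matrix_inv g)) (generic_matrix k)) $ i $ j =
        (generic_matrix k :: ('n, 'm, 'k) gen_poly^'n^'n) $ i $ j"
      by simp
    then show "(GL_act g \<circ> GL_act (matrix_inv g)) (Var v) = (id (Var v) :: ('n, 'm, 'k) gen_poly)"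
      by (simp add: generic_matrix_def v)
  qed simp
  then show ?thesis
    by (metis comp_apply id_apply)
qed

lemma GL_act_orbit_det:
  assumes "g \<in> GL"
  shows "GL_act g (orbit_det generic_matrix a) = orbit_det generic_matrix a"
  unfolding orbit_det_hom[OF GL_act_rhom] GL_act_generic
  by (rule orbit_det_conj) (simp_all add: map_Const_inverse matrix_inv_GL[OF assms])

section \<open>Restriction to diagonal matrices and multisymmetric functions\<close>

lemma Delta_rhom: "rhom Delta"
  unfolding Delta_def by (rule subst_rhom[OF Const_rhom])

lemma Delta_Const [simp]: "Delta (Const c) = Const c"
  by (simp add: Delta_def Const_rhom)

lemma Delta_generic: "map_matrix Delta (generic_matrix k) = diag_mat (\<lambda>i. Var (i, k))"
  by (simp add: vec_eq_iff generic_matrix_def Delta_def Const_rhom diag_mat_def)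

lemma Sym_act_rhom: "rhom (Sym_act \<sigma>)"
  unfolding Sym_act_def by (rule subst_rhom[OF Const_rhom])

lemma Sym_act_Const [simp]: "Sym_act \<sigma> (Const c) = Const c"
  by (simp add: Sym_act_def Const_rhom)

lemma Sym_act_Var [simp]: "Sym_act \<sigma> (Var (i, k)) = Var (\<sigma> i, k)"
  by (simp add: Sym_act_def Const_rhom)

text \<open>The convention is chosen so that conjugation moves the entry at (\<sigma> i, \<sigma> j)
  to (i, j), which makes \<open>Delta\<close> intertwine \<open>perm_mat \<sigma>\<close> with
  \<sigma> itself and not with its inverse.\<close>

definition perm_mat :: "('n \<Rightarrow> 'n) \<Rightarrow> 'k::comm_ring_1^'n^'n" where
  "perm_mat \<sigma> = (\<chi> i j. of_bool (i = \<sigma> j))"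

lemma perm_mat_inverse:
  assumes "\<sigma> permutes UNIV"
  shows "perm_mat \<sigma> ** perm_mat (inv \<sigma>) = (mat 1 :: 'k::comm_ring_1^'n^'n)"
proof -
  have "(\<Sum>r\<in>UNIV. of_bool (i = \<sigma> r) * of_bool (r = inv \<sigma> j)) = (of_bool (i = j) :: 'k)" for i j
  proof -
    have "(\<Sum>r\<in>UNIV. of_bool (i = \<sigma> r) * of_bool (r = inv \<sigma> j)) =
        (\<Sum>r\<in>UNIV. if r = inv \<sigma> j then of_bool (i = \<sigma> r) else (0 :: 'k))"
      by (rule sum.cong) auto
    then show ?thesis
      by (simp add: permutes_inverses[OF assms])
  qed
  then show ?thesis
    by (simp add: perm_mat_def matrix_matrix_mult_def mat_def vec_eq_iff)
qed

lemma perm_mat_conj: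
  assumes "\<sigma> permutes UNIV"
  shows "(perm_mat (inv \<sigma>) ** M ** perm_mat \<sigma>) $ i $ j = (M :: 'k::comm_ring_1^'n^'n) $ \<sigma> i $ \<sigma> j"
proof -
  have "(\<Sum>s\<in>UNIV. (\<Sum>r\<in>UNIV. of_bool (i = inv \<sigma> r) * M $ r $ s) * of_bool (s = \<sigma> j)) =
      (\<Sum>s\<in>UNIV. if s = \<sigma> j then (\<Sum>r\<in>UNIV. if r = \<sigma> i then M $ r $ s else 0) else 0)"
  proof (intro sum.cong refl)
    fix s
    have "(\<Sum>r\<in>UNIV. of_bool (i = inv \<sigma> r) * M $ r $ s) = (\<Sum>r\<in>UNIV. if r = \<sigma> i then M $ r $ s else 0)"
      using permutes_inverses[OF assms] by (intro sum.cong) auto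
    then show "(\<Sum>r\<in>UNIV. of_bool (i = inv \<sigma> r) * M $ r $ s) * of_bool (s = \<sigma> j) =
        (if s = \<sigma> j then (\<Sum>r\<in>UNIV. if r = \<sigma> i then M $ r $ s else 0) else 0)"
      by simp
  qed
  then show ?thesis
    by (simp add: perm_mat_def matrix_matrix_mult_def)
qed

lemma perm_mat_GL:
  assumes "\<sigma> permutes UNIV"
  shows "perm_mat \<sigma> \<in> GL" "matrix_inv (perm_mat \<sigma>) = perm_mat (inv \<sigma>)"
proof -
  have "perm_mat \<sigma> ** perm_mat (inv \<sigma>) = mat 1" "perm_mat (inv \<sigma>) ** perm_mat \<sigma> = mat 1"
    using perm_mat_inverse[OF assms] perm_mat_inverse[OF permutes_inv[OF assms]]
      permutes_inv_inv[OF assms] by simp_all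
  then show "perm_mat \<sigma> \<in> GL" "matrix_inv (perm_mat \<sigma>) = perm_mat (inv \<sigma>)"
    by (auto intro: GL_I matrix_inv_unique)
qed

lemma map_Const_perm_mat: "map_matrix Const (perm_mat \<sigma>) = perm_mat \<sigma>"
  by (simp add: vec_eq_iff perm_mat_def of_bool_def)

text \<open>Permutation matrices normalise the diagonal matrices and permute their entries. This is
  the reason why restriction to the diagonal takes invariants to symmetric polynomials.\<close>

lemma Delta_GL_act:
  fixes f :: "('n::finite, 'm::finite, 'k::comm_ring_1) gen_poly"
  assumes "\<sigma> permutes UNIV"
  shows "Delta (GL_act (perm_mat \<sigma>) f) = Sym_act \<sigma> (Delta f)"
proof -
  have "Delta \<circ> GL_act (perm_mat \<sigma>) = Sym_act \<sigma> \<circ> (Delta :: ('n, 'm, 'k) gen_poly \<Rightarrow> _)"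
  proof (rule mpoly_hom_eqI)
    fix v :: "'m \<times> 'n \<times> 'n"
    obtain k i j where v: "v = (k, i, j)"
      by (cases v)
    have "map_matrix (GL_act (perm_mat \<sigma>)) (generic_matrix k) $ i $ j =
        (generic_matrix k :: ('n, 'm, 'k) gen_poly^'n^'n) $ \<sigma> i $ \<sigma> j"
      unfolding GL_act_generic map_Const_perm_mat perm_mat_GL(2)[OF assms] perm_mat_conj[OF assms] ..
    moreover have "\<sigma> i = \<sigma> j \<longleftrightarrow> i = j"
      using permutes_inj[OF assms] by (auto dest: injD)
    ultimately have "Delta (map_matrix (GL_act (perm_mat \<sigma>)) (generic_matrix k) $ i $ j) =
        Sym_act \<sigma> (map_matrix Delta (generic_matrix k :: ('n, 'm, 'k) gen_poly^'n^'n) $ i $ j)"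
      by (simp add: generic_matrix_def Delta_def Const_rhom rhom.zero[OF Sym_act_rhom])
    then show "(Delta \<circ> GL_act (perm_mat \<sigma>)) (Var v) = (Sym_act \<sigma> \<circ> Delta) (Var v :: ('n, 'm, 'k) gen_poly)"
      by (simp add: generic_matrix_def v)
  qed (simp_all add: rhom_comp GL_act_rhom Sym_act_rhom Delta_rhom)
  then show ?thesis
    by (metis comp_apply)
qed

section \<open>Monomials and coefficients of polynomials on diagonal matrices\<close>

definition diag_monomial :: "('n::finite \<Rightarrow> 'm::finite \<Rightarrow> nat) \<Rightarrow> ('n, 'm, 'k::comm_ring_1) diag_poly" where
  "diag_monomial a = (\<Prod>i\<in>UNIV. \<Prod>k\<in>UNIV. Var (i, k) ^ a i k)"

lemma Delta_orbit_det: "Delta (orbit_det generic_matrix a) = (\<Sum>b\<in>orbit a. diag_monomial b)"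
  by (simp add: orbit_det_hom[OF Delta_rhom] Delta_generic orbit_det_diag diag_monomial_def)

text \<open>Curried exponents turn the action of a permutation of the rows into composition. Finite
  support is automatic because both index types are finite.\<close>

lift_definition exponent :: "('n::finite \<Rightarrow> 'm::finite \<Rightarrow> nat) \<Rightarrow> ('n \<times> 'm) \<Rightarrow>\<^sub>0 nat" is
  "\<lambda>a (i, k). a i k"
  by simp

lemma lookup_exponent [simp]: "Poly_Mapping.lookup (exponent a) (i, k) = a i k"
  by (simp add: exponent.rep_eq)

lemma exponent_lookup: "exponent (\<lambda>i k. Poly_Mapping.lookup t (i, k)) = t"
  by (rule poly_mapping_eqI) auto

lemma exponent_inject [simp]: "exponent a = exponent b \<longleftrightarrow> a = b"
proof
  assume "exponent a = exponent b"
  then have "Poly_Mapping.lookup (exponent a) (i, k) = Poly_Mapping.lookup (exponent b) (i, k)" for i k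
    by simp
  then show "a = b"
    by (simp add: fun_eq_iff)
qed simp

lemma Var_power: "Var v ^ n = (Poly_Mapping.single (Poly_Mapping.single v n) 1 :: ('v, 'k::comm_ring_1) mpoly)"
  by (induction n) (simp_all add: Var_def mult_single flip: Poly_Mapping.single_add)

lemma prod_single_one:
  "(\<Prod>i\<in>S. Poly_Mapping.single (t i) 1) = (Poly_Mapping.single (\<Sum>i\<in>S. t i) 1 :: 'a::comm_monoid_add \<Rightarrow>\<^sub>0 'k::comm_ring_1)"
  by (induction S rule: infinite_finite_induct) (simp_all add: mult_single)

lemma diag_monomial_eq_single: "diag_monomial a = Poly_Mapping.single (exponent a) 1"
proof -
  have "(\<Sum>i\<in>UNIV. \<Sum>k\<in>UNIV. Poly_Mapping.single (i, k) (a i k)) = exponent a"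
  proof (rule poly_mapping_eqI)
    fix v :: "'a \<times> 'b"
    obtain i' k' where v: "v = (i', k')"
      by (cases v)
    have "(\<Sum>i\<in>UNIV. \<Sum>k\<in>UNIV. a i k when (i = i' \<and> k = k')) =
        (\<Sum>i\<in>UNIV. if i = i' then (\<Sum>k\<in>UNIV. if k = k' then a i k else 0) else 0)"
      by (intro sum.cong refl) (simp add: when_def)
    then show "Poly_Mapping.lookup (\<Sum>i\<in>UNIV. \<Sum>k\<in>UNIV. Poly_Mapping.single (i, k) (a i k)) v =
        Poly_Mapping.lookup (exponent a) v"
      by (simp add: lookup_sum lookup_single v)
  qed
  then show ?thesis
    by (simp add: diag_monomial_def Var_power prod_single_one)
qed

lemma diag_poly_induct [case_names 0 add]:
  fixes p :: "('n::finite, 'm::finite, 'k::comm_ring_1) diag_poly"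
  assumes "P 0" "\<And>p c a. P p \<Longrightarrow> P (p + Const c * diag_monomial a)"
  shows "P p"
proof -
  have "P (\<Sum>t\<in>S. Poly_Mapping.single t (Poly_Mapping.lookup p t))" if "finite S" for S
    using that
  proof (induction S)
    case (insert t S)
    have "Poly_Mapping.single t (Poly_Mapping.lookup p t) =
        Const (Poly_Mapping.lookup p t) * diag_monomial (\<lambda>i k. Poly_Mapping.lookup t (i, k))"
      by (simp add: diag_monomial_eq_single exponent_lookup Const_def mult_single)
    then show ?case
      using assms(2)[OF insert.IH] insert.hyps
      by (simp add: add.commute[of "Const (Poly_Mapping.lookup p t) * _"])
  qed (simp add: assms)
  then have "P (\<Sum>t\<in>Poly_Mapping.keys p. Poly_Mapping.single t (Poly_Mapping.lookup p t))"
    by simp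
  then show ?thesis
    using poly_mapping_sum_single[of "Poly_Mapping.keys p" p] by simp
qed

definition coefficient :: "('n::finite, 'm::finite, 'k::comm_ring_1) diag_poly \<Rightarrow> ('n \<Rightarrow> 'm \<Rightarrow> nat) \<Rightarrow> 'k" where
  "coefficient p a = Poly_Mapping.lookup p (exponent a)"

lemma coefficient_simps [simp]:
  "coefficient 0 a = 0" "coefficient (p + q) a = coefficient p a + coefficient q a"
  "coefficient (p - q) a = coefficient p a - coefficient q a"
  "coefficient (Const c * p) a = c * coefficient p a"
  "coefficient (diag_monomial b) a = of_bool (a = b)"
  by (auto simp: coefficient_def lookup_add lookup_minus lookup_Const_mult diag_monomial_eq_single
      lookup_single when_def)

lemma coefficient_sum: "coefficient (\<Sum>i\<in>S. f i) a = (\<Sum>i\<in>S. coefficient (f i) a)"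
  by (induction S rule: infinite_finite_induct) simp_all

lemma finite_coefficient: "finite {a. coefficient p a \<noteq> 0}"
proof -
  have "exponent ` {a. coefficient p a \<noteq> 0} \<subseteq> Poly_Mapping.keys p"
    by (auto simp: coefficient_def in_keys_iff)
  then have "finite (exponent ` {a. coefficient p a \<noteq> 0})"
    by (rule finite_subset) simp
  then show ?thesis
    by (rule finite_imageD) (simp add: inj_on_def)
qed

lemma coefficient_eqI: "(\<And>a. coefficient p a = coefficient q a) \<Longrightarrow> p = q"
  by (rule poly_mapping_eqI) (metis coefficient_def exponent_lookup)

lemma Sym_act_diag_monomial:
  assumes "\<sigma> permutes UNIV"
  shows "Sym_act \<sigma> (diag_monomial a) = diag_monomial (a \<circ> inv \<sigma>)"
proof -
  have "Sym_act \<sigma> (diag_monomial a) = (\<Prod>i\<in>UNIV. \<Prod>k\<in>UNIV. Var (\<sigma> i, k) ^ a i k)"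
    by (simp add: diag_monomial_def rhom.prod[OF Sym_act_rhom] rhom.power[OF Sym_act_rhom])
  also have "\<dots> = (\<Prod>i\<in>UNIV. \<Prod>k\<in>UNIV. Var (i, k) ^ a (inv \<sigma> i) k)"
    by (rule prod.reindex_bij_witness[of _ "inv \<sigma>" \<sigma>]) (simp_all add: permutes_inverses[OF assms])
  finally show ?thesis
    by (simp add: diag_monomial_def)
qed

lemma coefficient_Sym_act:
  assumes "\<sigma> permutes UNIV"
  shows "coefficient (Sym_act \<sigma> p) a = coefficient p (a \<circ> \<sigma>)"
proof (induction p rule: diag_poly_induct)
  case 0
  then show ?case
    by (simp add: rhom.zero[OF Sym_act_rhom])
next
  case (add p c b)
  have "a = b \<circ> inv \<sigma> \<longleftrightarrow> a \<circ> \<sigma> = b"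
    by (metis assms comp_assoc comp_id permutes_inv_o)
  then show ?case
    using add by (simp del: comp_apply o_apply add: rhom.add[OF Sym_act_rhom] rhom.mult[OF Sym_act_rhom] Sym_act_diag_monomial[OF assms])
qed

lemma Delta_invariant:
  assumes "\<And>g. g \<in> GL \<Longrightarrow> GL_act g f = f" "\<sigma> \<in> Sym"
  shows "Sym_act \<sigma> (Delta f) = Delta f"
proof -
  have \<sigma>: "\<sigma> permutes UNIV"
    using assms(2) by (simp add: Sym_def)
  show ?thesis
    using Delta_GL_act[OF \<sigma>, of f] assms(1)[OF perm_mat_GL(1)[OF \<sigma>]] by simp
qed

text \<open>Induction on the number of monomials. The coefficients of \<open>s\<close> are constant
  on orbits, so subtracting a multiple of the image of one \<open>orbit_det\<close> removes a whole
  orbit from the support and leaves the other coefficients alone.\<close>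

lemma Delta_surj_invariants:
  fixes s :: "('n::finite, 'm::finite, 'k::comm_ring_1) diag_poly"
  assumes "\<And>\<sigma>. \<sigma> \<in> Sym \<Longrightarrow> Sym_act \<sigma> s = s"
  shows "\<exists>f. (\<forall>g\<in>GL. GL_act g f = f) \<and> Delta f = s"
  using assms
proof (induction "card {a. coefficient s a \<noteq> 0}" arbitrary: s rule: less_induct)
  case less
  show ?case
  proof (cases "\<exists>a. coefficient s a \<noteq> 0")
    case False
    then have "s = 0"
      by (intro coefficient_eqI) simp
    then show ?thesis
      by (intro exI[of _ 0]) (simp add: rhom.zero[OF GL_act_rhom] rhom.zero[OF Delta_rhom])
  next
    case True
    then obtain a where a: "coefficient s a \<noteq> 0" ..
    define m where "m = orbit_det (generic_matrix :: 'm \<Rightarrow> ('n, 'm, 'k) gen_poly^'n^'n) a"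
    have m: "Delta m = (\<Sum>b\<in>orbit a. diag_monomial b)"
      by (simp add: m_def Delta_orbit_det)
    define c where "c = coefficient s a"
    define s' where "s' = s - Const c * Delta m"
    have cs: "coefficient s b = c" if b: "b \<in> orbit a" for b
    proof -
      obtain \<sigma> where "\<sigma> permutes UNIV" "b = a \<circ> \<sigma>"
        using b unfolding orbit_def by blast
      then show ?thesis
        using coefficient_Sym_act[of \<sigma> s a] less.prems[of \<sigma>] by (simp add: Sym_def c_def)
    qed
    have cs': "coefficient s' b = (if b \<in> orbit a then 0 else coefficient s b)" for b
      using cs[of b] orbit_finite[of a]
      by (auto simp: s'_def m coefficient_sum of_bool_def)
    have "{b. coefficient s' b \<noteq> 0} \<subset> {b. coefficient s b \<noteq> 0}"
      using a orbit_self[of a] by (auto simp: cs')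
    then have "card {b. coefficient s' b \<noteq> 0} < card {b. coefficient s b \<noteq> 0}"
      by (intro psubset_card_mono finite_coefficient)
    moreover have "Sym_act \<sigma> s' = s'" if "\<sigma> \<in> Sym" for \<sigma>
      using Delta_invariant[of m \<sigma>] that less.prems[of \<sigma>]
      by (simp add: s'_def m_def GL_act_orbit_det rhom.diff[OF Sym_act_rhom] rhom.mult[OF Sym_act_rhom])
    ultimately obtain f where f: "\<forall>g\<in>GL. GL_act g f = f" "Delta f = s'"
      using less.hyps[of s'] by blast
    show ?thesis
    proof (intro exI[of _ "f + Const c * m"] conjI ballI)
      show "Delta (f + Const c * m) = s"
        by (simp add: rhom.add[OF Delta_rhom] rhom.mult[OF Delta_rhom] f s'_def)
      show "GL_act g (f + Const c * m) = f + Const c * m" if "g \<in> GL" for g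
        using f(1) that by (simp add: rhom.add[OF GL_act_rhom] rhom.mult[OF GL_act_rhom] m_def GL_act_orbit_det)
    qed
  qed
qed

section \<open>Integral operators and positivity\<close>

text \<open>The ambient space is a space of functions and may have infinite dimension; only
  \<open>Y\<close> is finite-dimensional, through the finite set \<open>B\<close>. If the image of a
  basis of \<open>Y\<close> did not span \<open>Y\<close>, one more vector would give an independent
  set larger than the basis.\<close>

lemma (in vector_space) injective_endomorphism_surj:
  assumes "finite B" "Y \<subseteq> span B" "subspace Y" and lin: "Vector_Spaces.linear scale scale N"
    and N: "N ` Y \<subseteq> Y" and inj: "\<And>y. y \<in> Y \<Longrightarrow> N y = 0 \<Longrightarrow> y = 0"
  shows "N ` Y = Y"
proof -
  interpret N: Vector_Spaces.linear scale scale N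
    by fact
  obtain C where C: "C \<subseteq> Y" "independent C" "Y \<subseteq> span C"
    using maximal_independent_subset by metis
  have Y: "span C = Y"
    using C assms(3) by (metis span_minimal subset_antisym)
  have finC: "finite C"
    using independent_span_bound[OF assms(1) C(2)] C(1) assms(2) by blast
  have injY: "inj_on N Y"
    using inj N.inj_on_iff_eq_0[OF assms(3)] by auto
  then have indep: "independent (N ` C)"
    using N.independent_injective_image[OF C(2)] by (simp add: Y)
  have card: "card (N ` C) = card C"
    using card_image injY C(1) inj_on_subset by blast
  have "Y \<subseteq> span (N ` C)"
  proof
    fix y assume y: "y \<in> Y"
    show "y \<in> span (N ` C)"
    proof (rule ccontr)
      assume "y \<notin> span (N ` C)"
      then have "independent (insert y (N ` C))" "y \<notin> N ` C"
        using indep independent_insertI span_base by auto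
      moreover have "insert y (N ` C) \<subseteq> span C"
        using y N C(1) by (auto simp: Y)
      ultimately have "card (insert y (N ` C)) \<le> card C"
        using independent_span_bound[OF finC] by blast
      then show False
        using card finC \<open>y \<notin> N ` C\<close> by simp
    qed
  qed
  then have "Y \<subseteq> N ` Y"
    by (simp add: N.span_image Y)
  with N show ?thesis
    by blast
qed

text \<open>The field is a vector space over the rationals, and \<open>a\<close> is part of a basis.
  Such functionals commute with integral matrices and carry a statement about an unordered field to
  the rationals, where squares are nonnegative.\<close>

lemma rational_functional:
  fixes a :: "'c::field_char_0"
  assumes "a \<noteq> 0"
  shows "\<exists>l :: 'c \<Rightarrow> rat. (\<forall>x y. l (x + y) = l x + l y) \<and> (\<forall>z x. l (of_int z * x) = of_int z * l x) \<and> l a \<noteq> 0"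
proof -
  interpret vector_space_pair "\<lambda>q (x :: 'c). of_rat q * x" "(*) :: rat \<Rightarrow> rat \<Rightarrow> rat"
    by unfold_locales (simp_all add: of_rat_add of_rat_mult algebra_simps)
  have "vs1.independent {a}"
    using assms by (simp add: vs1.independent_insert)
  then obtain l where l: "Vector_Spaces.linear (\<lambda>q (x :: 'c). of_rat q * x) (*) l" "l a = 1"
    using linear_independent_extend[of "{a}" "\<lambda>_. 1"] by auto
  interpret Vector_Spaces.linear "\<lambda>q (x :: 'c). of_rat q * x" "(*)" l
    by (rule l(1))
  show ?thesis
  proof (intro exI[of _ l] conjI allI)
    show "l (x + y) = l x + l y" for x y
      by (rule add)
    show "l (of_int z * x) = of_int z * l x" for z x
      using scale[of "of_int z" x] by simp
  qed (simp add: l)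
qed

text \<open>Integer entries let the operator commute with rational functionals. The value 0 outside
  \<open>W\<close> keeps all images in the finite-dimensional space of functions supported on
  \<open>W\<close>.\<close>

definition int_op :: "'x set \<Rightarrow> ('x \<Rightarrow> 'x \<Rightarrow> int) \<Rightarrow> ('x \<Rightarrow> 'c) \<Rightarrow> 'x \<Rightarrow> 'c::comm_ring_1" where
  "int_op W T c x = (if x \<in> W then \<Sum>y\<in>W. of_int (T x y) * c y else 0)"

text \<open>
  Over the rationals, \<open>\<Sum>\<^sub>s T\<^sub>s\<^sup>T T\<^sub>s\<close> and the \<open>T\<^sub>s\<close> jointly have the same kernel because a sum of
  squares vanishes only if each term does; rational functionals transfer this to any field of
  characteristic zero.
\<close>
lemma gram_kernel:
  fixes c :: "'x \<Rightarrow> 'c::field_char_0"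
  assumes "finite W" "finite S"
    and gram: "\<And>x. x \<in> W \<Longrightarrow> (\<Sum>s\<in>S. int_op W (\<lambda>x y. T s y x) (int_op W (T s) c) x) = 0"
    and "s \<in> S"
  shows "int_op W (T s) c x = 0"
proof (rule ccontr)
  assume ne: "int_op W (T s) c x \<noteq> 0"
  then have x: "x \<in> W"
    by (auto simp: int_op_def split: if_splits)
  obtain l :: "'c \<Rightarrow> rat" where l: "\<And>x y. l (x + y) = l x + l y"
    "\<And>z x. l (of_int z * x) = of_int z * l x" "l (int_op W (T s) c x) \<noteq> 0"
    using rational_functional[OF ne] by auto
  have l0: "l 0 = 0"
    using l(1)[of 0 0] by simp
  have lsum: "l (sum f A) = (\<Sum>i\<in>A. l (f i))" for f :: "'b \<Rightarrow> 'c" and A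
    by (induction A rule: infinite_finite_induct) (simp_all add: l0 l(1))
  have lsum': "l (sum f A) = (\<Sum>i\<in>A. l (f i))" for f :: "'x \<Rightarrow> 'c" and A
    by (induction A rule: infinite_finite_induct) (simp_all add: l0 l(1))
  have lop: "l (int_op W U d y) = int_op W U (l \<circ> d) y" for U d y
    by (simp add: int_op_def lsum' l(2) l0)
  define v where "v = l \<circ> c"
  have gramv: "(\<Sum>s\<in>S. int_op W (\<lambda>x y. T s y x) (int_op W (T s) v) y) = 0" if "y \<in> W" for y
  proof -
    have "l \<circ> int_op W U d = int_op W U (l \<circ> d)" for U d
      by (simp add: fun_eq_iff lop)
    then show ?thesis
      using arg_cong[OF gram[OF that], of l] by (simp add: lsum lop v_def l0)
  qed
  \<comment> \<open>The sum of the squared lengths of the vectors \<open>T s\<close> applied to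
    \<open>v\<close> is the pairing of \<open>v\<close> with the Gram operator applied to
    \<open>v\<close>, which vanishes by \<open>gramv\<close>.\<close>
  have "(\<Sum>s\<in>S. \<Sum>z\<in>W. (int_op W (T s) v z)\<^sup>2) = (\<Sum>s\<in>S. \<Sum>z\<in>W. \<Sum>y\<in>W. v y * (of_int (T s z y) * int_op W (T s) v z))"
    by (intro sum.cong refl)
      (simp add: int_op_def[of W _ _] power2_eq_square sum_distrib_left sum_distrib_right mult_ac)
  also have "\<dots> = (\<Sum>s\<in>S. \<Sum>y\<in>W. v y * int_op W (\<lambda>x y. T s y x) (int_op W (T s) v) y)"
  proof (rule sum.cong[OF refl])
    fix s
    show "(\<Sum>z\<in>W. \<Sum>y\<in>W. v y * (of_int (T s z y) * int_op W (T s) v z)) =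
        (\<Sum>y\<in>W. v y * int_op W (\<lambda>x y. T s y x) (int_op W (T s) v) y)"
      by (subst sum.swap) (simp add: int_op_def[of W "\<lambda>x y. T s y x"] sum_distrib_left)
  qed
  also have "\<dots> = (\<Sum>y\<in>W. v y * (\<Sum>s\<in>S. int_op W (\<lambda>x y. T s y x) (int_op W (T s) v) y))"
    by (subst sum.swap) (simp add: sum_distrib_left)
  also have "\<dots> = 0"
    by (simp add: gramv)
  finally have "(\<Sum>z\<in>W. (int_op W (T s) v z)\<^sup>2) = 0"
    using \<open>s \<in> S\<close> \<open>finite S\<close> by (subst (asm) sum_nonneg_eq_0_iff) (auto intro: sum_nonneg)
  then have "int_op W (T s) v x = 0"
    using x \<open>finite W\<close> by (subst (asm) sum_nonneg_eq_0_iff) auto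
  then show False
    using l(3) by (simp add: lop v_def)
qed

lemma int_op_add: "int_op W T (\<lambda>x. c x + d x) x = int_op W T c x + int_op W T d x"
  by (simp add: int_op_def distrib_left sum.distrib)

lemma int_op_scale: "int_op W T (\<lambda>x. a * c x) x = a * int_op W T c x"
  by (simp add: int_op_def sum_distrib_left mult_ac)

lemma int_op_comp:
  assumes "finite W"
  shows "int_op W T (int_op W U c) x = int_op W (\<lambda>x z. \<Sum>y\<in>W. T x y * U y z) c x"
proof (cases "x \<in> W")
  case True
  have "(\<Sum>y\<in>W. of_int (T x y) * (\<Sum>z\<in>W. of_int (U y z) * c z)) =
      (\<Sum>z\<in>W. (\<Sum>y\<in>W. of_int (T x y) * of_int (U y z)) * c z)"
    by (simp add: sum_distrib_left sum_distrib_right mult_ac) (rule sum.swap)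
  with True show ?thesis
    by (simp add: int_op_def)
qed (simp add: int_op_def)

lemma int_op_sum:
  "(\<Sum>s\<in>S. int_op W (T s) c x) = int_op W (\<lambda>x y. \<Sum>s\<in>S. T s x y) c x"
  by (simp add: int_op_def sum_distrib_right) (rule impI, rule sum.swap)

lemma function_vector_space: "vector_space (\<lambda>(a :: 'c::field) (f :: 'x \<Rightarrow> 'c) x. a * f x)"
  by unfold_locales (simp_all add: fun_eq_iff algebra_simps)

lemma finitely_supported_span:
  assumes "finite W"
  shows "\<exists>B. finite B \<and> {c. \<forall>x. x \<notin> W \<longrightarrow> c x = 0} \<subseteq> module.span (\<lambda>(a :: 'c::field) (f :: 'x \<Rightarrow> 'c) x. a * f x) B"
proof -
  interpret vector_space "\<lambda>(a :: 'c::field) (f :: 'x \<Rightarrow> 'c) x. a * f x"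
    by (rule function_vector_space)
  define B where "B = (\<lambda>y x. if x = y then 1 else 0 :: 'c) ` W"
  have "c \<in> span B" if "\<forall>x. x \<notin> W \<longrightarrow> c x = 0" for c :: "'x \<Rightarrow> 'c"
  proof -
    have "c = (\<Sum>y\<in>W. (\<lambda>x. c y * (if x = y then 1 else 0)))"
    proof
      fix x
      have "(\<Sum>y\<in>W. (\<lambda>x. c y * (if x = y then 1 else 0))) x = (\<Sum>y\<in>W. c y * (if x = y then 1 else 0))"
        by (induction W rule: infinite_finite_induct) auto
      then show "c x = (\<Sum>y\<in>W. (\<lambda>x. c y * (if x = y then 1 else 0))) x"
        using that assms by (auto simp: if_distrib[of "\<lambda>z. _ * z"] cong: if_cong)
    qed
    moreover have "(\<lambda>x. c y * (if x = y then 1 else 0)) \<in> span B" if "y \<in> W" for y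
      using span_scale[OF span_base, of "\<lambda>x. if x = y then 1 else 0" B "c y"] that by (auto simp: B_def)
    ultimately show ?thesis
      by (metis (no_types, lifting) span_sum)
  qed
  then show ?thesis
    using assms by (intro exI[of _ B]) (auto simp: B_def)
qed

lemma int_op_surj:
  fixes L :: "('x \<Rightarrow> 'c::field) set"
  assumes "finite W" and supp: "\<And>c x. c \<in> L \<Longrightarrow> x \<notin> W \<Longrightarrow> c x = 0"
    and L: "(\<lambda>_. 0) \<in> L" "\<And>c d. c \<in> L \<Longrightarrow> d \<in> L \<Longrightarrow> (\<lambda>x. c x + d x) \<in> L" "\<And>a c. c \<in> L \<Longrightarrow> (\<lambda>x. a * c x) \<in> L"
    and N: "\<And>c. c \<in> L \<Longrightarrow> int_op W N c \<in> L"
    and inj: "\<And>c. c \<in> L \<Longrightarrow> int_op W N c = (\<lambda>_. 0) \<Longrightarrow> c = (\<lambda>_. 0)"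
    and "c \<in> L"
  shows "\<exists>d\<in>L. int_op W N d = c"
proof -
  interpret V: vector_space "\<lambda>(a :: 'c) (f :: 'x \<Rightarrow> 'c) x. a * f x"
    by (rule function_vector_space)
  obtain B where B: "finite B" "{c. \<forall>x. x \<notin> W \<longrightarrow> c x = 0} \<subseteq> V.span B"
    using finitely_supported_span[OF assms(1), where ?'c = 'c] by auto
  have "int_op W N ` L = L"
  proof (rule V.injective_endomorphism_surj[OF B(1)])
    show "L \<subseteq> V.span B"
      using B(2) supp by auto
    show "V.subspace L"
      using L by (auto simp: V.subspace_def zero_fun_def plus_fun_def)
    show "Vector_Spaces.linear (\<lambda>(a :: 'c) (f :: 'x \<Rightarrow> 'c) x. a * f x) (\<lambda>a f x. a * f x) (int_op W N)"
      by unfold_locales (simp_all add: fun_eq_iff plus_fun_def int_op_add int_op_scale)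
  qed (use N inj in \<open>auto simp: zero_fun_def\<close>)
  then have "c \<in> int_op W N ` L"
    using \<open>c \<in> L\<close> by (simp only:)
  then show ?thesis
    by (simp add: image_iff) metis
qed

text \<open>
  This replaces complete reducibility: a vector that is killed by all \<open>T\<^sub>s\<close> modulo a stable
  subspace \<open>L\<close> is congruent modulo \<open>L\<close> to a vector that is killed by all \<open>T\<^sub>s\<close>.
\<close>
lemma lift_invariant:
  fixes L :: "('x \<Rightarrow> 'c::field_char_0) set"
  assumes W: "finite W" and S: "finite S"
    and tr: "\<And>s. s \<in> S \<Longrightarrow> tr s \<in> S" "\<And>s x y. s \<in> S \<Longrightarrow> T (tr s) x y = T s y x"
    and supp: "\<And>c x. c \<in> L \<Longrightarrow> x \<notin> W \<Longrightarrow> c x = 0"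
    and L: "(\<lambda>_. 0) \<in> L" "\<And>c d. c \<in> L \<Longrightarrow> d \<in> L \<Longrightarrow> (\<lambda>x. c x + d x) \<in> L" "\<And>a c. c \<in> L \<Longrightarrow> (\<lambda>x. a * c x) \<in> L"
    and TL: "\<And>c s. c \<in> L \<Longrightarrow> s \<in> S \<Longrightarrow> int_op W (T s) c \<in> L"
    and c: "\<And>s. s \<in> S \<Longrightarrow> int_op W (T s) c \<in> L"
  obtains d where "d \<in> L" "\<And>s x. s \<in> S \<Longrightarrow> int_op W (T s) (\<lambda>x. c x - d x) x = 0"
proof -
  define N where "N x y = (\<Sum>s\<in>S. \<Sum>z\<in>W. T s z x * T s z y)" for x y
  have N: "int_op W N d x = (\<Sum>s\<in>S. int_op W (\<lambda>x y. T s y x) (int_op W (T s) d) x)" for d :: "'x \<Rightarrow> 'c" and x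
  proof -
    have "N = (\<lambda>x y. \<Sum>s\<in>S. \<Sum>z\<in>W. T s z x * T s z y)"
      by (simp add: fun_eq_iff N_def)
    then show ?thesis
      by (simp only: int_op_comp[OF W] int_op_sum)
  qed
  have Lsum: "(\<lambda>x. \<Sum>s\<in>S'. f s x) \<in> L" if "\<And>s. s \<in> S' \<Longrightarrow> f s \<in> L" for f and S' :: "'b set"
    using that by (induction S' rule: infinite_finite_induct) (simp_all add: L)
  have NL: "int_op W N d \<in> L" if "\<And>s. s \<in> S \<Longrightarrow> int_op W (T s) d \<in> L" for d :: "'x \<Rightarrow> 'c"
  proof -
    have "int_op W (\<lambda>x y. T s y x) (int_op W (T s) d) \<in> L" if "s \<in> S" for s
    proof -
      have "(\<lambda>x y. T s y x) = T (tr s)"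
        using tr(2)[OF that] by (simp add: fun_eq_iff)
      then show ?thesis
        using TL[OF \<open>\<And>s. s \<in> S \<Longrightarrow> int_op W (T s) d \<in> L\<close>[OF that] tr(1)[OF that]] by simp
    qed
    then show ?thesis
      using Lsum[of S "\<lambda>s. int_op W (\<lambda>x y. T s y x) (int_op W (T s) d)"] by (simp add: N[abs_def])
  qed
  have kernel: "int_op W (T s) d x = 0" if "int_op W N d = (\<lambda>_. 0)" "s \<in> S" for d :: "'x \<Rightarrow> 'c" and x s
    using gram_kernel[OF W S, of T d s x] that N[of d] by simp
  \<comment> \<open>\<open>N\<close> is symmetric, so its own Gram operator is the square of
    \<open>N\<close>; the kernel lemma for the single operator \<open>N\<close> shows that
    \<open>N\<close> and its square have the same kernel.\<close>
  have NN: "int_op W N d = (\<lambda>_. 0)" if "int_op W N (int_op W N d) = (\<lambda>_. 0)" for d :: "'x \<Rightarrow> 'c"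
  proof -
    have "(\<lambda>x y. N y x) = N"
      by (simp add: N_def fun_eq_iff mult.commute)
    then show ?thesis
      using gram_kernel[OF W, of "{()}" "\<lambda>_. N" d "()"] that by (simp add: fun_eq_iff)
  qed
  \<comment> \<open>On the range of \<open>N\<close> the operator is injective by \<open>NN\<close>.
    Intersecting with \<open>L\<close> gives a finite-dimensional stable space that contains
    \<open>N c\<close>, so \<open>N d = N c\<close> has a solution in it, and \<open>c - d\<close>
    lies in the kernel of \<open>N\<close>.\<close>
  define L' where "L' = L \<inter> range (int_op W N)"
  have "\<exists>d\<in>L'. int_op W N d = int_op W N c"
  proof (rule int_op_surj[OF W])
    show "(\<lambda>_. 0) \<in> L'"
      using L(1) by (auto simp: L'_def image_iff fun_eq_iff int_op_def intro!: exI[of _ "\<lambda>_. 0"])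
    show "(\<lambda>x. c x + d x) \<in> L'" if "c \<in> L'" "d \<in> L'" for c d
      using that L(2) by (auto simp: L'_def image_iff fun_eq_iff simp flip: int_op_add)
    show "(\<lambda>x. a * c x) \<in> L'" if "c \<in> L'" for a c
      using that L(3) by (auto simp: L'_def image_iff fun_eq_iff simp flip: int_op_scale)
    show "int_op W N c \<in> L'" if "c \<in> L'" for c
      using that NL TL by (auto simp: L'_def)
    show "int_op W N c \<in> L'"
      using NL c by (auto simp: L'_def)
    show "c = (\<lambda>_. 0)" if "c \<in> L'" "int_op W N c = (\<lambda>_. 0)" for c
      using that NN by (auto simp: L'_def)
  qed (use supp in \<open>auto simp: L'_def\<close>)
  then obtain d where d: "d \<in> L" "int_op W N d = int_op W N c"
    by (auto simp: L'_def)
  have "int_op W N (\<lambda>x. c x - d x) = (\<lambda>_. 0)"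
  proof
    fix x
    show "int_op W N (\<lambda>x. c x - d x) x = 0"
      using fun_cong[OF d(2), of x] int_op_add[of W N c "\<lambda>x. - 1 * d x" x] int_op_scale[of W N "- 1" d x]
      by simp
  qed
  then show ?thesis
    using that d(1) kernel by blast
qed

declare sum_mult_of_bool_eq [simp del] sum_of_bool_mult_eq [simp del] sum_of_bool_eq [simp del]

section \<open>Invariant tensors\<close>

text \<open>
  A tensor in \<open>(V\<^sup>* \<otimes> V)\<^sup>\<otimes>\<^sup>d\<close> is given by its coordinates \<open>c (p, q)\<close>; the position \<open>l < d\<close> carries
  the pair of indices \<open>(p l, q l)\<close>.
\<close>
definition index_maps :: "nat \<Rightarrow> (nat \<Rightarrow> 'n) set" where
  "index_maps d = (\<Pi>\<^sub>E l\<in>{..<d}. UNIV)"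

definition positions :: "nat \<Rightarrow> ((nat \<Rightarrow> 'n) \<times> (nat \<Rightarrow> 'n)) set" where
  "positions d = index_maps d \<times> index_maps d"

text \<open>\<open>act_left\<close> and \<open>act_right\<close> are the two halves of the action of
  a matrix unit on coefficient tensors, on the first and on the second index of each position. Right
  minus left is the effect of the corresponding derivation on coefficients, see
  \<open>derivation_word_poly\<close>.\<close>

definition act_left :: "nat \<Rightarrow> 'n \<times> 'n \<Rightarrow> ((nat \<Rightarrow> 'n) \<times> (nat \<Rightarrow> 'n) \<Rightarrow> 'c::comm_ring_1) \<Rightarrow> (nat \<Rightarrow> 'n) \<times> (nat \<Rightarrow> 'n) \<Rightarrow> 'c" where
  "act_left d = (\<lambda>(i, j) c (p, q). \<Sum>l<d. of_bool (p l = j) * c (p(l := i), q))"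

definition act_right :: "nat \<Rightarrow> 'n \<times> 'n \<Rightarrow> ((nat \<Rightarrow> 'n) \<times> (nat \<Rightarrow> 'n) \<Rightarrow> 'c::comm_ring_1) \<Rightarrow> (nat \<Rightarrow> 'n) \<times> (nat \<Rightarrow> 'n) \<Rightarrow> 'c" where
  "act_right d = (\<lambda>(i, j) c (p, q). \<Sum>l<d. of_bool (q l = i) * c (p, q(l := j)))"

definition kernel_left :: "nat \<Rightarrow> 'n \<times> 'n \<Rightarrow> (nat \<Rightarrow> 'n) \<times> (nat \<Rightarrow> 'n) \<Rightarrow> (nat \<Rightarrow> 'n) \<times> (nat \<Rightarrow> 'n) \<Rightarrow> int" where
  "kernel_left d = (\<lambda>(i, j) (p, q) y. \<Sum>l<d. of_bool (p l = j \<and> y = (p(l := i), q)))"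

text \<open>The elementary invariant tensor attached to \<pi>: contracted with a family of matrices
  it gives a product of traces along the cycles of the inverse of \<pi>, see
  \<open>sum_pairing\<close>.\<close>

definition pairing :: "nat \<Rightarrow> (nat \<Rightarrow> nat) \<Rightarrow> (nat \<Rightarrow> 'n) \<times> (nat \<Rightarrow> 'n) \<Rightarrow> 'c::comm_ring_1" where
  "pairing d \<pi> = (\<lambda>(p, q). of_bool (\<forall>l<d. p l = q (\<pi> l)))"

definition pairing_span :: "nat \<Rightarrow> ((nat \<Rightarrow> 'n) \<times> (nat \<Rightarrow> 'n) \<Rightarrow> 'c::comm_ring_1) set" where
  "pairing_span d = {c. \<exists>b. \<forall>x\<in>positions d. c x = (\<Sum>\<pi> | \<pi> permutes {..<d}. b \<pi> * pairing d \<pi> x)}"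

lemma finite_index_maps: "finite (index_maps d :: (nat \<Rightarrow> 'n::finite) set)"
  unfolding index_maps_def by (rule finite_PiE) simp_all

lemma finite_positions: "finite (positions d :: ((nat \<Rightarrow> 'n::finite) \<times> (nat \<Rightarrow> 'n)) set)"
  by (simp add: positions_def finite_index_maps)

lemma index_maps_update: "p \<in> index_maps d \<Longrightarrow> l < d \<Longrightarrow> p(l := i) \<in> index_maps d"
  by (auto simp: index_maps_def PiE_iff extensional_def)

lemma index_maps_update_Suc: "p \<in> index_maps d \<Longrightarrow> p(d := i) \<in> index_maps (Suc d)"
  by (auto simp: index_maps_def PiE_iff extensional_def)

lemma index_maps_compose: "p \<in> index_maps d \<Longrightarrow> \<pi> permutes {..<d} \<Longrightarrow> p \<circ> \<pi> \<in> index_maps d"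
  by (auto simp: index_maps_def PiE_iff extensional_def permutes_not_in)

lemma transpose_permutes: "l < d \<Longrightarrow> l' < d \<Longrightarrow> Transposition.transpose l l' permutes {..<d}"
  by (rule permutes_swap_id) simp_all

lemma int_op_kernel_left:
  fixes c :: "(nat \<Rightarrow> 'n::finite) \<times> (nat \<Rightarrow> 'n) \<Rightarrow> 'c::comm_ring_1"
  assumes "x \<in> positions d"
  shows "int_op (positions d) (kernel_left d s) c x = act_left d s c x"
proof -
  obtain p q i j where x: "x = (p, q)" "s = (i, j)"
    by (cases x, cases s)
  have "(\<Sum>y\<in>positions d. of_int (\<Sum>l<d. of_bool (p l = j \<and> y = (p(l := i), q))) * c y) =
      (\<Sum>l<d. \<Sum>y\<in>positions d. of_bool (p l = j \<and> y = (p(l := i), q)) * c y)"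
    by (simp add: sum_distrib_right) (rule sum.swap)
  also have "\<dots> = (\<Sum>l<d. of_bool (p l = j) * c (p(l := i), q))"
  proof (rule sum.cong[OF refl])
    fix l assume "l \<in> {..<d}"
    then have mem: "(p(l := i), q) \<in> positions d"
      using assms index_maps_update[of p d l i] by (simp add: x positions_def)
    have "(\<Sum>y\<in>positions d. of_bool (p l = j \<and> y = (p(l := i), q)) * c y) =
        (\<Sum>y\<in>positions d. if y = (p(l := i), q) then of_bool (p l = j) * c y else 0)"
      by (rule sum.cong) auto
    also have "\<dots> = of_bool (p l = j) * c (p(l := i), q)"
      using mem by (cases "p l = j") (simp_all add: finite_positions)
    finally show "(\<Sum>y\<in>positions d. of_bool (p l = j \<and> y = (p(l := i), q)) * c y) =
        of_bool (p l = j) * c (p(l := i), q)" .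
  qed
  finally show ?thesis
    using assms by (simp add: int_op_def kernel_left_def act_left_def x)
qed

lemma kernel_left_transpose:
  "kernel_left d (i, j) x y = kernel_left d (j, i) y x"
proof -
  obtain p q p' q' where xy: "x = (p, q)" "y = (p', q')"
    by (cases x, cases y)
  have "p l = j \<and> p' = p(l := i) \<and> q' = q \<longleftrightarrow> p' l = i \<and> p = p'(l := j) \<and> q = q'" for l
    by auto
  then show ?thesis
    by (simp add: kernel_left_def xy)
qed

text \<open>The quadratic Casimir element of gl(n), acting on the first indices only. Since the
  operators for (i, j) and (j, i) are transposes of each other, it is at the same time their Gram
  operator, so that \<open>gram_kernel\<close> applies.\<close>

definition casimir :: "nat \<Rightarrow> ((nat \<Rightarrow> 'n::finite) \<times> (nat \<Rightarrow> 'n) \<Rightarrow> 'c::comm_ring_1) \<Rightarrow> (nat \<Rightarrow> 'n) \<times> (nat \<Rightarrow> 'n) \<Rightarrow> 'c" where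
  "casimir d c x = (\<Sum>(i, j)\<in>UNIV. act_left d (i, j) (act_left d (j, i) c) x)"

definition casimir_kernel :: "nat \<Rightarrow> (nat \<Rightarrow> 'n::finite) \<times> (nat \<Rightarrow> 'n) \<Rightarrow> (nat \<Rightarrow> 'n) \<times> (nat \<Rightarrow> 'n) \<Rightarrow> int" where
  "casimir_kernel d x y = (\<Sum>s\<in>UNIV. \<Sum>z\<in>positions d. kernel_left d s z x * kernel_left d s z y)"

lemma act_left_cong:
  assumes "\<And>y. y \<in> positions d \<Longrightarrow> c y = c' y" "x \<in> positions d"
  shows "act_left d s c x = act_left d s c' x"
  using assms by (auto simp: act_left_def positions_def index_maps_update split: prod.splits intro!: sum.cong)

lemma int_op_gram:
  "(\<Sum>s\<in>UNIV. int_op (positions d) (\<lambda>x y. kernel_left d s y x) (int_op (positions d) (kernel_left d s) c) x) =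
    int_op (positions d) (casimir_kernel d) c x"
  unfolding int_op_comp[OF finite_positions] int_op_sum casimir_kernel_def[abs_def] ..

lemma int_op_casimir:
  assumes x: "x \<in> positions d"
  shows "int_op (positions d) (casimir_kernel d) c x = casimir d c x"
proof -
  have "int_op (positions d) (\<lambda>x y. kernel_left d (i, j) y x) (int_op (positions d) (kernel_left d (i, j)) c) x =
      act_left d (j, i) (act_left d (i, j) c) x" for i j
  proof -
    have "(\<lambda>x y. kernel_left d (i, j) y x) = kernel_left d (j, i)"
      by (simp add: fun_eq_iff kernel_left_transpose[of d i j])
    then show ?thesis
      by (simp add: int_op_kernel_left[OF x]) (rule act_left_cong[OF _ x], rule int_op_kernel_left)
  qed
  then have "int_op (positions d) (casimir_kernel d) c x = (\<Sum>(i, j)\<in>UNIV. act_left d (j, i) (act_left d (i, j) c) x)"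
    unfolding int_op_gram[symmetric] by (intro sum.cong) auto
  also have "\<dots> = casimir d c x"
    unfolding casimir_def by (rule sum.reindex_bij_witness[of _ prod.swap prod.swap]) auto
  finally show ?thesis .
qed

text \<open>A tensor killed by the Gram operator is killed by each \<open>act_left d (i, i)\<close>.
  Summed over i these operators count every position once, so their sum is multiplication by
  \<open>d\<close>, which is invertible in characteristic zero.\<close>

lemma casimir_injective:
  fixes c :: "(nat \<Rightarrow> 'n::finite) \<times> (nat \<Rightarrow> 'n) \<Rightarrow> 'c::field_char_0"
  assumes "d > 0" and zero: "\<And>x. x \<in> positions d \<Longrightarrow> casimir d c x = 0" and x: "x \<in> positions d"
  shows "c x = 0"
proof -
  obtain p q where pq: "x = (p, q)"
    by (cases x)
  have "act_left d (i, i) c x = 0" for i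
    using gram_kernel[of "positions d" UNIV "kernel_left d" c "(i, i)" x] zero x
    by (simp add: finite_positions int_op_gram int_op_casimir int_op_kernel_left)
  then have "(\<Sum>i\<in>UNIV. act_left d (i, i) c x) = 0"
    by simp
  also have "(\<Sum>i\<in>UNIV. act_left d (i, i) c x) = (\<Sum>l<d. \<Sum>i\<in>UNIV. of_bool (p l = i) * c (p(l := i), q))"
    by (simp add: act_left_def pq) (rule sum.swap)
  also have "\<dots> = (\<Sum>l<d. \<Sum>i\<in>UNIV. if i = p l then c (p, q) else 0)"
    by (intro sum.cong refl) auto
  also have "\<dots> = of_nat d * c x"
    by (simp add: pq)
  finally show ?thesis
    using \<open>d > 0\<close> by simp
qed

text \<open>When both factors act at the same position, the sum over i and j is multiplication by n.
  At two different positions the sum of E_ij tensor E_ji is the flip, which exchanges the two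
  indices.\<close>

lemma casimir_eq_swaps:
  fixes c :: "(nat \<Rightarrow> 'n::finite) \<times> (nat \<Rightarrow> 'n) \<Rightarrow> 'c::comm_ring_1"
  shows "casimir d c (p, q) = of_nat (CARD('n) * d) * c (p, q) +
    (\<Sum>l<d. \<Sum>l'\<in>{..<d} - {l}. c (p \<circ> Transposition.transpose l l', q))"
proof -
  have "casimir d c (p, q) = (\<Sum>i\<in>UNIV. \<Sum>j\<in>UNIV. \<Sum>l<d. of_bool (p l = j) *
      (\<Sum>l'<d. of_bool ((p(l := i)) l' = i) * c (p(l := i, l' := j), q)))"
    unfolding casimir_def UNIV_Times_UNIV[symmetric]
    by (subst sum.cartesian_product[symmetric]) (simp add: act_left_def)
  also have "\<dots> = (\<Sum>l<d. \<Sum>i\<in>UNIV. \<Sum>j\<in>UNIV. if j = p l then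
      (\<Sum>l'<d. of_bool ((p(l := i)) l' = i) * c (p(l := i, l' := p l), q)) else 0)"
    by (subst sum.swap[of _ "{..<d}"], subst sum.swap[of _ "{..<d}"]) (intro sum.cong refl, auto)
  also have "\<dots> = (\<Sum>l<d. \<Sum>i\<in>UNIV. \<Sum>l'<d. of_bool ((p(l := i)) l' = i) * c (p(l := i, l' := p l), q))"
    by simp
  also have "\<dots> = (\<Sum>l<d. (\<Sum>i\<in>(UNIV :: 'n set). c (p, q)) + (\<Sum>l'\<in>{..<d} - {l}. c (p \<circ> Transposition.transpose l l', q)))"
  proof (rule sum.cong[OF refl])
    fix l assume l: "l \<in> {..<d}"
    have "(\<Sum>i\<in>UNIV. \<Sum>l'<d. of_bool ((p(l := i)) l' = i) * c (p(l := i, l' := p l), q)) =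
        (\<Sum>i\<in>UNIV. c (p, q) + (\<Sum>l'\<in>{..<d} - {l}. of_bool ((p(l := i)) l' = i) * c (p(l := i, l' := p l), q)))"
      using l by (subst sum.remove[of "{..<d}" l]) simp_all
    also have "\<dots> = (\<Sum>i\<in>(UNIV :: 'n set). c (p, q)) +
        (\<Sum>l'\<in>{..<d} - {l}. \<Sum>i\<in>UNIV. of_bool ((p(l := i)) l' = i) * c (p(l := i, l' := p l), q))"
      unfolding sum.distrib by (subst sum.swap[of _ "{..<d} - {l}" UNIV]) (rule refl)
    also have "(\<Sum>l'\<in>{..<d} - {l}. \<Sum>i\<in>UNIV. of_bool ((p(l := i)) l' = i) * c (p(l := i, l' := p l), q)) =
        (\<Sum>l'\<in>{..<d} - {l}. c (p \<circ> Transposition.transpose l l', q))"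
    proof (rule sum.cong[OF refl])
      fix l' assume l': "l' \<in> {..<d} - {l}"
      have swap: "p(l := p l', l' := p l) = p \<circ> Transposition.transpose l l'"
        by (auto simp: fun_eq_iff Transposition.transpose_def)
      have "(\<Sum>i\<in>UNIV. of_bool ((p(l := i)) l' = i) * c (p(l := i, l' := p l), q)) =
          (\<Sum>i\<in>UNIV. if i = p l' then c (p(l := p l', l' := p l), q) else 0)"
        using l' by (intro sum.cong refl) auto
      also have "\<dots> = c (p \<circ> Transposition.transpose l l', q)"
        unfolding swap by (simp only: sum.delta[OF finite_class.finite_UNIV] UNIV_I if_True)
      finally show "(\<Sum>i\<in>UNIV. of_bool ((p(l := i)) l' = i) * c (p(l := i, l' := p l), q)) =
          c (p \<circ> Transposition.transpose l l', q)" .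
    qed
    finally show "(\<Sum>i\<in>UNIV. \<Sum>l'<d. of_bool ((p(l := i)) l' = i) * c (p(l := i, l' := p l), q)) =
        (\<Sum>i\<in>(UNIV :: 'n set). c (p, q)) + (\<Sum>l'\<in>{..<d} - {l}. c (p \<circ> Transposition.transpose l l', q))" .
  qed
  finally show ?thesis
    by (simp add: sum.distrib mult_ac)
qed

lemma pairing_spanI:
  assumes "\<rho> permutes {..<d}" "\<And>x. x \<in> positions d \<Longrightarrow> c x = a * pairing d \<rho> x"
  shows "c \<in> pairing_span d"
proof -
  have "a * pairing d \<rho> x = (\<Sum>\<pi> | \<pi> permutes {..<d}. (if \<pi> = \<rho> then a else 0) * pairing d \<pi> x)" for x
  proof -
    have "(\<Sum>\<pi> | \<pi> permutes {..<d}. (if \<pi> = \<rho> then a else 0) * pairing d \<pi> x) =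
        (\<Sum>\<pi> | \<pi> permutes {..<d}. if \<pi> = \<rho> then a * pairing d \<rho> x else 0)"
      by (rule sum.cong) auto
    then show ?thesis
      using assms(1) by (simp add: finite_permutations)
  qed
  then show ?thesis
    unfolding pairing_span_def
    by (intro CollectI exI[of _ "\<lambda>\<pi>. if \<pi> = \<rho> then a else 0"] ballI) (simp only: assms(2))
qed

lemma pairing_span_cong:
  "(\<And>x. x \<in> positions d \<Longrightarrow> c x = c' x) \<Longrightarrow> c \<in> pairing_span d \<longleftrightarrow> c' \<in> pairing_span d"
  by (simp add: pairing_span_def)

lemma pairing_span_zero: "(\<lambda>_. 0) \<in> pairing_span d"
  by (auto simp: pairing_span_def intro!: exI[of _ "\<lambda>_. 0"])

lemma pairing_span_add:
  assumes "c \<in> pairing_span d" "c' \<in> pairing_span d"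
  shows "(\<lambda>x. c x + c' x) \<in> pairing_span d"
proof -
  obtain b b' where "\<And>x. x \<in> positions d \<Longrightarrow> c x = (\<Sum>\<pi> | \<pi> permutes {..<d}. b \<pi> * pairing d \<pi> x)"
    "\<And>x. x \<in> positions d \<Longrightarrow> c' x = (\<Sum>\<pi> | \<pi> permutes {..<d}. b' \<pi> * pairing d \<pi> x)"
    using assms unfolding pairing_span_def by blast
  then show ?thesis
    by (auto simp: pairing_span_def sum.distrib distrib_right intro!: exI[of _ "\<lambda>\<pi>. b \<pi> + b' \<pi>"])
qed

lemma pairing_span_scale:
  assumes "c \<in> pairing_span d"
  shows "(\<lambda>x. a * c x) \<in> pairing_span d"
proof -
  obtain b where "\<And>x. x \<in> positions d \<Longrightarrow> c x = (\<Sum>\<pi> | \<pi> permutes {..<d}. b \<pi> * pairing d \<pi> x)"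
    using assms unfolding pairing_span_def by blast
  then show ?thesis
    by (auto simp: pairing_span_def sum_distrib_left mult_ac intro!: exI[of _ "\<lambda>\<pi>. a * b \<pi>"])
qed

lemma pairing_span_sum:
  "(\<And>i. i \<in> S \<Longrightarrow> f i \<in> pairing_span d) \<Longrightarrow> (\<lambda>x. \<Sum>i\<in>S. f i x) \<in> pairing_span d"
  by (induction S rule: infinite_finite_induct) (simp_all add: pairing_span_zero pairing_span_add)

lemma pairing_compose:
  assumes \<alpha>: "\<alpha> permutes {..<d}" and \<beta>: "\<beta> permutes {..<d}"
  shows "pairing d \<pi> (p \<circ> \<alpha>, q \<circ> \<beta>) = pairing d (\<beta> \<circ> \<pi> \<circ> inv \<alpha>) (p, q)"
proof -
  have "(\<forall>l<d. p (\<alpha> l) = q (\<beta> (\<pi> l))) \<longleftrightarrow> (\<forall>l<d. p l = q (\<beta> (\<pi> (inv \<alpha> l))))"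
    using permutes_inverses[OF \<alpha>] permutes_in_image[OF \<alpha>] permutes_in_image[OF permutes_inv[OF \<alpha>]]
    by (metis lessThan_iff)
  then show ?thesis
    by (simp add: pairing_def)
qed

text \<open>By \<open>casimir_eq_swaps\<close> the operator only permutes positions, and a
  permutation of the positions turns one pairing into another.\<close>

lemma casimir_pairing_span:
  fixes c :: "(nat \<Rightarrow> 'n::finite) \<times> (nat \<Rightarrow> 'n) \<Rightarrow> 'c::comm_ring_1"
  assumes "c \<in> pairing_span d"
  shows "casimir d c \<in> pairing_span d"
proof -
  obtain b where b: "\<And>x. x \<in> positions d \<Longrightarrow> c x = (\<Sum>\<pi> | \<pi> permutes {..<d}. b \<pi> * pairing d \<pi> x)"
    using assms unfolding pairing_span_def by blast
  have swap: "(\<lambda>(p, q). c (p \<circ> \<alpha>, q)) \<in> pairing_span d" if \<alpha>: "\<alpha> permutes {..<d}" for \<alpha>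
  proof -
    have "(\<lambda>x. \<Sum>\<pi> | \<pi> permutes {..<d}. b \<pi> * pairing d (\<pi> \<circ> inv \<alpha>) x) \<in> pairing_span d"
      by (intro pairing_span_sum pairing_spanI[OF _ refl])
        (use permutes_compose[OF permutes_inv[OF \<alpha>]] in auto)
    moreover have "c (p \<circ> \<alpha>, q) = (\<Sum>\<pi> | \<pi> permutes {..<d}. b \<pi> * pairing d (\<pi> \<circ> inv \<alpha>) (p, q))"
      if pq: "(p, q) \<in> positions d" for p q
    proof -
      have "pairing d \<pi> (p \<circ> \<alpha>, q) = (pairing d (\<pi> \<circ> inv \<alpha>) (p, q) :: 'c)" for \<pi>
        using pairing_compose[OF \<alpha> permutes_id, of \<pi> p q] by simp
      moreover have "(p \<circ> \<alpha>, q) \<in> positions d"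
        using pq index_maps_compose[OF _ \<alpha>, of p] by (simp add: positions_def)
      ultimately show ?thesis
        using b[of "(p \<circ> \<alpha>, q)"] by simp
    qed
    ultimately show ?thesis
      by (subst pairing_span_cong) auto
  qed
  have "(\<lambda>x. of_nat (CARD('n) * d) * c x +
      (\<Sum>l<d. \<Sum>l'\<in>{..<d} - {l}. (\<lambda>(p, q). c (p \<circ> Transposition.transpose l l', q)) x)) \<in> pairing_span d"
    by (intro pairing_span_add pairing_span_scale pairing_span_sum swap assms transpose_permutes) auto
  then show ?thesis
    by (rule back_subst[of "\<lambda>c. c \<in> pairing_span d"]) (auto simp: fun_eq_iff casimir_eq_swaps)
qed

definition invariant_tensor :: "nat \<Rightarrow> ((nat \<Rightarrow> 'n::finite) \<times> (nat \<Rightarrow> 'n) \<Rightarrow> 'c::comm_ring_1) \<Rightarrow> bool" where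
  "invariant_tensor d c \<longleftrightarrow> (\<forall>s. \<forall>x\<in>positions d. act_right d s c x = act_left d s c x)"

lemma act_permute:
  fixes c :: "(nat \<Rightarrow> 'n) \<times> (nat \<Rightarrow> 'n) \<Rightarrow> 'c::comm_ring_1"
  assumes \<alpha>: "\<alpha> permutes {..<d}" and \<beta>: "\<beta> permutes {..<d}"
  shows "act_left d s (\<lambda>(p, q). c (p \<circ> \<alpha>, q \<circ> \<beta>)) (p, q) = act_left d s c (p \<circ> \<alpha>, q \<circ> \<beta>)"
    and "act_right d s (\<lambda>(p, q). c (p \<circ> \<alpha>, q \<circ> \<beta>)) (p, q) = act_right d s c (p \<circ> \<alpha>, q \<circ> \<beta>)"
proof -
  obtain i j where s: "s = (i, j)"
    by (cases s)
  have upd: "r(l := i) \<circ> \<gamma> = (r \<circ> \<gamma>)(inv \<gamma> l := i)" if "\<gamma> permutes {..<d}" for r :: "nat \<Rightarrow> 'n" and l i \<gamma>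
    using permutes_inverses[OF that] by (auto simp: fun_eq_iff)
  have bij: "inv \<gamma> l < d" "\<gamma> l < d" "\<gamma> (inv \<gamma> l) = l" "inv \<gamma> (\<gamma> l) = l" if "\<gamma> permutes {..<d}" "l < d" for \<gamma> l
    using permutes_inverses[OF that(1)] permutes_in_image[OF that(1)]
      permutes_in_image[OF permutes_inv[OF that(1)]] that(2) by auto
  show "act_left d s (\<lambda>(p, q). c (p \<circ> \<alpha>, q \<circ> \<beta>)) (p, q) = act_left d s c (p \<circ> \<alpha>, q \<circ> \<beta>)"
    unfolding act_left_def s prod.case
    by (rule sum.reindex_bij_witness[of _ \<alpha> "inv \<alpha>"]) (simp_all add: bij[OF \<alpha>] permutes_inverses[OF \<alpha>] upd[OF \<alpha>])
  show "act_right d s (\<lambda>(p, q). c (p \<circ> \<alpha>, q \<circ> \<beta>)) (p, q) = act_right d s c (p \<circ> \<alpha>, q \<circ> \<beta>)"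
    unfolding act_right_def s prod.case
    by (rule sum.reindex_bij_witness[of _ \<beta> "inv \<beta>"]) (simp_all add: bij[OF \<beta>] permutes_inverses[OF \<beta>] upd[OF \<beta>])
qed

lemma invariant_tensor_permute:
  fixes c :: "(nat \<Rightarrow> 'a::finite) \<times> (nat \<Rightarrow> 'a) \<Rightarrow> 'c::comm_ring_1"
  assumes "invariant_tensor d c" "\<alpha> permutes {..<d}" "\<beta> permutes {..<d}"
  shows "invariant_tensor d (\<lambda>(p, q). c (p \<circ> \<alpha>, q \<circ> \<beta>))"
  unfolding invariant_tensor_def
proof (intro allI ballI)
  fix s :: "'a \<times> 'a" and x :: "(nat \<Rightarrow> 'a) \<times> (nat \<Rightarrow> 'a)"
  assume x: "x \<in> positions d"
  obtain p q where pq: "x = (p, q)"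
    by (cases x)
  have "(p \<circ> \<alpha>, q \<circ> \<beta>) \<in> positions d"
    using x index_maps_compose assms by (auto simp: pq positions_def)
  then show "act_right d s (\<lambda>(p, q). c (p \<circ> \<alpha>, q \<circ> \<beta>)) x = act_left d s (\<lambda>(p, q). c (p \<circ> \<alpha>, q \<circ> \<beta>)) x"
    using assms(1) unfolding pq act_permute[OF assms(2,3)] invariant_tensor_def by blast
qed

definition contract :: "nat \<Rightarrow> ((nat \<Rightarrow> 'n::finite) \<times> (nat \<Rightarrow> 'n) \<Rightarrow> 'c::comm_ring_1) \<Rightarrow> (nat \<Rightarrow> 'n) \<times> (nat \<Rightarrow> 'n) \<Rightarrow> 'c" where
  "contract d c = (\<lambda>(p, q). \<Sum>r\<in>UNIV. c (p(d := r), q(d := r)))"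

text \<open>After summation over the contracted index, position \<open>d\<close> contributes the
  same term \<open>c (p(d := i), q(d := j))\<close> to the right action and to the left action. The
  two terms cancel and the actions on the remaining positions are left.\<close>

lemma invariant_tensor_contract:
  fixes c :: "(nat \<Rightarrow> 'a::finite) \<times> (nat \<Rightarrow> 'a) \<Rightarrow> 'c::comm_ring_1"
  assumes "invariant_tensor (Suc d) c"
  shows "invariant_tensor d (contract d c)"
  unfolding invariant_tensor_def
proof (intro allI ballI)
  fix s :: "'a \<times> 'a" and x :: "(nat \<Rightarrow> 'a) \<times> (nat \<Rightarrow> 'a)"
  assume x: "x \<in> positions d"
  obtain p q i j where pq: "x = (p, q)" "s = (i, j)"
    by (cases x, cases s)
  have "(p(d := r), q(d := r)) \<in> positions (Suc d)" for r
    using x index_maps_update_Suc[of p d r] index_maps_update_Suc[of q d r] by (simp add: pq positions_def)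
  then have "act_right (Suc d) (i, j) c (p(d := r), q(d := r)) = act_left (Suc d) (i, j) c (p(d := r), q(d := r))" for r
    using assms by (simp add: invariant_tensor_def)
  then have "(\<Sum>r\<in>UNIV. act_right (Suc d) (i, j) c (p(d := r), q(d := r))) =
      (\<Sum>r\<in>UNIV. act_left (Suc d) (i, j) c (p(d := r), q(d := r)))"
    by simp
  moreover have "(\<Sum>r\<in>UNIV. act_right (Suc d) (i, j) c (p(d := r), q(d := r))) =
      act_right d (i, j) (contract d c) (p, q) + c (p(d := i), q(d := j))"
  proof -
    have "(\<Sum>r\<in>UNIV. act_right (Suc d) (i, j) c (p(d := r), q(d := r))) =
        (\<Sum>r\<in>UNIV. (\<Sum>l<d. of_bool (q l = i) * c (p(d := r), q(l := j, d := r))) +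
          (if r = i then c (p(d := i), q(d := j)) else 0))"
    proof (rule sum.cong[OF refl])
      fix r
      have "(\<Sum>l<d. of_bool ((q(d := r)) l = i) * c (p(d := r), (q(d := r))(l := j))) =
          (\<Sum>l<d. of_bool (q l = i) * c (p(d := r), q(l := j, d := r)))"
        by (intro sum.cong refl) (auto simp: fun_upd_twist)
      then show "act_right (Suc d) (i, j) c (p(d := r), q(d := r)) =
          (\<Sum>l<d. of_bool (q l = i) * c (p(d := r), q(l := j, d := r))) +
          (if r = i then c (p(d := i), q(d := j)) else 0)"
        by (simp add: act_right_def)
    qed
    also have "\<dots> = act_right d (i, j) (contract d c) (p, q) + c (p(d := i), q(d := j))"
      by (simp add: sum.distrib act_right_def contract_def sum_distrib_left) (rule sum.swap)
    finally show ?thesis .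
  qed
  moreover have "(\<Sum>r\<in>UNIV. act_left (Suc d) (i, j) c (p(d := r), q(d := r))) =
      act_left d (i, j) (contract d c) (p, q) + c (p(d := i), q(d := j))"
  proof -
    have "(\<Sum>r\<in>UNIV. act_left (Suc d) (i, j) c (p(d := r), q(d := r))) =
        (\<Sum>r\<in>UNIV. (\<Sum>l<d. of_bool (p l = j) * c (p(l := i, d := r), q(d := r))) +
          (if r = j then c (p(d := i), q(d := j)) else 0))"
    proof (rule sum.cong[OF refl])
      fix r
      have "(\<Sum>l<d. of_bool ((p(d := r)) l = j) * c ((p(d := r))(l := i), q(d := r))) =
          (\<Sum>l<d. of_bool (p l = j) * c (p(l := i, d := r), q(d := r)))"
        by (intro sum.cong refl) (auto simp: fun_upd_twist)
      then show "act_left (Suc d) (i, j) c (p(d := r), q(d := r)) =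
          (\<Sum>l<d. of_bool (p l = j) * c (p(l := i, d := r), q(d := r))) +
          (if r = j then c (p(d := i), q(d := j)) else 0)"
        by (simp add: act_left_def)
    qed
    also have "\<dots> = act_left d (i, j) (contract d c) (p, q) + c (p(d := i), q(d := j))"
      by (simp add: sum.distrib act_left_def contract_def sum_distrib_left) (rule sum.swap)
    finally show ?thesis .
  qed
  ultimately show "act_right d s (contract d c) x = act_left d s (contract d c) x"
    by (simp add: pq)
qed

text \<open>Invariance replaces the inner left action by a right action. The sum over j then forces
  \<open>p l = q l'\<close>, and the sum over i contracts the first index of position l with the
  second index of position l'.\<close>

lemma casimir_invariant_tensor:
  fixes c :: "(nat \<Rightarrow> 'n::finite) \<times> (nat \<Rightarrow> 'n) \<Rightarrow> 'c::comm_ring_1"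
  assumes "invariant_tensor d c" and pq: "(p, q) \<in> positions d"
  shows "casimir d c (p, q) =
    (\<Sum>l<d. \<Sum>l'<d. of_bool (p l = q l') * (\<Sum>i\<in>UNIV. c (p(l := i), q(l' := i))))"
proof -
  have "act_left d (i, j) (act_left d (j, i) c) (p, q) = act_left d (i, j) (act_right d (j, i) c) (p, q)" for i j
    by (rule act_left_cong[OF _ pq]) (use assms(1) in \<open>simp add: invariant_tensor_def\<close>)
  then have "casimir d c (p, q) = (\<Sum>(i, j)\<in>UNIV. act_left d (i, j) (act_right d (j, i) c) (p, q))"
    by (simp add: casimir_def)
  also have "\<dots> = (\<Sum>i\<in>UNIV. \<Sum>j\<in>UNIV. \<Sum>l<d. \<Sum>l'<d.
      of_bool (p l = j) * (of_bool (q l' = j) * c (p(l := i), q(l' := i))))"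
    unfolding UNIV_Times_UNIV[symmetric]
    by (subst sum.cartesian_product[symmetric]) (simp add: act_left_def act_right_def sum_distrib_left)
  also have "\<dots> = (\<Sum>i\<in>UNIV. \<Sum>l<d. \<Sum>l'<d. \<Sum>j\<in>UNIV.
      of_bool (p l = j) * (of_bool (q l' = j) * c (p(l := i), q(l' := i))))"
    by (rule sum.cong[OF refl], subst sum.swap, rule sum.cong[OF refl], rule sum.swap)
  also have "\<dots> = (\<Sum>i\<in>UNIV. \<Sum>l<d. \<Sum>l'<d. of_bool (p l = q l') * c (p(l := i), q(l' := i)))"
  proof (intro sum.cong refl)
    fix i l l'
    have "(\<Sum>j\<in>UNIV. of_bool (p l = j) * (of_bool (q l' = j) * c (p(l := i), q(l' := i)))) =
        (\<Sum>j\<in>UNIV. if j = p l then of_bool (p l = q l') * c (p(l := i), q(l' := i)) else 0)"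
      by (rule sum.cong) auto
    then show "(\<Sum>j\<in>UNIV. of_bool (p l = j) * (of_bool (q l' = j) * c (p(l := i), q(l' := i)))) =
        of_bool (p l = q l') * c (p(l := i), q(l' := i))"
      by simp
  qed
  also have "\<dots> = (\<Sum>l<d. \<Sum>l'<d. of_bool (p l = q l') * (\<Sum>i\<in>UNIV. c (p(l := i), q(l' := i))))"
    by (subst sum.swap, rule sum.cong[OF refl], subst sum.swap) (simp add: sum_distrib_left)
  finally show ?thesis .
qed

text \<open>
  The first fundamental theorem. The operator \<open>casimir\<close> is injective and stabilises the span of
  the pairings; it maps an invariant tensor to a sum of contractions, which are known by induction.
\<close>
theorem invariant_tensor_pairing_span:
  fixes c :: "(nat \<Rightarrow> 'n::finite) \<times> (nat \<Rightarrow> 'n) \<Rightarrow> 'c::field_char_0"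
  assumes "invariant_tensor d c"
  shows "c \<in> pairing_span d"
  using assms
proof (induction d arbitrary: c)
  case 0
  define u where "u = (\<lambda>_ :: nat. undefined :: 'n)"
  have "positions 0 = {(u, u)}"
    by (auto simp: positions_def index_maps_def u_def)
  then show ?case
    by (intro pairing_spanI[of id _ _ "c (u, u)"]) (auto simp: pairing_def)
next
  case (Suc d)
  have contraction: "(\<lambda>(p, q). of_bool (p l = q l') * (\<Sum>i\<in>UNIV. c (p(l := i), q(l' := i)))) \<in> pairing_span (Suc d)"
    if "l < Suc d" "l' < Suc d" for l l'
  proof -
    \<comment> \<open>First and second indices are permuted independently, so that the contracted
      pair comes to stand in the last position, where \<open>contract\<close> and the induction
      hypothesis apply.\<close>
    define \<alpha> where "\<alpha> = Transposition.transpose l d"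
    define \<beta> where "\<beta> = Transposition.transpose l' d"
    have perm: "\<alpha> permutes {..<Suc d}" "\<beta> permutes {..<Suc d}"
      using that by (auto simp: \<alpha>_def \<beta>_def intro: transpose_permutes)
    have invol: "\<alpha> \<circ> \<alpha> = id" "\<beta> \<circ> \<beta> = id" "\<alpha> d = l" "\<beta> d = l'"
      by (simp_all add: \<alpha>_def \<beta>_def)
    define c' where "c' = contract d (\<lambda>(p, q). c (p \<circ> \<alpha>, q \<circ> \<beta>))"
    have "c' \<in> pairing_span d"
      unfolding c'_def by (intro Suc.IH invariant_tensor_contract invariant_tensor_permute Suc.prems perm)
    then obtain b where b: "\<And>x. x \<in> positions d \<Longrightarrow> c' x = (\<Sum>\<pi> | \<pi> permutes {..<d}. b \<pi> * pairing d \<pi> x)"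
      unfolding pairing_span_def by blast
    have "(\<lambda>x. \<Sum>\<pi> | \<pi> permutes {..<d}. b \<pi> * pairing (Suc d) (\<beta> \<circ> \<pi> \<circ> inv \<alpha>) x) \<in> pairing_span (Suc d)"
    proof (intro pairing_span_sum pairing_spanI[OF _ refl])
      fix \<pi> assume "\<pi> \<in> {\<pi>. \<pi> permutes {..<d}}"
      then have "\<pi> permutes {..<Suc d}"
        using permutes_subset[of \<pi> "{..<d}" "{..<Suc d}"] by auto
      then show "\<beta> \<circ> \<pi> \<circ> inv \<alpha> permutes {..<Suc d}"
        using permutes_compose permutes_inv perm by blast
    qed
    moreover have "of_bool (p l = q l') * (\<Sum>i\<in>UNIV. c (p(l := i), q(l' := i))) =
        (\<Sum>\<pi> | \<pi> permutes {..<d}. b \<pi> * pairing (Suc d) (\<beta> \<circ> \<pi> \<circ> inv \<alpha>) (p, q))"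
      if "(p, q) \<in> positions (Suc d)" for p q
    proof -
      define p' where "p' = restrict (p \<circ> \<alpha>) {..<d}"
      define q' where "q' = restrict (q \<circ> \<beta>) {..<d}"
      have mem: "p \<circ> \<alpha> \<in> index_maps (Suc d)" "q \<circ> \<beta> \<in> index_maps (Suc d)"
        using that perm index_maps_compose by (auto simp: positions_def)
      have pq': "(p', q') \<in> positions d"
        by (simp add: p'_def q'_def positions_def index_maps_def)
      have "p'(d := i) = (p \<circ> \<alpha>)(d := i)" "q'(d := i) = (q \<circ> \<beta>)(d := i)" for i
        using mem by (auto simp: p'_def q'_def fun_eq_iff restrict_def index_maps_def PiE_iff extensional_def)
      moreover have "(p \<circ> \<alpha>)(d := i) \<circ> \<alpha> = p(l := i)" "(q \<circ> \<beta>)(d := i) \<circ> \<beta> = q(l' := i)" for i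
        by (auto simp: fun_eq_iff \<alpha>_def \<beta>_def Transposition.transpose_def)
      ultimately have "(\<Sum>i\<in>UNIV. c (p(l := i), q(l' := i))) = c' (p', q')"
        by (simp add: c'_def contract_def)
      also have "\<dots> = (\<Sum>\<pi> | \<pi> permutes {..<d}. b \<pi> * pairing d \<pi> (p', q'))"
        by (rule b[OF pq'])
      finally have "of_bool (p l = q l') * (\<Sum>i\<in>UNIV. c (p(l := i), q(l' := i))) =
          (\<Sum>\<pi> | \<pi> permutes {..<d}. b \<pi> * (of_bool (p l = q l') * pairing d \<pi> (p', q')))"
        by (simp add: sum_distrib_left mult_ac)
      also have "\<dots> = (\<Sum>\<pi> | \<pi> permutes {..<d}. b \<pi> * pairing (Suc d) \<pi> (p \<circ> \<alpha>, q \<circ> \<beta>))"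
      proof (rule sum.cong[OF refl])
        fix \<pi> assume "\<pi> \<in> {\<pi>. \<pi> permutes {..<d}}"
        then have \<pi>: "\<pi> permutes {..<d}"
          by simp
        have "\<pi> d = d" "\<And>x. x < d \<Longrightarrow> \<pi> x < d"
          using permutes_not_in[OF \<pi>, of d] permutes_in_image[OF \<pi>] by auto
        \<comment> \<open>\<pi> fixes \<open>d\<close>, so the extra condition at position
          \<open>d\<close> is exactly \<open>p l = q l'\<close>; this extends a pairing on d
          positions to one on d + 1 positions.\<close>
        then have "(p l = q l' \<and> (\<forall>x<d. p' x = q' (\<pi> x))) \<longleftrightarrow> (\<forall>x<Suc d. (p \<circ> \<alpha>) x = (q \<circ> \<beta>) (\<pi> x))"
          using invol by (auto simp: p'_def q'_def less_Suc_eq)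
        then show "b \<pi> * (of_bool (p l = q l') * pairing d \<pi> (p', q')) = b \<pi> * pairing (Suc d) \<pi> (p \<circ> \<alpha>, q \<circ> \<beta>)"
          by (auto simp: pairing_def)
      qed
      finally show ?thesis
        by (simp add: pairing_compose[OF perm])
    qed
    ultimately show ?thesis
      by (subst pairing_span_cong) auto
  qed
  have "casimir (Suc d) c \<in> pairing_span (Suc d)"
  proof -
    have "(\<lambda>x. \<Sum>l<Suc d. \<Sum>l'<Suc d. (\<lambda>(p, q). of_bool (p l = q l') * (\<Sum>i\<in>UNIV. c (p(l := i), q(l' := i)))) x)
        \<in> pairing_span (Suc d)"
      by (intro pairing_span_sum contraction) auto
    then show ?thesis
      by (subst pairing_span_cong) (auto simp: casimir_invariant_tensor[OF Suc.prems])
  qed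
  define W where "W = (positions (Suc d) :: ((nat \<Rightarrow> 'n) \<times> (nat \<Rightarrow> 'n)) set)"
  define L where "L = {c \<in> pairing_span (Suc d). \<forall>x. x \<notin> W \<longrightarrow> c x = (0 :: 'c)}"
  define N where "N = (casimir_kernel (Suc d) :: (nat \<Rightarrow> 'n) \<times> (nat \<Rightarrow> 'n) \<Rightarrow> _)"
  have N: "int_op W N e x = casimir (Suc d) e x" if "x \<in> W" for e :: "_ \<Rightarrow> 'c" and x
    using that by (simp add: W_def N_def int_op_casimir)
  have NL: "int_op W N e \<in> L" if "casimir (Suc d) e \<in> pairing_span (Suc d)" for e
  proof -
    have "int_op W N e \<in> pairing_span (Suc d)"
      using that pairing_span_cong[of "Suc d" "int_op W N e" "casimir (Suc d) e"] N by (simp add: W_def)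
    then show ?thesis
      by (simp add: L_def int_op_def)
  qed
  \<comment> \<open>The Casimir operator is injective on the finite-dimensional span, hence
    surjective there, and the image of \<open>c\<close> has a preimage \<open>e\<close> in the span.
    Injectivity on all tensors then identifies \<open>c\<close> with \<open>e\<close>.\<close>
  have "\<exists>e\<in>L. int_op W N e = int_op W N c"
  proof (rule int_op_surj)
    show "finite W"
      by (simp add: W_def finite_positions)
    show "int_op W N c \<in> L"
      by (rule NL) fact
    show "int_op W N e \<in> L" if "e \<in> L" for e
      using that NL casimir_pairing_span by (auto simp: L_def)
    show "e = (\<lambda>_. 0)" if "e \<in> L" "int_op W N e = (\<lambda>_. 0)" for e
    proof
      fix x
      have "casimir (Suc d) e y = 0" if "y \<in> positions (Suc d)" for y
        using N[of y e] that \<open>int_op W N e = (\<lambda>_. 0)\<close> by (simp add: W_def)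
      then have "x \<in> W \<Longrightarrow> e x = 0"
        using casimir_injective[of "Suc d" e x] unfolding W_def by blast
      then show "e x = 0"
        using \<open>e \<in> L\<close> unfolding L_def by blast
    qed
  qed (auto simp: L_def pairing_span_zero pairing_span_add pairing_span_scale)
  then obtain e where e: "e \<in> pairing_span (Suc d)" "int_op W N e = int_op W N c"
    by (auto simp: L_def)
  have "casimir (Suc d) (\<lambda>x. c x - e x) y = 0" if "y \<in> positions (Suc d)" for y
  proof -
    have "y \<in> W"
      using that by (simp add: W_def)
    then show ?thesis
      using N[of y "\<lambda>x. c x - e x"] fun_cong[OF e(2), of y]
        int_op_add[of W N c "\<lambda>x. - 1 * e x" y] int_op_scale[of W N "- 1" e y] by simp
  qed
  then have "c x = e x" if "x \<in> positions (Suc d)" for x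
    using casimir_injective[of "Suc d" "\<lambda>x. c x - e x" x] that by simp
  then show ?case
    using e(1) pairing_span_cong by blast
qed

section \<open>The ideal of commuting matrices\<close>

lemma matrix_mul_diff_right: "A ** (B - C) = A ** B - A ** (C :: 'a::comm_ring_1^'n^'m)"
  and matrix_mul_diff_left: "(B' - C') ** A' = B' ** A' - C' ** (A' :: 'a::comm_ring_1^'n^'m)"
  by (simp_all add: matrix_matrix_mult_def vec_eq_iff algebra_simps sum_subtractf)

section \<open>Congruence and commutation of matrices modulo an ideal\<close>

context type_ideal
begin

definition mat_cong :: "'a^'n^'m \<Rightarrow> 'a^'n^'m \<Rightarrow> bool" where
  "mat_cong M N \<longleftrightarrow> (\<forall>i j. M $ i $ j - N $ i $ j \<in> J)"

lemma mat_cong_refl: "mat_cong M M"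
  by (simp add: mat_cong_def zero_mem)

lemma mat_cong_sym: "mat_cong M N \<Longrightarrow> mat_cong N M"
  by (auto simp: mat_cong_def diff_sym)

lemma mat_cong_trans [trans]: "mat_cong L M \<Longrightarrow> mat_cong M N \<Longrightarrow> mat_cong L N"
  unfolding mat_cong_def using diff_trans by blast

lemma mat_cong_mult: "mat_cong M M' \<Longrightarrow> mat_cong N N' \<Longrightarrow> mat_cong (M ** N) (M' ** N')"
  by (auto simp: mat_cong_def matrix_matrix_mult_def intro!: diff_sum diff_mult)

lemma mat_mult_mem:
  fixes Z :: "'a^'n^'n"
  assumes "\<And>i j. Z $ i $ j \<in> J"
  shows "(M ** Z) $ i $ j \<in> J" "(Z ** M) $ i $ j \<in> J"
  by (simp_all add: matrix_matrix_mult_def sum_mem mult_mem mult_mem_right assms)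

definition commute_mod :: "'a^'n^'n \<Rightarrow> 'a^'n^'n \<Rightarrow> bool" where
  "commute_mod M N \<longleftrightarrow> mat_cong (M ** N) (N ** M)"

lemma commute_mod_sym: "commute_mod M N \<Longrightarrow> commute_mod N M"
  by (simp add: commute_mod_def mat_cong_sym)

lemma commute_mod_one: "commute_mod M (mat 1)"
  by (simp add: commute_mod_def mat_cong_refl)

lemma commute_mod_mult:
  assumes "commute_mod M N" "commute_mod M N'"
  shows "commute_mod M (N ** N')"
proof -
  have "mat_cong (M ** N ** N') (N ** M ** N')"
    using assms(1) by (auto simp: commute_mod_def intro: mat_cong_mult mat_cong_refl)
  also have "mat_cong (N ** M ** N') (N ** (N' ** M))"
    unfolding matrix_mul_assoc[symmetric]
    using assms(2) by (auto simp: commute_mod_def intro: mat_cong_mult mat_cong_refl)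
  finally show ?thesis
    by (simp add: commute_mod_def matrix_mul_assoc)
qed

lemma commute_mod_mpow: "commute_mod M N \<Longrightarrow> commute_mod M (mpow N n)"
  by (induction n) (simp_all add: commute_mod_one commute_mod_mult)

lemma commute_mod_list_monomial:
  "(\<And>k. commute_mod M (U k)) \<Longrightarrow> commute_mod M (list_monomial U e ks)"
  by (induction ks) (simp_all add: commute_mod_one commute_mod_mult commute_mod_mpow)

lemma mpow_add: "mpow (M :: 'b::comm_ring_1^'n^'n) (a + b) = mpow M a ** mpow M b"
  by (induction a) (simp_all add: matrix_mul_assoc)

text \<open>The power of \<open>U k\<close> in the second monomial has to pass the tail of the first
  one, with which it commutes modulo the ideal; powers of the same matrix then merge.\<close>

lemma list_monomial_mult:
  assumes "\<And>k h. commute_mod (U k) (U h)"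
  shows "mat_cong (list_monomial U e ks ** list_monomial U f ks) (list_monomial U (\<lambda>k. e k + f k) ks)"
proof (induction ks)
  case Nil
  then show ?case
    by (simp add: mat_cong_refl)
next
  case (Cons k ks)
  define A B L M where "A = mpow (U k) (e k)" and "B = mpow (U k) (f k)"
    and "L = list_monomial U e ks" and "M = list_monomial U f ks"
  have "commute_mod B L"
    unfolding B_def L_def
    by (intro commute_mod_list_monomial commute_mod_sym[OF commute_mod_mpow] assms)
  then have "mat_cong (L ** B) (B ** L)"
    unfolding commute_mod_def by (rule mat_cong_sym)
  then have "mat_cong (A ** (L ** B) ** M) (A ** (B ** L) ** M)"
    by (rule mat_cong_mult[OF mat_cong_mult[OF mat_cong_refl] mat_cong_refl])
  also have "mat_cong (A ** (B ** L) ** M) (A ** B ** list_monomial U (\<lambda>k. e k + f k) ks)"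
    using mat_cong_mult[OF mat_cong_refl Cons.IH, of "A ** B"] by (simp add: matrix_mul_assoc L_def M_def)
  finally show ?case
    by (simp add: matrix_mul_assoc mpow_add A_def B_def L_def M_def)
qed

lemma monomial_mult:
  assumes "\<And>k h. commute_mod (U k) (U h)"
  shows "mat_cong (monomial U e ** monomial U f) (monomial U (\<lambda>k. e k + f k))"
  unfolding monomial_def by (rule list_monomial_mult) (rule assms)

end

section \<open>The ideal generated by the commutators of the generic matrices\<close>

lemma type_ideal_vimage:
  assumes "rhom \<phi>" "type_ideal J"
  shows "type_ideal {x. \<phi> x \<in> J}"
proof -
  interpret type_ideal J by fact
  interpret \<phi>: rhom \<phi> by fact
  show ?thesis
    by (intro type_ideal.intro idealI_type) (simp_all add: \<phi>.zero \<phi>.add \<phi>.mult zero_mem add_mem mult_mem)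
qed

lemma type_ideal_zero: "type_ideal {0 :: 'a::comm_ring_1}"
  by (intro type_ideal.intro idealI_type) auto

interpretation comm: type_ideal "comm_ideal :: ('n::finite, 'm::finite, 'k::comm_ring_1) gen_poly set"
proof (rule type_ideal.intro)
  interpret R: cring "type_ring :: ('n, 'm, 'k) gen_poly ring"
    by (rule type_ring_cring)
  show "ideal (comm_ideal :: ('n, 'm, 'k) gen_poly set) type_ring"
    unfolding comm_ideal_def A_ring_def by (rule R.genideal_ideal) simp
qed

lemma commutator_in_comm_ideal:
  "((generic_matrix k ** generic_matrix h - generic_matrix h ** generic_matrix k) $ i $ j
    :: ('n::finite, 'm::finite, 'k::comm_ring_1) gen_poly) \<in> comm_ideal"
proof -
  interpret R: cring "type_ring :: ('n, 'm, 'k) gen_poly ring"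
    by (rule type_ring_cring)
  show ?thesis
    unfolding comm_ideal_def A_ring_def by (rule subsetD[OF R.genideal_self]) auto
qed

lemma comm_ideal_least:
  fixes J :: "('n::finite, 'm::finite, 'k::comm_ring_1) gen_poly set"
  assumes "type_ideal J"
    "\<And>k h i j. (generic_matrix k ** generic_matrix h - generic_matrix h ** generic_matrix k) $ i $ j \<in> J"
    "x \<in> comm_ideal"
  shows "x \<in> J"
proof -
  interpret R: cring "type_ring :: ('n, 'm, 'k) gen_poly ring"
    by (rule type_ring_cring)
  have "comm_ideal \<subseteq> J"
    unfolding comm_ideal_def A_ring_def
    by (rule R.genideal_minimal) (use assms(1,2) in \<open>auto simp: type_ideal_def\<close>)
  with assms(3) show ?thesis
    by blast
qed

lemma commute_mod_generic:
  "comm.commute_mod (generic_matrix k :: ('n::finite, 'm::finite, 'k::comm_ring_1) gen_poly^'n^'n) (generic_matrix h)"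
  unfolding comm.commute_mod_def comm.mat_cong_def
proof (intro allI)
  fix i j :: 'n
  show "(generic_matrix k ** generic_matrix h) $ i $ j - (generic_matrix h ** generic_matrix k) $ i $ j
      \<in> (comm_ideal :: ('n, 'm, 'k) gen_poly set)"
    using commutator_in_comm_ideal[of k h i j] by simp
qed

lemma rhom_vanishes_on_comm_ideal:
  assumes \<phi>: "rhom \<phi>" and "x \<in> comm_ideal"
    and "\<And>k h. map_matrix \<phi> (generic_matrix k) ** map_matrix \<phi> (generic_matrix h) =
      map_matrix \<phi> (generic_matrix h) ** map_matrix \<phi> (generic_matrix k)"
  shows "\<phi> x = 0"
proof -
  have "\<phi> ((generic_matrix k ** generic_matrix h - generic_matrix h ** generic_matrix k) $ i $ j) = 0" for k h i j
  proof -
    have "map_matrix \<phi> (generic_matrix k ** generic_matrix h - generic_matrix h ** generic_matrix k) = 0"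
      by (simp add: rhom.map_matrix_diff[OF \<phi>] rhom.map_matrix_mult[OF \<phi>] assms(3)[of k h])
    then show ?thesis
      by (metis map_matrix_nth zero_index)
  qed
  then have "x \<in> {x. \<phi> x \<in> {0}}"
    by (intro comm_ideal_least[OF type_ideal_vimage[OF \<phi> type_ideal_zero] _ assms(2)]) simp
  then show ?thesis
    by simp
qed

lemma Delta_comm_ideal: "x \<in> comm_ideal \<Longrightarrow> Delta x = 0"
  by (rule rhom_vanishes_on_comm_ideal[OF Delta_rhom])
    (simp_all add: Delta_generic diag_mat_mult mult.commute)

text \<open>A commutator of generic matrices is conjugated as a whole, so its new entries are
  combinations of the old ones with constant coefficients.\<close>

lemma GL_act_comm_ideal:
  fixes x :: "('n::finite, 'm::finite, 'k::comm_ring_1) gen_poly"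
  assumes g: "g \<in> GL" and "x \<in> comm_ideal"
  shows "GL_act g x \<in> comm_ideal"
proof -
  let ?C = "map_matrix Const :: 'k^'n^'n \<Rightarrow> ('n, 'm, 'k) gen_poly^'n^'n"
  have "GL_act g ((generic_matrix k ** generic_matrix h - generic_matrix h ** generic_matrix k) $ i $ j) \<in> comm_ideal"
    for k h :: 'm and i j :: 'n
  proof -
    define Z where "Z = generic_matrix k ** generic_matrix h - generic_matrix h ** (generic_matrix k :: ('n, 'm, 'k) gen_poly^'n^'n)"
    have "map_matrix (GL_act g) Z = ?C (matrix_inv g) ** Z ** ?C g"
      unfolding Z_def rhom.map_matrix_diff[OF GL_act_rhom] rhom.map_matrix_mult[OF GL_act_rhom] GL_act_generic
      by (simp add: conj_mult map_Const_inverse matrix_inv_GL[OF g] matrix_mul_diff_left matrix_mul_diff_right)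
    moreover have "(?C (matrix_inv g) ** Z ** ?C g) $ i $ j \<in> comm_ideal"
      unfolding Z_def by (intro comm.mat_mult_mem commutator_in_comm_ideal)
    ultimately show ?thesis
      by (metis Z_def map_matrix_nth)
  qed
  then have "x \<in> {x. GL_act g x \<in> comm_ideal}"
    by (intro comm_ideal_least[OF type_ideal_vimage[OF GL_act_rhom comm.type_ideal_axioms] _ assms(2)]) simp
  then show ?thesis
    by simp
qed

section \<open>Infinitesimal invariance\<close>

text \<open>Differences of distinct values \<open>\<kappa> s\<close> are units, being images of
  nonzero field elements. Splitting off the linear factor at one value therefore keeps the quotient
  in the ideal at all other values, while its degree is smaller. This works for an arbitrary ideal
  \<open>J\<close>.\<close>

lemma (in type_ideal) coeff_mem_of_infinitely_many_values:
  fixes \<kappa> :: "'k::field \<Rightarrow> 'a"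
  assumes \<kappa>: "rhom \<kappa>" and "infinite S" and "\<And>s. s \<in> S \<Longrightarrow> poly p (\<kappa> s) \<in> J"
  shows "Polynomial.coeff p i \<in> J"
  using assms(2,3)
proof (induction "Polynomial.degree p" arbitrary: p S i rule: less_induct)
  case less
  show ?case
  proof (cases "Polynomial.degree p = 0")
    case True
    then obtain a where p: "p = [:a:]"
      by (auto elim: degree_eq_zeroE)
    obtain s where "s \<in> S"
      using less.prems(1) by (metis finite.emptyI ex_in_conv)
    then have "a \<in> J"
      using less.prems(2)[of s] by (simp add: p)
    then show ?thesis
      by (cases i) (simp_all add: p zero_mem)
  next
    case False
    obtain s0 where s0: "s0 \<in> S"
      using less.prems(1) by (metis finite.emptyI ex_in_conv)
    define q where "q = synthetic_div p (\<kappa> s0)"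
    have p: "p = [:- \<kappa> s0, 1:] * q + [:poly p (\<kappa> s0):]"
      using synthetic_div_correct'[of "\<kappa> s0" p] by (simp add: q_def)
    have q: "poly q (\<kappa> s) \<in> J" if "s \<in> S - {s0}" for s
    proof -
      have "(\<kappa> s - \<kappa> s0) * poly q (\<kappa> s) = poly p (\<kappa> s) - poly p (\<kappa> s0)"
        by (subst (1) p) (simp add: algebra_simps)
      then have "(\<kappa> s - \<kappa> s0) * poly q (\<kappa> s) \<in> J"
        using less.prems(2)[of s] less.prems(2)[OF s0] that diff_mem by simp
      then have "\<kappa> (inverse (s - s0)) * (\<kappa> (s - s0) * poly q (\<kappa> s)) \<in> J"
        using mult_mem by (simp add: rhom.diff[OF \<kappa>])
      also have "\<kappa> (inverse (s - s0)) * (\<kappa> (s - s0) * poly q (\<kappa> s)) = \<kappa> (inverse (s - s0) * (s - s0)) * poly q (\<kappa> s)"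
        by (simp only: rhom.mult[OF \<kappa>] mult.assoc)
      finally show ?thesis
        using that by (simp add: rhom.one[OF \<kappa>])
    qed
    have "Polynomial.degree q < Polynomial.degree p"
      using False by (simp add: q_def degree_synthetic_div)
    moreover have "infinite (S - {s0})"
      using less.prems(1) by simp
    ultimately have coeffs: "Polynomial.coeff q j \<in> J" for j
      by (rule less.hyps) (rule q)
    have "Polynomial.coeff ([:- \<kappa> s0, 1:] * q) i \<in> J"
      by (cases i) (simp_all add: coeffs mult_mem diff_mem uminus_mem)
    moreover have "Polynomial.coeff [:poly p (\<kappa> s0):] i \<in> J"
      using less.prems(2)[OF s0] by (cases i) (simp_all add: zero_mem)
    ultimately show ?thesis
      by (subst p) (simp add: add_mem)
  qed
qed

lemma const_poly_rhom: "rhom (\<lambda>c. [:\<phi> c:])" if "rhom \<phi>"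
  using that by (auto simp: rhom_def one_pCons)

text \<open>The linear coefficient in s of (1 - s x) \<xi> (1 + s x), where \<xi> is the generic
  matrix of index k: the infinitesimal form of \<open>GL_act\<close>.\<close>

definition bracket :: "'k::comm_ring_1^'n^'n \<Rightarrow> 'm \<Rightarrow> ('n::finite, 'm::finite, 'k) gen_poly^'n^'n" where
  "bracket x k = generic_matrix k ** map_matrix Const x - map_matrix Const x ** generic_matrix k"

text \<open>The derivation \<open>\<xi>\<^sub>k \<mapsto> \<xi>\<^sub>k x - x \<xi>\<^sub>k\<close>.\<close>
definition derivation_hom :: "'k::comm_ring_1^'n^'n \<Rightarrow> ('n::finite, 'm::finite, 'k) gen_poly \<Rightarrow> ('n, 'm, 'k) gen_poly poly" where
  "derivation_hom x = subst (\<lambda>c. [:Const c:]) (\<lambda>(k, i, j). [:Var (k, i, j), bracket x k $ i $ j:])"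

text \<open>As the linear coefficient of a homomorphism into polynomials in a parameter, whose
  constant coefficient is the identity, it inherits the Leibniz rule from the formula for
  coefficients of a product.\<close>

definition derivation :: "'k::comm_ring_1^'n^'n \<Rightarrow> ('n::finite, 'm::finite, 'k) gen_poly \<Rightarrow> ('n, 'm, 'k) gen_poly" where
  "derivation x f = Polynomial.coeff (derivation_hom x f) 1"

lemma poly_rhom: "rhom (\<lambda>p. poly p a)"
  by unfold_locales simp_all

lemma coeff_0_hom:
  fixes \<rho> :: "('v, 'k::comm_ring_1) mpoly \<Rightarrow> ('v, 'k) mpoly poly"
  assumes "rhom \<rho>" "\<And>c. Polynomial.coeff (\<rho> (Const c)) 0 = Const c" "\<And>v. Polynomial.coeff (\<rho> (Var v)) 0 = Var v"
  shows "Polynomial.coeff (\<rho> f) 0 = f"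
proof -
  have "rhom (\<lambda>f. Polynomial.coeff (\<rho> f) 0)"
    using rhom_comp[OF assms(1) poly_rhom[of 0]] by (simp add: comp_def poly_0_coeff_0)
  moreover have "rhom (\<lambda>f. f)"
    by unfold_locales simp_all
  ultimately have "(\<lambda>f. Polynomial.coeff (\<rho> f) 0) = (\<lambda>f. f)"
    by (rule mpoly_hom_eqI) (simp_all add: assms)
  then show ?thesis
    by metis
qed

lemma coeff_1_mult: "Polynomial.coeff (p * q) 1 = Polynomial.coeff p 0 * Polynomial.coeff q 1 + Polynomial.coeff p 1 * Polynomial.coeff (q :: 'a::comm_ring_1 poly) 0"
  by (simp add: coeff_mult)

lemma derivation_hom_rhom: "rhom (derivation_hom x)"
  unfolding derivation_hom_def by (rule subst_rhom[OF const_poly_rhom[OF Const_rhom]])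

lemma derivation_hom_simps:
  "derivation_hom x (Const c) = [:Const c:]"
  "derivation_hom x (Var (k, i, j)) = [:Var (k, i, j), bracket x k $ i $ j:]"
  by (simp_all add: derivation_hom_def const_poly_rhom[OF Const_rhom])

lemma coeff_0_derivation_hom: "Polynomial.coeff (derivation_hom x f) 0 = f"
  by (rule coeff_0_hom[OF derivation_hom_rhom]) (auto simp: derivation_hom_simps split_paired_all)

lemma derivation_add: "derivation x (f + g) = derivation x f + derivation x g"
  by (simp add: derivation_def rhom.add[OF derivation_hom_rhom])

lemma derivation_diff: "derivation x (f - g) = derivation x f - derivation x g"
  by (simp add: derivation_def rhom.diff[OF derivation_hom_rhom])

lemma derivation_mult: "derivation x (f * g) = f * derivation x g + derivation x f * g"
  by (simp only: derivation_def rhom.mult[OF derivation_hom_rhom] coeff_1_mult coeff_0_derivation_hom)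

lemma derivation_Const [simp]: "derivation x (Const c) = 0"
  by (simp add: derivation_def derivation_hom_simps)

lemma derivation_one [simp]: "derivation x 1 = 0"
  using derivation_Const[of x 1] by simp

lemma derivation_Var: "derivation x (Var (k, i, j)) = bracket x k $ i $ j"
  by (simp add: derivation_def derivation_hom_simps)

lemma derivation_zero [simp]: "derivation x 0 = 0"
  using derivation_Const[of x 0] by simp

lemma derivation_sum: "derivation x (\<Sum>i\<in>S. f i) = (\<Sum>i\<in>S. derivation x (f i))"
  by (induction S rule: infinite_finite_induct) (simp_all add: derivation_add)

lemma derivation_prod:
  "finite S \<Longrightarrow> derivation x (\<Prod>i\<in>S. f i) = (\<Sum>i\<in>S. derivation x (f i) * (\<Prod>j\<in>S - {i}. f j))"
proof (induction S rule: finite_induct)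
  case (insert a S)
  have "(\<Sum>i\<in>S. derivation x (f i) * (\<Prod>j\<in>insert a S - {i}. f j)) =
      (\<Sum>i\<in>S. f a * (derivation x (f i) * (\<Prod>j\<in>S - {i}. f j)))"
  proof (rule sum.cong[OF refl])
    fix i assume "i \<in> S"
    then have "insert a S - {i} = insert a (S - {i})"
      using insert.hyps by auto
    then show "derivation x (f i) * (\<Prod>j\<in>insert a S - {i}. f j) = f a * (derivation x (f i) * (\<Prod>j\<in>S - {i}. f j))"
      using insert.hyps by simp
  qed
  then show ?case
    using insert by (simp add: derivation_mult sum_distrib_left)
qed simp

lemma derivation_eqI:
  fixes f :: "('n::finite, 'm::finite, 'k::comm_ring_1) gen_poly"
  assumes "\<And>f g. \<delta> (f + g) = \<delta> f + \<delta> g" "\<And>f g. \<delta> (f * g) = f * \<delta> g + \<delta> f * g"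
    "\<And>c. \<delta> (Const c) = 0" "\<And>k i j. \<delta> (Var (k, i, j)) = bracket x k $ i $ j"
  shows "derivation x f = \<delta> f"
proof (induction f rule: mpoly_induct)
  case (Var p v)
  then show ?case
    by (cases v) (simp add: derivation_mult derivation_Var assms)
qed (simp_all add: derivation_add assms)

lemma bracket_diff: "bracket (x - y) k = bracket x k - bracket y k"
  by (simp add: bracket_def rhom.map_matrix_diff[OF Const_rhom] matrix_mul_diff_left matrix_mul_diff_right)

lemma derivation_diff_arg: "derivation (x - y) f = derivation x f - derivation y f"
  by (rule derivation_eqI)
    (simp_all add: derivation_add derivation_mult derivation_Var bracket_diff algebra_simps)

lemma derivation_mat: "derivation (mat c) f = 0"
proof (rule derivation_eqI)
  fix k :: 'a and i j :: 'b
  have "map_matrix Const (mat c) = (mat (Const c) :: ('b, 'a, 'c) gen_poly^'b^'b)"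
    by (simp add: mat_def vec_eq_iff)
  moreover have "M ** mat (Const c) = mat (Const c) ** M" for M :: "('b, 'a, 'c) gen_poly^'b^'b"
    by (simp add: matrix_matrix_mult_def mat_def vec_eq_iff if_distrib[of "\<lambda>x. x * _"]
        if_distrib[of "\<lambda>x. _ * x"] mult.commute cong: if_cong)
  ultimately show "0 = bracket (mat c) k $ i $ j"
    by (simp add: bracket_def)
qed simp_all

lemma derivation_matrix_mult:
  "map_matrix (derivation x) (M ** N) = M ** map_matrix (derivation x) N + map_matrix (derivation x) M ** N"
  by (simp add: matrix_matrix_mult_def vec_eq_iff derivation_sum derivation_mult sum.distrib)

lemma derivation_generic: "map_matrix (derivation x) (generic_matrix k) = bracket x k"
  by (simp add: vec_eq_iff generic_matrix_def derivation_Var)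

lemma derivation_comm_ideal:
  fixes f :: "('n::finite, 'm::finite, 'k::comm_ring_1) gen_poly"
  assumes "f \<in> comm_ideal"
  shows "derivation x f \<in> comm_ideal"
proof -
  \<comment> \<open>Both conditions are required for an ideal: by the Leibniz rule the derivation of
    r f involves f itself as well as its derivation.\<close>
  let ?J = "{f \<in> comm_ideal. derivation x f \<in> comm_ideal} :: ('n, 'm, 'k) gen_poly set"
  have "type_ideal ?J"
    by (intro type_ideal.intro idealI_type)
      (simp_all add: comm.zero_mem comm.add_mem comm.mult_mem comm.mult_mem_right derivation_add derivation_mult)
  moreover have "(generic_matrix k ** generic_matrix h - generic_matrix h ** generic_matrix k) $ i $ j \<in> ?J"
    for k h :: 'm and i j :: 'n
  proof -
    define Y Z C where "Y = (generic_matrix k :: ('n, 'm, 'k) gen_poly^'n^'n)"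
      and "Z = (generic_matrix h :: ('n, 'm, 'k) gen_poly^'n^'n)"
      and "C = (map_matrix Const x :: ('n, 'm, 'k) gen_poly^'n^'n)"
    have "map_matrix (derivation x) (M - N) = map_matrix (derivation x) M - map_matrix (derivation x) N"
      for M N :: "('n, 'm, 'k) gen_poly^'n^'n"
      by (simp add: vec_eq_iff derivation_diff)
    then have "map_matrix (derivation x) (Y ** Z - Z ** Y) =
        Y ** bracket x h + bracket x k ** Z - (Z ** bracket x k + bracket x h ** Y)"
      by (simp add: derivation_matrix_mult Y_def Z_def derivation_generic)
    \<comment> \<open>The Jacobi identity: deriving the commutator of \<open>Y\<close> and
      \<open>Z\<close> gives the commutator of that commutator with the constant matrix
      \<open>C\<close>.\<close>
    also have "\<dots> = (Y ** Z - Z ** Y) ** C - C ** (Y ** Z - Z ** Y)"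
      by (simp add: bracket_def Y_def[symmetric] Z_def[symmetric] C_def[symmetric] matrix_mul_diff_left
          matrix_mul_diff_right matrix_mul_assoc)
    finally have eq: "map_matrix (derivation x) (Y ** Z - Z ** Y) = (Y ** Z - Z ** Y) ** C - C ** (Y ** Z - Z ** Y)" .
    have "derivation x ((Y ** Z - Z ** Y) $ i $ j) =
        ((Y ** Z - Z ** Y) ** C) $ i $ j - (C ** (Y ** Z - Z ** Y)) $ i $ j"
      using arg_cong[OF eq, of "\<lambda>M. M $ i $ j"] by (simp only: map_matrix_nth vector_minus_component)
    moreover have "((Y ** Z - Z ** Y) ** C) $ i $ j - (C ** (Y ** Z - Z ** Y)) $ i $ j \<in> comm_ideal"
      unfolding Y_def Z_def by (intro comm.diff_mem comm.mat_mult_mem commutator_in_comm_ideal)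
    ultimately have "derivation x ((Y ** Z - Z ** Y) $ i $ j) \<in> comm_ideal"
      by (simp only:)
    then show ?thesis
      using commutator_in_comm_ideal[of k h i j] by (simp add: Y_def Z_def)
  qed
  ultimately have "f \<in> ?J"
    using assms by (rule comm_ideal_least)
  then show ?thesis
    by simp
qed

lemma matrix_mul_add_left: "(B + C) ** A = B ** A + C ** (A :: 'a::comm_ring_1^'n^'m)"
  by (simp add: matrix_matrix_mult_def vec_eq_iff algebra_simps sum.distrib)

definition scale_matrix :: "'a::comm_ring_1 \<Rightarrow> 'a^'n^'n \<Rightarrow> 'a^'n^'n" where
  "scale_matrix c M = (\<chi> i j. c * M $ i $ j)"

lemma scale_matrix_zero: "scale_matrix c 0 = 0"
  by (simp add: scale_matrix_def vec_eq_iff)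

text \<open>If \<open>x\<^sup>2 = 0\<close>, then \<open>1 + s x\<close> is invertible for all \<open>s\<close> and acts polynomially in \<open>s\<close>.\<close>
lemma derivation_square_zero:
  fixes f :: "('n::finite, 'm::finite, 'k::field) gen_poly"
  assumes "infinite (UNIV :: 'k set)" and inv: "\<And>g. g \<in> GL \<Longrightarrow> GL_act g f - f \<in> comm_ideal"
    and x: "x ** x = 0"
  shows "derivation x f \<in> comm_ideal"
proof -
  define C where "C = (map_matrix Const x :: ('n, 'm, 'k) gen_poly^'n^'n)"
  \<comment> \<open>The action of 1 + s x with s as indeterminate. Expanding (1 - s x) \<xi> (1 + s
    x) gives \<open>bracket x k\<close> in degree one and - x \<xi> x in degree two.\<close>
  define \<rho> :: "('n, 'm, 'k) gen_poly \<Rightarrow> ('n, 'm, 'k) gen_poly poly" where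
    "\<rho> = subst (\<lambda>c. [:Const c:]) (\<lambda>(k, i, j). [:Var (k, i, j), bracket x k $ i $ j, - (C ** generic_matrix k ** C) $ i $ j:])"
  have \<rho>: "rhom \<rho>"
    unfolding \<rho>_def by (rule subst_rhom[OF const_poly_rhom[OF Const_rhom]])
  have \<rho>_simps: "\<rho> (Const c) = [:Const c:]"
    "\<rho> (Var (k, i, j)) = [:Var (k, i, j), bracket x k $ i $ j, - (C ** generic_matrix k ** C) $ i $ j:]" for c k i j
    by (simp_all add: \<rho>_def const_poly_rhom[OF Const_rhom])
  have coeff0: "Polynomial.coeff (\<rho> f) 0 = f" for f
    by (rule coeff_0_hom[OF \<rho>]) (auto simp: \<rho>_simps split_paired_all)
  have coeff1: "derivation x f = Polynomial.coeff (\<rho> f) 1" for f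
  proof (rule derivation_eqI)
    show "Polynomial.coeff (\<rho> (f * g)) 1 = f * Polynomial.coeff (\<rho> g) 1 + Polynomial.coeff (\<rho> f) 1 * g" for f g
      by (simp only: rhom.mult[OF \<rho>] coeff_1_mult coeff0)
  qed (simp_all add: rhom.add[OF \<rho>] \<rho>_simps)
  have val: "poly (\<rho> f) (Const s) = GL_act (mat 1 + scale_matrix s x) f" and GL: "mat 1 + scale_matrix s x \<in> GL" for s f
  proof -
    have smult: "scale_matrix s x ** y = scale_matrix s (x ** y)" "y ** scale_matrix s x = scale_matrix s (y ** x)" for y :: "'k^'n^'n"
      by (simp_all add: scale_matrix_def matrix_matrix_mult_def vec_eq_iff sum_distrib_left mult_ac)
    have inverse: "(mat 1 + scale_matrix s x) ** (mat 1 - scale_matrix s x) = mat 1" "(mat 1 - scale_matrix s x) ** (mat 1 + scale_matrix s x) = mat 1"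
      by (simp_all add: matrix_mul_diff_left matrix_mul_diff_right matrix_add_ldistrib matrix_mul_add_left smult x
          scale_matrix_zero)
    then show "mat 1 + scale_matrix s x \<in> GL"
      by (rule GL_I)
    have mi: "matrix_inv (mat 1 + scale_matrix s x) = mat 1 - scale_matrix s x"
      by (rule matrix_inv_unique[OF inverse])
    have "(\<lambda>f. poly (\<rho> f) (Const s)) = GL_act (mat 1 + scale_matrix s x)"
    proof (rule mpoly_hom_eqI)
      show "rhom (\<lambda>f. poly (\<rho> f) (Const s))"
        using rhom_comp[OF \<rho> poly_rhom[of "Const s"]] by (simp add: comp_def)
      fix v :: "'m \<times> 'n \<times> 'n"
      obtain k i j where v: "v = (k, i, j)"
        by (cases v)
      define G where "G = (generic_matrix k :: ('n, 'm, 'k) gen_poly^'n^'n)"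
      have C: "map_matrix Const (scale_matrix s x) = scale_matrix (Const s) C"
        by (simp add: C_def scale_matrix_def vec_eq_iff rhom.mult[OF Const_rhom])
      have smultC: "scale_matrix (Const s) M ** N = scale_matrix (Const s) (M ** N)" "N ** scale_matrix (Const s) M = scale_matrix (Const s) (N ** M)"
        for M N :: "('n, 'm, 'k) gen_poly^'n^'n"
        by (simp_all add: scale_matrix_def matrix_matrix_mult_def vec_eq_iff sum_distrib_left mult_ac)
      have "map_matrix (GL_act (mat 1 + scale_matrix s x)) G = (mat 1 - scale_matrix (Const s) C) ** G ** (mat 1 + scale_matrix (Const s) C)"
        unfolding G_def GL_act_generic mi
        by (simp add: rhom.map_matrix_diff[OF Const_rhom] rhom.map_matrix_add[OF Const_rhom]
            rhom.map_matrix_one[OF Const_rhom] C)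
      also have "\<dots> = G + scale_matrix (Const s) (G ** C - C ** G) - scale_matrix (Const s) (scale_matrix (Const s) (C ** G ** C))"
        by (simp add: matrix_mul_diff_left matrix_add_ldistrib smultC)
          (simp add: scale_matrix_def vec_eq_iff algebra_simps)
      finally have "map_matrix (GL_act (mat 1 + scale_matrix s x)) G $ i $ j =
          (G + scale_matrix (Const s) (G ** C - C ** G) - scale_matrix (Const s) (scale_matrix (Const s) (C ** G ** C))) $ i $ j"
        by simp
      then show "poly (\<rho> (Var v)) (Const s) = GL_act (mat 1 + scale_matrix s x) (Var v)"
        by (simp add: v \<rho>_simps bracket_def G_def C_def generic_matrix_def scale_matrix_def algebra_simps)
    qed (simp_all add: \<rho>_simps GL_act_rhom)
    then show "poly (\<rho> f) (Const s) = GL_act (mat 1 + scale_matrix s x) f"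
      by metis
  qed
  \<comment> \<open>The value at each s of the infinite field is the difference between the
    transform of \<open>f\<close> under 1 + s x and \<open>f\<close>; hence all coefficients lie in
    the ideal, and the linear one is the derivation.\<close>
  have "poly (\<rho> f - [:f:]) (Const s) \<in> comm_ideal" for s
    using inv[OF GL[of s]] by (simp add: val)
  then have "Polynomial.coeff (\<rho> f - [:f:]) 1 \<in> comm_ideal"
    by (intro comm.coeff_mem_of_infinitely_many_values[OF Const_rhom assms(1)])
  then show ?thesis
    by (simp add: coeff1)
qed

definition matrix_unit :: "'n \<Rightarrow> 'n \<Rightarrow> 'k::zero_neq_one^'n^'n" where
  "matrix_unit a b = (\<chi> i j. if i = a \<and> j = b then 1 else 0)"

lemma matrix_unit_mult:
  "matrix_unit a b ** matrix_unit c d = (if b = c then matrix_unit a d else 0 :: 'k::comm_ring_1^'n^'n)"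
proof -
  have "(\<Sum>r\<in>UNIV. (if i = a \<and> r = b then 1 else 0) * (if r = c \<and> j = d then 1 else 0)) =
      (if b = c then if i = a \<and> j = d then 1 else 0 else 0 :: 'k)" for i j
  proof -
    have "(\<Sum>r\<in>UNIV. (if i = a \<and> r = b then 1 else 0) * (if r = c \<and> j = d then 1 else 0)) =
        (\<Sum>r\<in>UNIV. if r = b then (if b = c \<and> i = a \<and> j = d then 1 else 0 :: 'k) else 0)"
      by (rule sum.cong) auto
    then show ?thesis
      by simp
  qed
  then show ?thesis
    by (simp add: matrix_unit_def matrix_matrix_mult_def vec_eq_iff)
qed

text \<open>Matrix units off the diagonal have square zero. On the diagonal, E_aa - E_bb is a
  combination of matrices of square zero, the identity matrix acts as zero, and n E_aa is the
  identity plus the sum over b of E_aa - E_bb. Division by n uses characteristic zero.\<close>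

lemma derivation_matrix_unit:
  fixes f :: "('n::finite, 'm::finite, 'k::field_char_0) gen_poly"
  assumes inv: "\<And>g. g \<in> GL \<Longrightarrow> GL_act g f - f \<in> comm_ideal"
  shows "derivation (matrix_unit a b) f \<in> comm_ideal"
proof -
  have inf: "infinite (UNIV :: 'k set)"
    by (rule infinite_UNIV_char_0)
  have off: "derivation (matrix_unit a b) f \<in> comm_ideal" if "a \<noteq> b" for a b
    by (rule derivation_square_zero[OF inf inv]) (use that in \<open>auto simp: matrix_unit_mult\<close>)
  have diag: "derivation (matrix_unit a a - matrix_unit b b) f \<in> comm_ideal" if "a \<noteq> b" for a b
  proof -
    \<comment> \<open>In the rows and columns a, b this is the matrix with rows (1, -1) and (1, -1),
      whose square is zero. The double negation writes a sum through differences, so that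
      \<open>derivation_diff_arg\<close> alone can split it.\<close>
    define y :: "'k^'n^'n" where "y = matrix_unit a a - matrix_unit b b - matrix_unit a b - (0 - matrix_unit b a)"
    have "y ** y = 0"
      using that by (simp add: y_def matrix_mul_diff_left matrix_mul_diff_right matrix_add_ldistrib matrix_mul_add_left matrix_unit_mult)
    then have "derivation y f \<in> comm_ideal"
      by (intro derivation_square_zero[OF inf]) (simp_all add: inv)
    moreover have "derivation 0 f = 0"
      using derivation_diff_arg[of 0 0 f] by simp
    then have "derivation y f = derivation (matrix_unit a a - matrix_unit b b) f
        - derivation (matrix_unit a b) f + derivation (matrix_unit b a) f"
      by (simp only: y_def derivation_diff_arg) simp
    then have "derivation (matrix_unit a a - matrix_unit b b) f =
        derivation y f + derivation (matrix_unit a b) f - derivation (matrix_unit b a) f"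
      by simp
    ultimately show ?thesis
      using off[OF that] off[OF that[symmetric]] by (simp add: comm.add_mem comm.diff_mem)
  qed
  show ?thesis
  proof (cases "a = b")
    case True
    have add: "derivation (x + y) f = derivation x f + derivation y f" for x y
      using derivation_diff_arg[of "x + y" y f] by simp
    have sum: "derivation (\<Sum>b\<in>S. x b) f = (\<Sum>b\<in>S. derivation (x b) f)" for x :: "'n \<Rightarrow> 'k^'n^'n" and S
      by (induction S rule: infinite_finite_induct)
        (use derivation_diff_arg[of 0 0 f] in \<open>simp_all add: add\<close>)
    have "(\<Sum>b\<in>UNIV. matrix_unit b b) = (mat 1 :: 'k^'n^'n)"
    proof -
      have "(\<Sum>b\<in>UNIV. matrix_unit b b :: 'k^'n^'n) $ i $ j = mat 1 $ i $ j" for i j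
      proof -
        have "(\<Sum>b\<in>UNIV. if i = b \<and> j = b then 1 else 0 :: 'k) = (\<Sum>b\<in>UNIV. if b = i then if i = j then 1 else 0 else 0)"
          by (rule sum.cong) auto
        then show ?thesis
          by (simp add: matrix_unit_def mat_def)
      qed
      then show ?thesis
        by (simp add: vec_eq_iff)
    qed
    then have "(\<Sum>b\<in>UNIV. derivation (matrix_unit b b) f) = 0"
      using sum[of "\<lambda>b. matrix_unit b b" UNIV] derivation_mat[of 1 f] by simp
    moreover have "(\<Sum>b\<in>UNIV. derivation (matrix_unit a a) f - derivation (matrix_unit b b) f) \<in> comm_ideal"
    proof (rule comm.sum_mem)
      fix b :: 'n
      show "derivation (matrix_unit a a) f - derivation (matrix_unit b b) f \<in> comm_ideal"
        using diag[of a b] by (cases "a = b") (simp_all add: comm.zero_mem derivation_diff_arg)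
    qed
    ultimately have "of_nat CARD('n) * derivation (matrix_unit a a) f \<in> comm_ideal"
      by (simp add: sum_subtractf)
    then have "Const (inverse (of_nat CARD('n))) * (of_nat CARD('n) * derivation (matrix_unit a a) f) \<in> comm_ideal"
      by (rule comm.mult_mem)
    moreover have "Const (inverse (of_nat CARD('n))) * of_nat CARD('n) = (1 :: ('n, 'm, 'k) gen_poly)"
      unfolding rhom.of_nat[OF Const_rhom, symmetric] rhom.mult[OF Const_rhom, symmetric] by simp
    ultimately show ?thesis
      using True by (simp add: mult.assoc[symmetric])
  qed (rule off)
qed

section \<open>Polynomials in matrix entries as tensors\<close>

text \<open>A monomial with its variables put in order: degree, labels of the matrices, row indices,
  column indices. Several words can name the same monomial, so a coefficient vector determines a
  polynomial but not conversely.\<close>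

type_synonym ('n, 'm) word = "nat \<times> (nat \<Rightarrow> 'm) \<times> (nat \<Rightarrow> 'n) \<times> (nat \<Rightarrow> 'n)"

text \<open>The bound on the degree makes the index set finite, as \<open>lift_invariant\<close>
  demands; the operators preserve the degree, so no word leaves the set.\<close>

definition words :: "nat \<Rightarrow> ('n, 'm) word set" where
  "words N = (SIGMA d:{..N}. index_maps d \<times> positions d)"

definition word_monomial :: "('n::finite, 'm::finite) word \<Rightarrow> ('n, 'm, 'k::comm_ring_1) gen_poly" where
  "word_monomial = (\<lambda>(d, ks, p, q). \<Prod>l<d. Var (ks l, p l, q l))"

definition word_poly :: "nat \<Rightarrow> (('n::finite, 'm::finite) word \<Rightarrow> 'k) \<Rightarrow> ('n, 'm, 'k::comm_ring_1) gen_poly" where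
  "word_poly N c = (\<Sum>w\<in>words N. Const (c w) * word_monomial w)"

lemma finite_words: "finite (words N :: ('n::finite, 'm::finite) word set)"
  by (simp add: words_def finite_index_maps finite_positions)

lemma words_mono: "N \<le> N' \<Longrightarrow> words N \<subseteq> words N'"
  by (auto simp: words_def)

lemma poly_mapping_single_induct [case_names 0 add]:
  fixes p :: "'a \<Rightarrow>\<^sub>0 'b::comm_monoid_add"
  assumes "P 0" "\<And>p t c. P p \<Longrightarrow> P (p + Poly_Mapping.single t c)"
  shows "P p"
proof -
  have "P (\<Sum>t\<in>S. Poly_Mapping.single t (Poly_Mapping.lookup p t))" if "finite S" for S
    using that
  proof (induction S)
    case (insert t S)
    then show ?case
      using assms(2)[OF insert.IH] by (simp add: add.commute)
  qed (simp add: assms)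
  then have "P (\<Sum>t\<in>Poly_Mapping.keys p. Poly_Mapping.single t (Poly_Mapping.lookup p t))"
    by simp
  then show ?thesis
    using poly_mapping_sum_single[of "Poly_Mapping.keys p" p] by simp
qed

lemma monomial_eq_word_monomial:
  fixes t :: "('m::finite \<times> 'n::finite \<times> 'n) \<Rightarrow>\<^sub>0 nat"
  shows "\<exists>N. \<exists>w\<in>words N. Poly_Mapping.single t (1 :: 'k::comm_ring_1) = word_monomial w"
proof (induction t rule: exponent_induct)
  case 0
  have "(0, \<lambda>_. undefined, \<lambda>_. undefined, \<lambda>_. undefined) \<in> words 0"
    by (simp add: words_def positions_def index_maps_def)
  moreover have "Poly_Mapping.single 0 (1 :: 'k) = word_monomial (0, \<lambda>_. undefined, \<lambda>_. undefined, \<lambda>_. undefined)"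
    by (simp add: word_monomial_def)
  ultimately show ?case
    by blast
next
  case (Suc t v)
  then obtain N w where w: "w \<in> words N" "Poly_Mapping.single t (1 :: 'k) = word_monomial w"
    by blast
  obtain d ks p q k i j where dec: "w = (d, ks, p, q)" "v = (k, i, j)"
    by (cases w, cases v)
  let ?w = "(Suc d, ks(d := k), p(d := i), q(d := j))"
  have "?w \<in> words (Suc N)"
    using w(1) by (auto simp: dec words_def positions_def intro: index_maps_update_Suc)
  moreover have "(\<Prod>l<d. Var ((ks(d := k)) l, (p(d := i)) l, (q(d := j)) l)) = (\<Prod>l<d. Var (ks l, p l, q l) :: ('n, 'm, 'k) gen_poly)"
    by (rule prod.cong) auto
  then have "Poly_Mapping.single (t + Poly_Mapping.single v 1) (1 :: 'k) = word_monomial ?w"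
    unfolding single_Suc_eq_mult_Var w(2) by (simp add: dec word_monomial_def)
  ultimately show ?case
    by blast
qed

lemma word_poly_surj:
  fixes f :: "('n::finite, 'm::finite, 'k::comm_ring_1) gen_poly"
  shows "\<exists>N c. (\<forall>w. w \<notin> words N \<longrightarrow> c w = 0) \<and> f = word_poly N c"
proof (induction f rule: poly_mapping_single_induct)
  case 0
  show ?case
    by (intro exI[of _ 0] exI[of _ "\<lambda>_. 0"]) (simp add: word_poly_def)
next
  case (add f t a)
  then obtain N c where c: "\<And>w. w \<notin> words N \<Longrightarrow> c w = 0" "f = word_poly N c"
    by blast
  obtain M w where w: "w \<in> words M" "Poly_Mapping.single t (1 :: 'k) = word_monomial w"
    using monomial_eq_word_monomial by blast
  let ?N = "max N M"
  have "word_poly N c = word_poly ?N c"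
    unfolding word_poly_def
    by (rule sum.mono_neutral_left) (use c(1) words_mono[of N ?N] in \<open>auto simp: finite_words\<close>)
  moreover have w': "w \<in> words ?N"
    using words_mono[of M ?N] w(1) by auto
  have "word_poly ?N (\<lambda>x. if x = w then a else 0) = (\<Sum>x\<in>words ?N. if x = w then Const a * word_monomial x else 0)"
    unfolding word_poly_def by (rule sum.cong) auto
  then have "word_poly ?N (\<lambda>x. if x = w then a else 0) = Poly_Mapping.single t a"
    unfolding single_eq_Const_mult[of t a] w(2) using w' by (simp add: finite_words)
  ultimately have "f + Poly_Mapping.single t a = word_poly ?N (\<lambda>x. c x + (if x = w then a else 0))"
    by (simp add: c(2) word_poly_def rhom.add[OF Const_rhom] distrib_right sum.distrib)
  moreover have "c x + (if x = w then a else 0) = 0" if "x \<notin> words ?N" for x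
    using that c(1)[of x] words_mono[of N ?N] w' by auto
  ultimately show ?case
    by (intro exI[of _ ?N] exI[of _ "\<lambda>x. c x + (if x = w then a else 0)"] conjI allI impI)
qed

definition kernel_right :: "nat \<Rightarrow> 'n \<times> 'n \<Rightarrow> (nat \<Rightarrow> 'n) \<times> (nat \<Rightarrow> 'n) \<Rightarrow> (nat \<Rightarrow> 'n) \<times> (nat \<Rightarrow> 'n) \<Rightarrow> int" where
  "kernel_right d s x y = kernel_left d (prod.swap s) (prod.swap x) (prod.swap y)"

lemma int_op_kernel_right:
  fixes c :: "(nat \<Rightarrow> 'n::finite) \<times> (nat \<Rightarrow> 'n) \<Rightarrow> 'c::comm_ring_1"
  assumes "x \<in> positions d"
  shows "int_op (positions d) (kernel_right d s) c x = act_right d s c x"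
proof -
  obtain p q i j where dec: "x = (p, q)" "s = (i, j)"
    by (cases x, cases s)
  have swap: "prod.swap y \<in> positions d \<longleftrightarrow> y \<in> positions d" for y :: "(nat \<Rightarrow> 'n) \<times> (nat \<Rightarrow> 'n)"
    by (cases y) (auto simp: positions_def)
  have swap': "(b, a) \<in> positions d \<longleftrightarrow> (a, b) \<in> positions d" for a b :: "nat \<Rightarrow> 'n"
    by (auto simp: positions_def)
  have "int_op (positions d) (kernel_right d s) c x =
      int_op (positions d) (kernel_left d (prod.swap s)) (c \<circ> prod.swap) (prod.swap x)"
    unfolding int_op_def kernel_right_def
    by (auto simp: swap swap' intro!: sum.reindex_bij_witness[of _ prod.swap prod.swap])
  also have "\<dots> = act_left d (prod.swap s) (c \<circ> prod.swap) (prod.swap x)"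
    by (rule int_op_kernel_left) (simp add: swap assms)
  also have "\<dots> = act_right d s c x"
    by (simp add: dec act_left_def act_right_def)
  finally show ?thesis .
qed

lemma kernel_right_transpose: "kernel_right d (i, j) x y = kernel_right d (j, i) y x"
  by (simp add: kernel_right_def kernel_left_transpose[of d j i])

text \<open>Block diagonal in degree and labels. Transposition exchanges the matrix units (i, j) and
  (j, i), which makes the family closed under transposition.\<close>

definition word_kernel :: "'n \<times> 'n \<Rightarrow> ('n, 'm) word \<Rightarrow> ('n, 'm) word \<Rightarrow> int" where
  "word_kernel s = (\<lambda>(d, ks, x) (d', ks', y). if d' = d \<and> ks' = ks then kernel_right d s x y - kernel_left d s x y else 0)"

lemma word_kernel_transpose: "word_kernel (i, j) w w' = word_kernel (j, i) w' w"
  by (auto simp: word_kernel_def kernel_left_transpose[of _ i j] kernel_right_transpose[of _ i j] split: prod.splits)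

lemma int_op_word_kernel:
  fixes c :: "('n::finite, 'm::finite) word \<Rightarrow> 'c::comm_ring_1"
  assumes "(d, ks, x) \<in> words N"
  shows "int_op (words N) (word_kernel s) c (d, ks, x) =
    act_right d s (\<lambda>y. c (d, ks, y)) x - act_left d s (\<lambda>y. c (d, ks, y)) x"
proof -
  have mem: "x \<in> positions d" "ks \<in> index_maps d" "d \<le> N"
    using assms by (auto simp: words_def)
  have "int_op (words N) (word_kernel s) c (d, ks, x) = (\<Sum>w\<in>words N. of_int (word_kernel s (d, ks, x) w) * c w)"
    using assms by (simp add: int_op_def)
  also have "\<dots> = (\<Sum>w\<in>(\<lambda>y. (d, ks, y)) ` positions d. of_int (word_kernel s (d, ks, x) w) * c w)"
    by (rule sum.mono_neutral_right[OF finite_words]) (use mem in \<open>auto simp: words_def word_kernel_def\<close>)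
  also have "\<dots> = (\<Sum>y\<in>positions d. of_int (kernel_right d s x y - kernel_left d s x y) * c (d, ks, y))"
    by (subst sum.reindex) (auto simp: inj_on_def word_kernel_def)
  also have "\<dots> = int_op (positions d) (kernel_right d s) (\<lambda>y. c (d, ks, y)) x -
      int_op (positions d) (kernel_left d s) (\<lambda>y. c (d, ks, y)) x"
    using mem by (simp add: int_op_def left_diff_distrib sum_subtractf)
  finally show ?thesis
    by (simp add: int_op_kernel_right int_op_kernel_left mem)
qed

lemma bracket_matrix_unit:
  "bracket (matrix_unit i j) k $ a $ b =
    (of_bool (b = j) * Var (k, a, i) - of_bool (a = i) * Var (k, j, b) :: ('n::finite, 'm::finite, 'k::comm_ring_1) gen_poly)"
proof -
  have "(\<Sum>r\<in>UNIV. Var (k, a, r) * Const (if r = i \<and> b = j then 1 else 0)) =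
      (\<Sum>r\<in>UNIV. if r = i then of_bool (b = j) * Var (k, a, i) else (0 :: ('n, 'm, 'k) gen_poly))"
    by (rule sum.cong) auto
  moreover have "(\<Sum>r\<in>UNIV. Const (if a = i \<and> r = j then 1 else 0) * Var (k, r, b)) =
      (\<Sum>r\<in>UNIV. if r = j then of_bool (a = i) * Var (k, j, b) else (0 :: ('n, 'm, 'k) gen_poly))"
    by (rule sum.cong) auto
  ultimately show ?thesis
    by (simp add: bracket_def matrix_matrix_mult_def generic_matrix_def matrix_unit_def)
qed

text \<open>The indices are reversed because monomials are basis vectors: they transform by the
  transpose of the matrix that acts on the coefficients in
  \<open>derivation_word_poly\<close>.\<close>

lemma derivation_word_monomial:
  fixes w :: "('n::finite, 'm::finite) word"
  assumes "w \<in> words N"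
  shows "derivation (matrix_unit i j) (word_monomial w :: ('n, 'm, 'k::comm_ring_1) gen_poly) =
    int_op (words N) (word_kernel (j, i)) word_monomial w"
proof -
  obtain d ks p q where w: "w = (d, ks, p, q)"
    by (cases w)
  define V where "V l = (Var (ks l, p l, q l) :: ('n, 'm, 'k) gen_poly)" for l
  have right: "word_monomial (d, ks, p, q(l := i)) = Var (ks l, p l, i) * (\<Prod>j\<in>{..<d} - {l}. V j)"
    and left: "word_monomial (d, ks, p(l := j), q) = Var (ks l, j, q l) * (\<Prod>j\<in>{..<d} - {l}. V j)"
    if "l < d" for l
    using that by (simp_all add: word_monomial_def V_def prod.remove[of "{..<d}" l])
  have "derivation (matrix_unit i j) (word_monomial w :: ('n, 'm, 'k) gen_poly) =
      (\<Sum>l<d. (of_bool (q l = j) * Var (ks l, p l, i) - of_bool (p l = i) * Var (ks l, j, q l)) * (\<Prod>j\<in>{..<d} - {l}. V j))"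
    by (simp add: w word_monomial_def derivation_prod derivation_Var bracket_matrix_unit V_def)
  also have "\<dots> = (\<Sum>l<d. of_bool (q l = j) * word_monomial (d, ks, p, q(l := i)) -
      of_bool (p l = i) * word_monomial (d, ks, p(l := j), q))"
    by (rule sum.cong) (auto simp: right left left_diff_distrib mult.assoc)
  also have "\<dots> = int_op (words N) (word_kernel (j, i)) word_monomial w"
    using assms by (simp add: w int_op_word_kernel act_right_def act_left_def sum_subtractf)
  finally show ?thesis .
qed

lemma derivation_word_poly:
  fixes c :: "('n::finite, 'm::finite) word \<Rightarrow> 'k::comm_ring_1"
  shows "derivation (matrix_unit i j) (word_poly N c) = word_poly N (int_op (words N) (word_kernel (i, j)) c)"
proof -
  have "derivation (matrix_unit i j) (word_poly N c) =
      (\<Sum>w\<in>words N. Const (c w) * int_op (words N) (word_kernel (j, i)) word_monomial w)"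
    by (simp add: word_poly_def derivation_sum derivation_mult derivation_word_monomial)
  also have "\<dots> = (\<Sum>w\<in>words N. \<Sum>w'\<in>words N. Const (c w) * (of_int (word_kernel (j, i) w w') * word_monomial w'))"
    by (simp add: int_op_def sum_distrib_left)
  also have "\<dots> = (\<Sum>w'\<in>words N. \<Sum>w\<in>words N. Const (of_int (word_kernel (i, j) w' w) * c w) * word_monomial w')"
    by (subst sum.swap)
      (simp add: word_kernel_transpose[of j i] rhom.mult[OF Const_rhom] rhom.of_int[OF Const_rhom] mult_ac)
  also have "\<dots> = word_poly N (int_op (words N) (word_kernel (i, j)) c)"
    by (simp add: word_poly_def int_op_def rhom.sum[OF Const_rhom] sum_distrib_right)
  finally show ?thesis .
qed

text \<open>\<open>lift_invariant\<close> is applied with \<open>L\<close> the space of coefficient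
  vectors of elements of the ideal. The correction \<open>e\<close> lies in \<open>L\<close>, so it
  changes the representative of \<open>f\<close> but not its class.\<close>

lemma invariant_modulo_comm_ideal:
  fixes f :: "('n::finite, 'm::finite, 'k::field_char_0) gen_poly"
  assumes inv: "\<And>g. g \<in> GL \<Longrightarrow> GL_act g f - f \<in> comm_ideal"
  obtains N c where "f - word_poly N c \<in> comm_ideal"
    "\<And>d ks. d \<le> N \<Longrightarrow> ks \<in> index_maps d \<Longrightarrow> invariant_tensor d (\<lambda>x. c (d, ks, x))"
proof -
  obtain N c where c: "\<And>w. w \<notin> words N \<Longrightarrow> c w = 0" "f = word_poly N c"
    using word_poly_surj by metis
  define L :: "(('n, 'm) word \<Rightarrow> 'k) set" where "L = {c. (\<forall>w. w \<notin> words N \<longrightarrow> c w = 0) \<and> word_poly N c \<in> comm_ideal}"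
  have poly_0: "word_poly N (\<lambda>_. 0 :: 'k) = (0 :: ('n, 'm, 'k) gen_poly)"
    by (simp add: word_poly_def)
  have poly_add: "word_poly N (\<lambda>w. c w + c' w) = word_poly N c + word_poly N c'" for c c' :: "('n, 'm) word \<Rightarrow> 'k"
    by (simp add: word_poly_def rhom.add[OF Const_rhom] distrib_right sum.distrib)
  have poly_scale: "word_poly N (\<lambda>w. a * c w) = Const a * word_poly N c" for a and c :: "('n, 'm) word \<Rightarrow> 'k"
    by (simp add: word_poly_def rhom.mult[OF Const_rhom] sum_distrib_left mult.assoc)
  have L_kernel: "int_op (words N) (word_kernel s) c \<in> L" if "derivation (matrix_unit (fst s) (snd s)) (word_poly N c) \<in> comm_ideal"
    for s and c :: "('n, 'm) word \<Rightarrow> 'k"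
    using that by (simp add: L_def derivation_word_poly int_op_def)
  have "\<exists>e\<in>L. \<forall>s x. int_op (words N) (word_kernel s) (\<lambda>x. c x - e x) x = 0"
  proof (rule lift_invariant[where W = "words N" and S = UNIV and T = word_kernel and tr = prod.swap and L = L and c = c])
    show "word_kernel (prod.swap s) x y = word_kernel s y x" for s :: "'n \<times> 'n" and x y :: "('n, 'm) word"
      using word_kernel_transpose[of "snd s" "fst s" x y] by (cases s) simp
    show "int_op (words N) (word_kernel s) c \<in> L" for s
      by (rule L_kernel) (use derivation_matrix_unit[OF inv] in \<open>simp add: c(2)\<close>)
    show "int_op (words N) (word_kernel s) e \<in> L" if "e \<in> L" for e s
      by (rule L_kernel) (rule derivation_comm_ideal, use that in \<open>simp add: L_def\<close>)
    show "(\<lambda>_. 0) \<in> L"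
      by (simp add: L_def poly_0 comm.zero_mem)
    show "(\<lambda>x. d x + e x) \<in> L" if "d \<in> L" "e \<in> L" for d e
      using that by (simp add: L_def poly_add comm.add_mem)
    show "(\<lambda>x. a * e x) \<in> L" if "e \<in> L" for a e
      using that by (simp add: L_def poly_scale comm.mult_mem)
  qed (auto simp: finite_words L_def)
  then obtain e where e: "e \<in> L" "\<And>s x. int_op (words N) (word_kernel s) (\<lambda>x. c x - e x) x = 0"
    by blast
  show ?thesis
  proof (rule that[of N "\<lambda>w. c w - e w"])
    have "word_poly N (\<lambda>w. c w - e w) = word_poly N c - word_poly N e"
      by (simp add: word_poly_def rhom.diff[OF Const_rhom] left_diff_distrib sum_subtractf)
    then show "f - word_poly N (\<lambda>w. c w - e w) \<in> comm_ideal"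
      using e(1) by (simp add: c(2) L_def)
    fix d and ks :: "nat \<Rightarrow> 'm" assume d: "d \<le> N" "ks \<in> index_maps d"
    show "invariant_tensor d (\<lambda>x. c (d, ks, x) - e (d, ks, x))"
      unfolding invariant_tensor_def
    proof (intro allI ballI)
      fix s and x :: "(nat \<Rightarrow> 'n) \<times> (nat \<Rightarrow> 'n)"
      assume "x \<in> positions d"
      then have "(d, ks, x) \<in> words N"
        using d by (simp add: words_def)
      from int_op_word_kernel[OF this, of s "\<lambda>x. c x - e x"] e(2)[of s "(d, ks, x)"]
      show "act_right d s (\<lambda>x. c (d, ks, x) - e (d, ks, x)) x = act_left d s (\<lambda>x. c (d, ks, x) - e (d, ks, x)) x"
        by simp
    qed
  qed
qed

section \<open>Products of traces\<close>

text \<open>The product of traces, one for each cycle of \<tau>, of the matrices multiplied along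
  the cycle, written as one expanded sum over all indices.\<close>

definition cycle_sum :: "nat \<Rightarrow> (nat \<Rightarrow> nat) \<Rightarrow> (nat \<Rightarrow> 'a::comm_ring_1^'n::finite^'n) \<Rightarrow> 'a" where
  "cycle_sum d \<tau> B = (\<Sum>p\<in>index_maps d. \<Prod>l<d. B l $ p l $ p (\<tau> l))"

text \<open>The condition \<open>p l = q (\<pi> l)\<close> for all l leaves only
  \<open>q = p \<circ> inv \<pi>\<close> in the inner sum; this is where the inverse comes
  from.\<close>

lemma sum_pairing:
  fixes B :: "nat \<Rightarrow> 'a::comm_ring_1^'n::finite^'n"
  assumes \<pi>: "\<pi> permutes {..<d}"
  shows "(\<Sum>(p, q)\<in>positions d. pairing d \<pi> (p, q) * (\<Prod>l<d. B l $ p l $ q l)) = cycle_sum d (inv \<pi>) B"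
proof -
  have "(\<Sum>q\<in>index_maps d. pairing d \<pi> (p, q) * (\<Prod>l<d. B l $ p l $ q l)) = (\<Prod>l<d. B l $ p l $ p (inv \<pi> l))"
    if p: "p \<in> index_maps d" for p
  proof -
    have iff: "(\<forall>l<d. p l = q (\<pi> l)) \<longleftrightarrow> q = p \<circ> inv \<pi>" if q: "q \<in> index_maps d" for q
    proof
      assume *: "\<forall>l<d. p l = q (\<pi> l)"
      show "q = p \<circ> inv \<pi>"
      proof
        fix l
        show "q l = (p \<circ> inv \<pi>) l"
        proof (cases "l < d")
          case True
          then have "inv \<pi> l < d"
            using permutes_in_image[OF permutes_inv[OF \<pi>], of l] by simp
          then show ?thesis
            using * permutes_inverses(1)[OF \<pi>, of l] by simp
        next
          case False
          then have "inv \<pi> l = l"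
            using permutes_not_in[OF permutes_inv[OF \<pi>], of l] by simp
          then show ?thesis
            using False p q by (simp add: index_maps_def PiE_iff extensional_def)
        qed
      qed
    qed (simp add: permutes_inverses[OF \<pi>])
    have "(\<Sum>q\<in>index_maps d. pairing d \<pi> (p, q) * (\<Prod>l<d. B l $ p l $ q l)) =
        (\<Sum>q\<in>index_maps d. if q = p \<circ> inv \<pi> then (\<Prod>l<d. B l $ p l $ p (inv \<pi> l)) else 0)"
      by (rule sum.cong) (auto simp: pairing_def iff)
    moreover have "p \<circ> inv \<pi> \<in> index_maps d"
      using p permutes_inv[OF \<pi>] by (rule index_maps_compose)
    ultimately show ?thesis
      by (simp add: finite_index_maps)
  qed
  then show ?thesis
    unfolding positions_def cycle_sum_def by (subst sum.cartesian_product[symmetric]) simp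
qed

lemma sum_index_maps_Suc:
  "(\<Sum>p\<in>index_maps (Suc d). h p) = (\<Sum>p\<in>index_maps d. \<Sum>r\<in>UNIV. h (p(d := r :: 'n::finite)))"
proof -
  have drop: "p(d := undefined) \<in> index_maps d" if "p \<in> index_maps (Suc d)" for p :: "nat \<Rightarrow> 'n"
    using that by (auto simp: index_maps_def PiE_iff extensional_def)
  have out: "p(d := undefined) = p" if "p \<in> index_maps d" for p :: "nat \<Rightarrow> 'n"
    using that by (auto simp: index_maps_def PiE_iff extensional_def fun_eq_iff)
  have "(\<Sum>p\<in>index_maps (Suc d). h p) = (\<Sum>x\<in>index_maps d \<times> UNIV. h ((fst x)(d := snd x)))"
  proof (rule sum.reindex_bij_witness[of _ "\<lambda>x. (fst x)(d := snd x)" "\<lambda>p. (p(d := undefined), p d)"])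
    fix x :: "(nat \<Rightarrow> 'n) \<times> 'n"
    assume "x \<in> index_maps d \<times> UNIV"
    then have "fst x \<in> index_maps d"
      by (simp add: mem_Times_iff)
    then show "(fst x)(d := snd x) \<in> index_maps (Suc d)"
      and "(((fst x)(d := snd x))(d := undefined), ((fst x)(d := snd x)) d) = x"
      by (simp_all add: index_maps_update_Suc out)
  qed (simp_all add: drop)
  then show ?thesis
    by (simp add: sum.cartesian_product case_prod_unfold)
qed

text \<open>
  The last position is eliminated: either it is a fixed point of \<open>\<tau>\<close> and contributes a trace, or
  its matrix is multiplied to the matrix of its predecessor.
\<close>
lemma cycle_sum_induct:
  fixes B :: "nat \<Rightarrow> 'a::comm_ring_1^'n::finite^'n"
  assumes "1 \<in> Z" and trace: "\<And>M f. M \<in> Ms \<Longrightarrow> f \<in> Z \<Longrightarrow> trace M * f \<in> Z"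
    and mult: "\<And>M M'. M \<in> Ms \<Longrightarrow> M' \<in> Ms \<Longrightarrow> M ** M' \<in> Ms"
    and "\<And>l. B l \<in> Ms" "\<tau> permutes {..<d}"
  shows "cycle_sum d \<tau> B \<in> Z"
  using assms(4,5)
proof (induction d arbitrary: \<tau> B)
  case 0
  then show ?case
    using \<open>1 \<in> Z\<close> by (simp add: cycle_sum_def index_maps_def)
next
  case (Suc d)
  note \<tau> = \<open>\<tau> permutes {..<Suc d}\<close>
  have lt: "\<tau> l \<le> d" if "l \<le> d" for l
    using permutes_in_image[OF \<tau>, of l] that by simp
  show ?case
  proof (cases "\<tau> d = d")
    case True
    then have \<tau>': "\<tau> permutes {..<d}"
      by (intro permutes_superset[OF \<tau>]) (auto simp: less_Suc_eq)
    have ne: "\<tau> l \<noteq> d" if "l < d" for l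
      using permutes_in_image[OF \<tau>', of l] that by simp
    have "cycle_sum (Suc d) \<tau> B =
        (\<Sum>p\<in>index_maps d. \<Sum>r\<in>UNIV. (\<Prod>l<d. B l $ p l $ p (\<tau> l)) * B d $ r $ r)"
      unfolding cycle_sum_def sum_index_maps_Suc
      by (intro sum.cong refl) (use ne in \<open>simp add: True\<close>)
    also have "\<dots> = trace (B d) * cycle_sum d \<tau> B"
      by (simp add: cycle_sum_def trace_def sum_distrib_left sum_distrib_right mult.commute)
    finally show ?thesis
      using trace Suc.IH[OF Suc.prems(1) \<tau>'] Suc.prems(1) by simp
  next
    case False
    define a b where "a = \<tau> d" and "b = inv \<tau> d"
    have ab: "a < d" "b < d" "\<tau> b = d"
    proof -
      show "a < d"
        using lt[of d] False by (simp add: a_def)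
      show "\<tau> b = d"
        by (simp add: b_def permutes_inverses[OF \<tau>])
      have "b \<le> d"
        using permutes_in_image[OF permutes_inv[OF \<tau>], of d] by (simp add: b_def)
      moreover have "b \<noteq> d"
        using False \<open>\<tau> b = d\<close> by auto
      ultimately show "b < d"
        by simp
    qed
    have inj: "\<tau> l = \<tau> l' \<longleftrightarrow> l = l'" for l l'
      using permutes_inj[OF \<tau>] by (auto dest: injD)
    \<comment> \<open>The part b, d, a of the cycle is shortened to b, a: the new permutation skips
      \<open>d\<close>, and \<open>B b\<close> absorbs \<open>B d\<close>.\<close>
    define \<tau>' where "\<tau>' = Transposition.transpose d a \<circ> \<tau>"
    define B' where "B' = B(b := B b ** B d)"
    have "\<tau>' permutes {..<Suc d}"
      unfolding \<tau>'_def using \<tau> ab by (intro permutes_compose transpose_permutes) auto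
    then have \<tau>': "\<tau>' permutes {..<d}"
      by (rule permutes_superset) (auto simp: less_Suc_eq \<tau>'_def a_def)
    have vals: "\<tau>' b = a" "\<And>l. l < d \<Longrightarrow> l \<noteq> b \<Longrightarrow> \<tau>' l = \<tau> l" "\<And>l. l < d \<Longrightarrow> l \<noteq> b \<Longrightarrow> \<tau> l \<noteq> d"
    proof -
      show "\<tau>' b = a"
        by (simp add: \<tau>'_def ab)
      fix l assume l: "l < d" "l \<noteq> b"
      show "\<tau> l \<noteq> d"
        using l ab inj[of l b] by simp
      moreover have "\<tau> l \<noteq> a"
        using l inj[of l d] by (simp add: a_def)
      ultimately show "\<tau>' l = \<tau> l"
        by (simp add: \<tau>'_def)
    qed
    have "cycle_sum (Suc d) \<tau> B =
        (\<Sum>p\<in>index_maps d. \<Sum>r\<in>UNIV. B b $ p b $ r * B d $ r $ p a * (\<Prod>l\<in>{..<d} - {b}. B l $ p l $ p (\<tau> l)))"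
      unfolding cycle_sum_def sum_index_maps_Suc
    proof (intro sum.cong refl)
      fix p :: "nat \<Rightarrow> 'n" and r
      have "(\<Prod>l\<in>{..<d} - {b}. B l $ (p(d := r)) l $ (p(d := r)) (\<tau> l)) = (\<Prod>l\<in>{..<d} - {b}. B l $ p l $ p (\<tau> l))"
        by (rule prod.cong) (use vals(3) in auto)
      moreover have "(\<Prod>l<d. B l $ (p(d := r)) l $ (p(d := r)) (\<tau> l)) =
          B b $ p b $ r * (\<Prod>l\<in>{..<d} - {b}. B l $ (p(d := r)) l $ (p(d := r)) (\<tau> l))"
        using ab by (subst prod.remove[of _ b]) auto
      moreover have "(p(d := r)) (\<tau> d) = p a"
        using ab(1) by (simp add: a_def)
      ultimately show "(\<Prod>l<Suc d. B l $ (p(d := r)) l $ (p(d := r)) (\<tau> l)) =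
          B b $ p b $ r * B d $ r $ p a * (\<Prod>l\<in>{..<d} - {b}. B l $ p l $ p (\<tau> l))"
        by (simp add: mult_ac)
    qed
    also have "\<dots> = (\<Sum>p\<in>index_maps d. (B b ** B d) $ p b $ p a * (\<Prod>l\<in>{..<d} - {b}. B l $ p l $ p (\<tau> l)))"
      by (simp add: matrix_matrix_mult_def sum_distrib_right)
    also have "\<dots> = cycle_sum d \<tau>' B'"
      unfolding cycle_sum_def
    proof (intro sum.cong refl)
      fix p :: "nat \<Rightarrow> 'n"
      have "(\<Prod>l<d. B' l $ p l $ p (\<tau>' l)) = B' b $ p b $ p (\<tau>' b) * (\<Prod>l\<in>{..<d} - {b}. B' l $ p l $ p (\<tau>' l))"
        using ab by (subst prod.remove[of _ b]) auto
      also have "(\<Prod>l\<in>{..<d} - {b}. B' l $ p l $ p (\<tau>' l)) = (\<Prod>l\<in>{..<d} - {b}. B l $ p l $ p (\<tau> l))"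
        by (rule prod.cong) (use vals(2) in \<open>auto simp: B'_def\<close>)
      finally show "(B b ** B d) $ p b $ p a * (\<Prod>l\<in>{..<d} - {b}. B l $ p l $ p (\<tau> l)) = (\<Prod>l<d. B' l $ p l $ p (\<tau>' l))"
        by (simp add: vals(1) B'_def)
    qed
    also have "cycle_sum d \<tau>' B' \<in> Z"
      by (rule Suc.IH[OF _ \<tau>']) (use Suc.prems(1) mult in \<open>simp add: B'_def\<close>)
    finally show ?thesis .
  qed
qed

section \<open>Lifting multisymmetric functions modulo commutators\<close>

text \<open>In contrast to \<open>orbit_det\<close>, all permutations are summed, so each
  rearrangement is counted with the order of the stabiliser of \<open>a\<close>. Formulas that
  change \<open>a\<close> then hold without case distinctions on coinciding exponents; the price is
  the factor n!, which is harmless in characteristic zero.\<close>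

definition polarised_det :: "('n \<Rightarrow> 'm \<Rightarrow> nat) \<Rightarrow> ('n::finite, 'm::finite, 'k::comm_ring_1) gen_poly" where
  "polarised_det a = (\<Sum>\<sigma> | \<sigma> permutes UNIV. det (\<chi> i. monomial generic_matrix (a (\<sigma> i)) $ i))"

text \<open>
  Linear, but not multiplicative. Modulo \<open>comm_ideal\<close> it is \<open>n!\<close> times a left inverse of \<open>Delta\<close>
  on products of traces.
\<close>
definition polarise :: "('n::finite, 'm::finite, 'k::comm_ring_1) diag_poly \<Rightarrow> ('n, 'm, 'k) gen_poly" where
  "polarise = lift Const (\<lambda>t. polarised_det (\<lambda>i k. Poly_Mapping.lookup t (i, k)))"

lemma polarise_add: "polarise (p + q) = polarise p + polarise q"
  unfolding polarise_def by (rule lift_add) (rule rhom.add[OF Const_rhom])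

lemma polarise_sum: "polarise (\<Sum>i\<in>S. f i) = (\<Sum>i\<in>S. polarise (f i))"
  unfolding polarise_def by (rule lift_sum) (rule rhom.add[OF Const_rhom])

lemma polarise_0 [simp]: "polarise 0 = 0"
  by (simp add: polarise_def lift_0)

lemma polarise_diag_monomial: "polarise (Const c * diag_monomial a) = Const c * polarised_det a"
proof -
  have "Const c * diag_monomial a = Poly_Mapping.single (exponent a) c"
    by (simp add: diag_monomial_eq_single single_eq_Const_mult[of "exponent a" c])
  then show ?thesis
    by (simp add: polarise_def lift_single)
qed

lemma polarise_Const_mult:
  fixes p :: "('n::finite, 'm::finite, 'k::comm_ring_1) diag_poly"
  shows "polarise (Const c * p) = Const c * polarise p"
proof (induction p rule: diag_poly_induct)
  case (add p b a)
  have "polarise (Const c * (Const b * diag_monomial a)) = Const c * (Const b * polarised_det a)"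
    using polarise_diag_monomial[of "c * b" a] by (simp add: rhom.mult[OF Const_rhom] mult.assoc)
  then show ?case
    using add by (simp add: distrib_left polarise_add polarise_diag_monomial)
qed simp

lemma diag_monomial_mult: "diag_monomial a * diag_monomial b = diag_monomial (\<lambda>i k. a i k + b i k)"
  by (simp add: diag_monomial_def power_add prod.distrib)

lemma monomial_zero: "monomial U (\<lambda>_. 0) = mat 1"
proof -
  have "list_monomial U (\<lambda>_. 0) ks = mat 1" for ks
    by (induction ks) simp_all
  then show ?thesis
    by (simp add: monomial_def)
qed

lemma monomial_unit: "monomial U (\<lambda>h. of_bool (h = k)) = U k"
proof -
  have "list_monomial U (\<lambda>h. of_bool (h = k)) ks = (if k \<in> set ks then U k else mat 1)" if "distinct ks" for ks
    using that by (induction ks) auto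
  then show ?thesis
    by (simp add: monomial_def enumeration)
qed

lemma polarise_1:
  "polarise 1 = (of_nat (fact CARD('n)) :: ('n::finite, 'm::finite, 'k::comm_ring_1) gen_poly)"
proof -
  have "polarise (Const 1 * diag_monomial (\<lambda>_ _. 0)) = (Const 1 * polarised_det (\<lambda>_ _. 0) :: ('n, 'm, 'k) gen_poly)"
    by (rule polarise_diag_monomial)
  moreover have "diag_monomial (\<lambda>_ _. 0) = (1 :: ('n, 'm, 'k) diag_poly)"
    by (simp add: diag_monomial_def)
  ultimately have "polarise 1 = (polarised_det (\<lambda>_ _. 0) :: ('n, 'm, 'k) gen_poly)"
    by simp
  also have "\<dots> = (\<Sum>\<sigma> | \<sigma> permutes (UNIV :: 'n set). 1)"
    by (simp add: polarised_det_def monomial_zero)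
  finally show ?thesis
    by (simp add: card_permutations)
qed

lemma Delta_trace_monomial:
  "Delta (trace (monomial generic_matrix e) :: ('n::finite, 'm::finite, 'k::comm_ring_1) gen_poly) = (\<Sum>j\<in>UNIV. diag_monomial (\<lambda>i. if i = j then e else (\<lambda>_. 0)))"
proof -
  have "Delta (trace (monomial generic_matrix e) :: ('n, 'm, 'k) gen_poly) = trace (map_matrix Delta (monomial generic_matrix e))"
    by (simp add: trace_def rhom.sum[OF Delta_rhom])
  also have "\<dots> = (\<Sum>j\<in>UNIV. \<Prod>k\<in>UNIV. Var (j, k) ^ e k)"
    by (simp add: map_matrix_monomial[OF Delta_rhom] Delta_generic monomial_diag)
      (simp add: trace_def diag_mat_def)
  also have "\<dots> = (\<Sum>j\<in>UNIV. diag_monomial (\<lambda>i. if i = j then e else (\<lambda>_. 0)))"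
  proof (rule sum.cong[OF refl])
    fix j :: 'n
    have "diag_monomial (\<lambda>i. if i = j then e else (\<lambda>_. 0)) =
        (\<Prod>i\<in>UNIV. if i = j then \<Prod>k\<in>UNIV. Var (j, k) ^ e k else (1 :: ('n, 'm, 'k) diag_poly))"
      unfolding diag_monomial_def by (rule prod.cong) auto
    then show "(\<Prod>k\<in>UNIV. Var (j, k) ^ e k) = (diag_monomial (\<lambda>i. if i = j then e else (\<lambda>_. 0)) :: ('n, 'm, 'k) diag_poly)"
      by simp
  qed
  finally show ?thesis .
qed

lemma (in type_ideal) mat_cong_trace: "mat_cong M N \<Longrightarrow> trace M - trace N \<in> J"
  by (auto simp: trace_def mat_cong_def intro!: diff_sum)

text \<open>Modulo commutators, raising one exponent by \<open>e\<close> multiplies one matrix by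
  the monomial \<open>M e\<close>. Expanding the affected row r gives the entry of
  \<open>M e\<close> at (r, s) times a determinant with row r replaced by row s. Summed over all
  permutations these vanish unless s = r, and the diagonal entries add up to the trace.\<close>

lemma polarised_det_shift:
  fixes a :: "'n::finite \<Rightarrow> 'm::finite \<Rightarrow> nat"
  shows "(\<Sum>j\<in>UNIV. polarised_det (\<lambda>i. if i = j then (\<lambda>k. e k + a i k) else a i)) -
    trace (monomial generic_matrix e) * polarised_det a \<in> (comm_ideal :: ('n, 'm, 'k::comm_ring_1) gen_poly set)"
proof -
  define M where "M = (monomial generic_matrix :: _ \<Rightarrow> ('n, 'm, 'k) gen_poly^'n^'n)"
  define S where "S = {\<sigma> :: 'n \<Rightarrow> 'n. \<sigma> permutes UNIV}"
  have S: "finite S" "\<And>b \<sigma>. b \<in> S \<Longrightarrow> \<sigma> permutes UNIV \<Longrightarrow> b \<circ> \<sigma> \<in> S"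
    by (auto simp: S_def finite_permutations permutes_compose)
  have "(\<Sum>j\<in>UNIV. polarised_det (\<lambda>i. if i = j then (\<lambda>k. e k + a i k) else a i)) =
      (\<Sum>\<sigma>\<in>S. \<Sum>j\<in>UNIV. det (\<chi> i. M (if \<sigma> i = j then (\<lambda>k. e k + a (\<sigma> i) k) else a (\<sigma> i)) $ i))"
    unfolding polarised_det_def M_def[symmetric] S_def[symmetric] by (rule sum.swap)
  also have "\<dots> = (\<Sum>\<sigma>\<in>S. \<Sum>r\<in>UNIV. det (\<chi> i. if i = r then M (\<lambda>k. e k + a (\<sigma> i) k) $ i else M (a (\<sigma> i)) $ i))"
  proof (rule sum.cong[OF refl])
    fix \<sigma> assume "\<sigma> \<in> S"
    then have \<sigma>: "\<sigma> permutes UNIV"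
      by (simp add: S_def)
    define g where "g r = det (\<chi> i. if i = r then M (\<lambda>k. e k + a (\<sigma> i) k) $ i else M (a (\<sigma> i)) $ i)" for r
    have "det (\<chi> i. M (if \<sigma> i = j then (\<lambda>k. e k + a (\<sigma> i) k) else a (\<sigma> i)) $ i) = g (inv \<sigma> j)" for j
    proof -
      have "\<sigma> i = j \<longleftrightarrow> i = inv \<sigma> j" for i
        using permutes_inverses[OF \<sigma>] by auto
      then have "(\<chi> i. M (if \<sigma> i = j then (\<lambda>k. e k + a (\<sigma> i) k) else a (\<sigma> i)) $ i) =
          (\<chi> i. if i = inv \<sigma> j then M (\<lambda>k. e k + a (\<sigma> i) k) $ i else M (a (\<sigma> i)) $ i)"
        by (auto simp: vec_eq_iff)
      then show ?thesis
        by (simp only: g_def)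
    qed
    moreover have "(\<Sum>j\<in>UNIV. g (inv \<sigma> j)) = (\<Sum>r\<in>UNIV. g r)"
      by (rule sum.reindex_bij_witness[of _ \<sigma> "inv \<sigma>"]) (simp_all add: permutes_inverses[OF \<sigma>])
    ultimately show "(\<Sum>j\<in>UNIV. det (\<chi> i. M (if \<sigma> i = j then (\<lambda>k. e k + a (\<sigma> i) k) else a (\<sigma> i)) $ i)) =
        (\<Sum>r\<in>UNIV. det (\<chi> i. if i = r then M (\<lambda>k. e k + a (\<sigma> i) k) $ i else M (a (\<sigma> i)) $ i))"
      by (simp only: g_def)
  qed
  finally have 1: "(\<Sum>j\<in>UNIV. polarised_det (\<lambda>i. if i = j then (\<lambda>k. e k + a i k) else a i)) =
      (\<Sum>\<sigma>\<in>S. \<Sum>r\<in>UNIV. det (\<chi> i. if i = r then M (\<lambda>k. e k + a (\<sigma> i) k) $ i else M (a (\<sigma> i)) $ i))" .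
  have cong: "comm.mat_cong (M (\<lambda>k. e k + b k)) (M e ** M b)" for b
    unfolding M_def by (rule comm.mat_cong_sym[OF comm.monomial_mult[OF commute_mod_generic]])
  have 2: "(\<Sum>\<sigma>\<in>S. \<Sum>r\<in>UNIV. det (\<chi> i. if i = r then M (\<lambda>k. e k + a (\<sigma> i) k) $ i else M (a (\<sigma> i)) $ i)) -
      (\<Sum>\<sigma>\<in>S. \<Sum>r\<in>UNIV. det (\<chi> i. if i = r then (M e ** M (a (\<sigma> i))) $ i else M (a (\<sigma> i)) $ i)) \<in> comm_ideal"
    by (intro comm.diff_sum comm.diff_det) (use cong in \<open>simp add: comm.mat_cong_def comm.zero_mem\<close>)
  have "(\<Sum>\<sigma>\<in>S. \<Sum>r\<in>UNIV. det (\<chi> i. if i = r then (M e ** M (a (\<sigma> i))) $ i else M (a (\<sigma> i)) $ i)) =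
      (\<Sum>\<sigma>\<in>S. \<Sum>r\<in>UNIV. \<Sum>s\<in>UNIV. M e $ r $ s * det (\<chi> i. M (a (\<sigma> i)) $ (if i = r then s else i)))"
  proof (intro sum.cong refl)
    fix \<sigma> and r :: 'n
    have "(M e ** M (a (\<sigma> r))) $ r = (\<Sum>s\<in>UNIV. M e $ r $ s *s M (a (\<sigma> r)) $ s)"
      by (simp add: matrix_mul_sum_alt)
    then have "(\<chi> i. if i = r then (M e ** M (a (\<sigma> i))) $ i else M (a (\<sigma> i)) $ i) =
        (\<chi> i. if i = r then \<Sum>s\<in>UNIV. M e $ r $ s *s M (a (\<sigma> r)) $ s else M (a (\<sigma> i)) $ i)"
      by (simp add: vec_eq_iff)
    then have "det (\<chi> i. if i = r then (M e ** M (a (\<sigma> i))) $ i else M (a (\<sigma> i)) $ i) =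
        (\<Sum>s\<in>UNIV. M e $ r $ s * det (\<chi> i. if i = r then M (a (\<sigma> r)) $ s else M (a (\<sigma> i)) $ i))"
      by (simp only: det_linear_row_sum[OF finite_class.finite_UNIV] det_row_mul)
    also have "\<dots> = (\<Sum>s\<in>UNIV. M e $ r $ s * det (\<chi> i. M (a (\<sigma> i)) $ (if i = r then s else i)))"
    proof (rule sum.cong[OF refl])
      fix s
      have "(\<chi> i. if i = r then M (a (\<sigma> r)) $ s else M (a (\<sigma> i)) $ i) = (\<chi> i. M (a (\<sigma> i)) $ (if i = r then s else i))"
        by (simp add: vec_eq_iff)
      then show "M e $ r $ s * det (\<chi> i. if i = r then M (a (\<sigma> r)) $ s else M (a (\<sigma> i)) $ i) =
          M e $ r $ s * det (\<chi> i. M (a (\<sigma> i)) $ (if i = r then s else i))"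
        by simp
    qed
    finally show "det (\<chi> i. if i = r then (M e ** M (a (\<sigma> i))) $ i else M (a (\<sigma> i)) $ i) =
        (\<Sum>s\<in>UNIV. M e $ r $ s * det (\<chi> i. M (a (\<sigma> i)) $ (if i = r then s else i)))" .
  qed
  also have "\<dots> = (\<Sum>r\<in>UNIV. \<Sum>s\<in>UNIV. M e $ r $ s * (\<Sum>\<sigma>\<in>S. det (\<chi> i. M (a (\<sigma> i)) $ (if i = r then s else i))))"
    by (subst sum.swap, rule sum.cong[OF refl], subst sum.swap) (simp add: sum_distrib_left)
  \<comment> \<open>The row choice that sends r to s and fixes everything else is a permutation only
    if s = r, so \<open>sum_det_rows\<close> removes the entries of \<open>M e\<close> off the
    diagonal.\<close>
  also have "\<dots> = (\<Sum>r\<in>UNIV. \<Sum>s\<in>UNIV. if s = r then M e $ r $ r * polarised_det a else 0)"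
  proof (intro sum.cong refl)
    fix r s :: 'n
    have "(\<lambda>i. if i = r then s else i) permutes UNIV \<longleftrightarrow> s = r"
    proof
      assume "(\<lambda>i. if i = r then s else i) permutes UNIV"
      from permutes_inj[OF this] show "s = r"
        by (auto simp: inj_def split: if_splits)
    next
      assume "s = r"
      then have "(\<lambda>i. if i = r then s else i) = id"
        by auto
      then show "(\<lambda>i. if i = r then s else i) permutes UNIV"
        by (simp only: permutes_id)
    qed
    moreover have "(\<lambda>i. if i = r then r else i) = id"
      by auto
    ultimately show "M e $ r $ s * (\<Sum>\<sigma>\<in>S. det (\<chi> i. M (a (\<sigma> i)) $ (if i = r then s else i))) =
        (if s = r then M e $ r $ r * polarised_det a else 0)"
      using sum_det_rows[OF S, of "\<lambda>i. M (a i)" "\<lambda>i. if i = r then s else i"]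
      by (auto simp: polarised_det_def M_def S_def)
  qed
  also have "\<dots> = trace (M e) * polarised_det a"
    by (simp add: trace_def sum_distrib_right)
  finally show ?thesis
    using 2 by (simp only: 1 M_def)
qed

text \<open>The image of the trace is a power sum. Multiplying a monomial by it adds
  \<open>e\<close> to each row exponent in turn, which is the sum in
  \<open>polarised_det_shift\<close>; linearity does the rest.\<close>

lemma polarise_Delta_trace:
  "polarise (Delta (trace (monomial generic_matrix e)) * p) - trace (monomial generic_matrix e) * polarise p
    \<in> (comm_ideal :: ('n::finite, 'm::finite, 'k::comm_ring_1) gen_poly set)"
proof (induction p rule: diag_poly_induct)
  case 0
  show ?case
    by (simp add: comm.zero_mem)
next
  case (add p c a)
  define T where "T = (trace (monomial generic_matrix e) :: ('n, 'm, 'k) gen_poly)"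
  have "Delta T * (Const c * diag_monomial a) =
      (\<Sum>j\<in>UNIV. Const c * diag_monomial (\<lambda>i. if i = j then (\<lambda>k. e k + a i k) else a i))"
    unfolding T_def Delta_trace_monomial sum_distrib_right
  proof (rule sum.cong[OF refl])
    fix j :: 'n
    have "(\<lambda>i k. (if i = j then e else (\<lambda>_. 0)) k + a i k) = (\<lambda>i. if i = j then (\<lambda>k. e k + a i k) else a i)"
      by auto
    then have "diag_monomial (\<lambda>i. if i = j then e else (\<lambda>_. 0)) * diag_monomial a =
        (diag_monomial (\<lambda>i. if i = j then (\<lambda>k. e k + a i k) else a i) :: ('n, 'm, 'k) diag_poly)"
      by (simp only: diag_monomial_mult)
    then show "diag_monomial (\<lambda>i. if i = j then e else (\<lambda>_. 0)) * (Const c * diag_monomial a) =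
        (Const c * diag_monomial (\<lambda>i. if i = j then (\<lambda>k. e k + a i k) else a i) :: ('n, 'm, 'k) diag_poly)"
      by (simp only: mult.left_commute)
  qed
  then have "polarise (Delta T * (Const c * diag_monomial a)) - T * polarise (Const c * diag_monomial a) =
      Const c * ((\<Sum>j\<in>UNIV. polarised_det (\<lambda>i. if i = j then (\<lambda>k. e k + a i k) else a i)) - T * polarised_det a)"
    by (simp add: polarise_sum polarise_diag_monomial sum_distrib_left right_diff_distrib mult.left_commute)
  moreover have "Const c * ((\<Sum>j\<in>UNIV. polarised_det (\<lambda>i. if i = j then (\<lambda>k. e k + a i k) else a i)) - T * polarised_det a) \<in> comm_ideal"
    unfolding T_def by (rule comm.mult_mem[OF polarised_det_shift])
  ultimately have "polarise (Delta T * (Const c * diag_monomial a)) - T * polarise (Const c * diag_monomial a) \<in> comm_ideal"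
    by simp
  from comm.add_mem[OF add this[unfolded T_def]] show ?case
    by (simp add: distrib_left polarise_add algebra_simps)
qed

text \<open>The polynomials with the claimed congruence contain 1, because \<open>polarise\<close>
  sends 1 to n!, and are stable under multiplication by traces of monomials. \<open>Ms\<close>
  admits matrices that are only congruent to a monomial, since a product of monomials is a monomial
  only modulo commutators.\<close>

lemma cycle_sum_polarise:
  fixes ks :: "nat \<Rightarrow> 'm::finite"
  assumes "\<tau> permutes {..<d}"
  shows "of_nat (fact CARD('n)) * cycle_sum d \<tau> (\<lambda>l. generic_matrix (ks l)) -
    polarise (Delta (cycle_sum d \<tau> (\<lambda>l. generic_matrix (ks l)))) \<in> (comm_ideal :: ('n::finite, 'm, 'k::comm_ring_1) gen_poly set)"
proof -
  define Z where "Z = {f :: ('n, 'm, 'k) gen_poly. of_nat (fact CARD('n)) * f - polarise (Delta f) \<in> comm_ideal}"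
  define Ms where "Ms = {M :: ('n, 'm, 'k) gen_poly^'n^'n. \<exists>e. comm.mat_cong M (monomial generic_matrix e)}"
  have "cycle_sum d \<tau> (\<lambda>l. generic_matrix (ks l)) \<in> Z"
  proof (rule cycle_sum_induct[where Ms = Ms])
    show "1 \<in> Z"
      by (simp add: Z_def rhom.one[OF Delta_rhom] polarise_1 comm.zero_mem)
    show "generic_matrix (ks l) \<in> Ms" for l
    proof -
      have "monomial generic_matrix (\<lambda>h. of_bool (h = ks l)) = (generic_matrix (ks l) :: ('n, 'm, 'k) gen_poly^'n^'n)"
        by (rule monomial_unit)
      then show ?thesis
        unfolding Ms_def using comm.mat_cong_refl by (metis (mono_tags, lifting) mem_Collect_eq)
    qed
    show "M ** M' \<in> Ms" if "M \<in> Ms" "M' \<in> Ms" for M M'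
    proof -
      obtain e e' where "comm.mat_cong M (monomial generic_matrix e)" "comm.mat_cong M' (monomial generic_matrix e')"
        using \<open>M \<in> Ms\<close> \<open>M' \<in> Ms\<close> by (auto simp: Ms_def)
      then have "comm.mat_cong (M ** M') (monomial generic_matrix (\<lambda>k. e k + e' k))"
        by (intro comm.mat_cong_trans[OF comm.mat_cong_mult comm.monomial_mult[OF commute_mod_generic]])
      then show ?thesis
        by (auto simp: Ms_def)
    qed
    show "trace M * f \<in> Z" if M: "M \<in> Ms" and f: "f \<in> Z" for M f
    proof -
      obtain e where e: "comm.mat_cong M (monomial generic_matrix e)"
        using M by (auto simp: Ms_def)
      define T where "T = (trace (monomial generic_matrix e) :: ('n, 'm, 'k) gen_poly)"
      have tr: "trace M - T \<in> comm_ideal"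
        unfolding T_def by (rule comm.mat_cong_trace[OF e])
      then have Delta: "Delta (trace M) = Delta T"
        using Delta_comm_ideal[OF tr] by (simp add: rhom.diff[OF Delta_rhom])
      have "T * (of_nat (fact CARD('n)) * f - polarise (Delta f)) \<in> comm_ideal"
        using f by (auto simp: Z_def intro: comm.mult_mem)
      moreover have "of_nat (fact CARD('n)) * f * (trace M - T) \<in> comm_ideal"
        using tr by (rule comm.mult_mem)
      moreover have "polarise (Delta T * Delta f) - T * polarise (Delta f) \<in> comm_ideal"
        unfolding T_def by (rule polarise_Delta_trace)
      ultimately have "T * (of_nat (fact CARD('n)) * f - polarise (Delta f)) + of_nat (fact CARD('n)) * f * (trace M - T) -
          (polarise (Delta T * Delta f) - T * polarise (Delta f)) \<in> comm_ideal"
        by (rule comm.diff_mem[OF comm.add_mem])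
      also have "T * (of_nat (fact CARD('n)) * f - polarise (Delta f)) + of_nat (fact CARD('n)) * f * (trace M - T) -
          (polarise (Delta T * Delta f) - T * polarise (Delta f)) =
          of_nat (fact CARD('n)) * (trace M * f) - polarise (Delta (trace M * f))"
        by (simp add: rhom.mult[OF Delta_rhom] Delta algebra_simps)
      finally show ?thesis
        by (simp add: Z_def)
    qed
  qed (rule assms)
  then show ?thesis
    by (simp add: Z_def)
qed

theorem Delta_kernel_of_invariants:
  fixes f :: "('n::finite, 'm::finite, 'k::field_char_0) gen_poly"
  assumes inv: "\<And>g. g \<in> GL \<Longrightarrow> GL_act g f - f \<in> comm_ideal" and "Delta f = 0"
  shows "f \<in> comm_ideal"
proof -
  obtain N c where c: "f - word_poly N c \<in> comm_ideal"
    "\<And>d ks. d \<le> N \<Longrightarrow> ks \<in> index_maps d \<Longrightarrow> invariant_tensor d (\<lambda>x. c (d, ks, x))"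
    using invariant_modulo_comm_ideal[OF inv] by blast
  define F where "F = (of_nat (fact CARD('n)) :: ('n, 'm, 'k) gen_poly)"
  define Z where "Z = {f :: ('n, 'm, 'k) gen_poly. F * f - polarise (Delta f) \<in> comm_ideal}"
  have Z_sum: "(\<Sum>i\<in>S. h i) \<in> Z" if "\<And>i. i \<in> S \<Longrightarrow> h i \<in> Z" for S :: "'b set" and h
  proof -
    have "(\<Sum>i\<in>S. F * h i - polarise (Delta (h i))) \<in> comm_ideal"
      using that by (intro comm.sum_mem) (simp add: Z_def)
    then show ?thesis
      by (simp add: Z_def sum_distrib_left rhom.sum[OF Delta_rhom] polarise_sum sum_subtractf)
  qed
  have Z_scale: "Const a * h \<in> Z" if "h \<in> Z" for a h
  proof -
    have "Const a * (F * h - polarise (Delta h)) \<in> comm_ideal"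
      using that by (intro comm.mult_mem) (simp add: Z_def)
    then show ?thesis
      by (simp add: Z_def rhom.mult[OF Delta_rhom] polarise_Const_mult algebra_simps)
  qed
  have "(\<Sum>x\<in>positions d. Const (c (d, ks, x)) * word_monomial (d, ks, x)) \<in> Z"
    if d: "d \<le> N" "ks \<in> index_maps d" for d ks
  proof -
    have "(\<lambda>x. c (d, ks, x)) \<in> pairing_span d"
      by (rule invariant_tensor_pairing_span[OF c(2)[OF d]])
    then obtain b where b: "\<And>x. x \<in> positions d \<Longrightarrow> c (d, ks, x) = (\<Sum>\<pi> | \<pi> permutes {..<d}. b \<pi> * pairing d \<pi> x)"
      unfolding pairing_span_def by blast
    have "(\<Sum>x\<in>positions d. Const (c (d, ks, x)) * word_monomial (d, ks, x)) =
        (\<Sum>x\<in>positions d. \<Sum>\<pi> | \<pi> permutes {..<d}. Const (b \<pi>) * (pairing d \<pi> x * word_monomial (d, ks, x)))"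
    proof (rule sum.cong[OF refl])
      fix x :: "(nat \<Rightarrow> 'n) \<times> (nat \<Rightarrow> 'n)"
      assume x: "x \<in> positions d"
      have "Const (pairing d \<pi> x) = (pairing d \<pi> x :: ('n, 'm, 'k) gen_poly)" for \<pi>
        by (cases x) (simp add: pairing_def of_bool_def)
      then show "Const (c (d, ks, x)) * word_monomial (d, ks, x) =
          (\<Sum>\<pi> | \<pi> permutes {..<d}. Const (b \<pi>) * (pairing d \<pi> x * word_monomial (d, ks, x) :: ('n, 'm, 'k) gen_poly))"
        by (simp add: b[OF x] rhom.sum[OF Const_rhom] rhom.mult[OF Const_rhom] sum_distrib_right mult.assoc)
    qed
    also have "\<dots> = (\<Sum>\<pi> | \<pi> permutes {..<d}. Const (b \<pi>) * (\<Sum>x\<in>positions d. pairing d \<pi> x * word_monomial (d, ks, x)))"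
      by (subst sum.swap) (simp add: sum_distrib_left)
    also have "\<dots> = (\<Sum>\<pi> | \<pi> permutes {..<d}. Const (b \<pi>) * cycle_sum d (inv \<pi>) (\<lambda>l. generic_matrix (ks l)))"
    proof (rule sum.cong[OF refl])
      fix \<pi> assume "\<pi> \<in> {\<pi>. \<pi> permutes {..<d}}"
      then have \<pi>: "\<pi> permutes {..<d}"
        by simp
      have "(\<Sum>x\<in>positions d. pairing d \<pi> x * word_monomial (d, ks, x)) =
          (\<Sum>(p, q)\<in>positions d. pairing d \<pi> (p, q) * (\<Prod>l<d. (generic_matrix (ks l) :: ('n, 'm, 'k) gen_poly^'n^'n) $ p l $ q l))"
        by (intro sum.cong refl) (auto simp: word_monomial_def generic_matrix_def)
      then show "Const (b \<pi>) * (\<Sum>x\<in>positions d. pairing d \<pi> x * word_monomial (d, ks, x)) =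
          Const (b \<pi>) * (cycle_sum d (inv \<pi>) (\<lambda>l. generic_matrix (ks l)) :: ('n, 'm, 'k) gen_poly)"
        by (simp only: sum_pairing[OF \<pi>])
    qed
    also have "\<dots> \<in> Z"
    proof (intro Z_sum Z_scale)
      fix \<pi> assume "\<pi> \<in> {\<pi>. \<pi> permutes {..<d}}"
      then have "inv \<pi> permutes {..<d}"
        by (simp add: permutes_inv)
      then show "cycle_sum d (inv \<pi>) (\<lambda>l. generic_matrix (ks l)) \<in> Z"
        unfolding Z_def F_def mem_Collect_eq by (rule cycle_sum_polarise)
    qed
    finally show ?thesis .
  qed
  note inner = this
  have "(\<Sum>d\<le>N. \<Sum>ks\<in>index_maps d. \<Sum>x\<in>positions d. Const (c (d, ks, x)) * word_monomial (d, ks, x)) \<in> Z"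
    by (intro Z_sum inner) auto
  moreover have "word_poly N c = (\<Sum>d\<le>N. \<Sum>ks\<in>index_maps d. \<Sum>x\<in>positions d. Const (c (d, ks, x)) * word_monomial (d, ks, x))"
  proof -
    have "(\<Sum>d\<le>N. \<Sum>ks\<in>index_maps d. \<Sum>x\<in>positions d. Const (c (d, ks, x)) * word_monomial (d, ks, x)) =
        (\<Sum>d\<le>N. \<Sum>y\<in>index_maps d \<times> positions d. Const (c (d, y)) * (word_monomial (d, y) :: ('n, 'm, 'k) gen_poly))"
      by (simp add: sum.cartesian_product case_prod_unfold)
    also have "\<dots> = word_poly N c"
      unfolding word_poly_def words_def
      by (subst sum.Sigma) (simp_all add: finite_index_maps finite_positions case_prod_unfold)
    finally show ?thesis
      by (rule sym)
  qed
  ultimately have "F * word_poly N c - polarise (Delta (word_poly N c)) \<in> comm_ideal"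
    by (simp add: Z_def)
  moreover have "Delta (word_poly N c) = 0"
    \<comment> \<open>The invariant representative differs from \<open>f\<close> by an element of
      the ideal, on which \<open>Delta\<close> vanishes.\<close>
    using Delta_comm_ideal[OF c(1)] assms(2) by (simp add: rhom.diff[OF Delta_rhom])
  ultimately have "F * word_poly N c \<in> comm_ideal"
    by simp
  then have "Const (inverse (of_nat (fact CARD('n)))) * (F * word_poly N c) \<in> comm_ideal"
    by (rule comm.mult_mem)
  moreover have "Const (inverse (of_nat (fact CARD('n)))) * F = 1"
    unfolding F_def rhom.of_nat[OF Const_rhom, symmetric] rhom.mult[OF Const_rhom, symmetric] by simp
  ultimately have "word_poly N c \<in> comm_ideal"
    by (simp add: mult.assoc[symmetric])
  then show ?thesis
    using comm.mem_cong[OF c(1)] by simp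
qed

section \<open>The Nullstellensatz\<close>

locale type_prime_ideal = type_ideal J for J :: "'a::comm_ring_1 set" +
  assumes one_notin: "1 \<notin> J" and prime: "x * y \<in> J \<Longrightarrow> x \<in> J \<or> y \<in> J"
begin

lemma power_notin: "x \<notin> J \<Longrightarrow> x ^ n \<notin> J"
  by (induction n) (use one_notin prime in auto)

end

text \<open>Krull's argument: by Zorn's lemma there is a largest ideal above \<open>I\<close>
  without powers of \<open>f\<close>. If it contained x y but neither x nor y, enlarging it by x and
  by y would give two powers of \<open>f\<close> whose product lies in it.\<close>

lemma prime_ideal_avoiding_powers:
  fixes I :: "'a::comm_ring_1 set"
  assumes I: "type_ideal I" and f: "\<And>n :: nat. f ^ n \<notin> I"
  obtains J where "type_prime_ideal J" "I \<subseteq> J" "f \<notin> J"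
proof -
  define A where "A = {J. type_ideal J \<and> I \<subseteq> J \<and> (\<forall>n. f ^ n \<notin> J)}"
  have "\<exists>M\<in>A. \<forall>J\<in>A. M \<subseteq> J \<longrightarrow> J = M"
  proof (rule subset_Zorn_nonempty)
    show "A \<noteq> {}"
      using I f by (auto simp: A_def)
    fix C assume C: "C \<noteq> {}" "subset.chain A C"
    then have mem: "J \<in> A" if "J \<in> C" for J
      using that by (auto simp: subset.chain_def)
    have "type_ideal (\<Union>C)"
    proof (intro type_ideal.intro idealI_type)
      show "0 \<in> \<Union>C"
      proof -
        obtain J where "J \<in> C"
          using C(1) by blast
        then have "0 \<in> J"
          using mem[of J] type_ideal.zero_mem[of J] by (simp add: A_def)
        with \<open>J \<in> C\<close> show ?thesis
          by blast
      qed
      show "r * x \<in> \<Union>C" if "x \<in> \<Union>C" for r x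
      proof -
        obtain X1 where "X1 \<in> C" "x \<in> X1"
          using \<open>x \<in> \<Union>C\<close> by blast
        then have "r * x \<in> X1"
          using mem[of X1] type_ideal.mult_mem[of X1 x r] by (simp add: A_def)
        with \<open>X1 \<in> C\<close> show ?thesis
          by blast
      qed
      show "x + y \<in> \<Union>C" if "x \<in> \<Union>C" "y \<in> \<Union>C" for x y
      proof -
        obtain X1 Y1 where XY: "X1 \<in> C" "Y1 \<in> C" "x \<in> X1" "y \<in> Y1"
          using \<open>x \<in> \<Union>C\<close> \<open>y \<in> \<Union>C\<close> by blast
        then have "X1 \<subseteq> Y1 \<or> Y1 \<subseteq> X1"
          using C(2) by (auto simp: subset.chain_def)
        then obtain W where "W \<in> C" "x \<in> W" "y \<in> W"
          using XY by blast
        then have "x + y \<in> W"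
          using mem[of W] type_ideal.add_mem[of W x y] by (simp add: A_def)
        with \<open>W \<in> C\<close> show ?thesis
          by blast
      qed
    qed
    then show "\<Union>C \<in> A"
      using C(1) mem by (auto simp: A_def)
  qed
  then obtain M where M: "type_ideal M" "I \<subseteq> M" "\<And>n. f ^ n \<notin> M"
    and max: "\<And>J. type_ideal J \<Longrightarrow> M \<subseteq> J \<Longrightarrow> (\<And>n. f ^ n \<notin> J) \<Longrightarrow> J = M"
    by (auto simp: A_def)
  interpret type_ideal M
    by (rule M(1))
  have power: "\<exists>n m r. m \<in> M \<and> f ^ n = m + r * a" if "a \<notin> M" for a
  proof -
    define J where "J = {m + r * a | m r. m \<in> M}"
    have "type_ideal J"
    proof (intro type_ideal.intro idealI_type)
      show "0 \<in> J"
        unfolding J_def using zero_mem by (auto intro!: exI[of _ 0])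
      show "x + y \<in> J" if "x \<in> J" "y \<in> J" for x y
      proof -
        obtain m r m' r' where "m \<in> M" "m' \<in> M" "x = m + r * a" "y = m' + r' * a"
          using \<open>x \<in> J\<close> \<open>y \<in> J\<close> by (auto simp: J_def)
        then have "x + y = (m + m') + (r + r') * a" "m + m' \<in> M"
          by (simp_all add: algebra_simps add_mem)
        then show ?thesis
          by (auto simp: J_def)
      qed
      show "s * x \<in> J" if "x \<in> J" for s x
      proof -
        obtain m r where "m \<in> M" "x = m + r * a"
          using \<open>x \<in> J\<close> by (auto simp: J_def)
        then have "s * x = s * m + (s * r) * a" "s * m \<in> M"
          using mult_mem[of m s] by (simp_all add: distrib_left mult.assoc)
        then show ?thesis
          by (auto simp: J_def)
      qed
    qed
    moreover have "M \<subseteq> J"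
    proof
      fix m assume "m \<in> M"
      then have "m = m + 0 * a \<and> m \<in> M"
        by simp
      then show "m \<in> J"
        unfolding J_def by blast
    qed
    moreover have "a = 0 + 1 * a"
      by simp
    then have "a \<in> J"
      unfolding J_def using zero_mem by blast
    ultimately obtain n where "f ^ n \<in> J"
      using max \<open>a \<notin> M\<close> by metis
    then show ?thesis
      by (auto simp: J_def)
  qed
  have "type_prime_ideal M"
  proof
    show "1 \<notin> M"
      using M(3)[of 0] by simp
    show "x \<in> M \<or> y \<in> M" if "x * y \<in> M" for x y
    proof (rule ccontr)
      assume "\<not> (x \<in> M \<or> y \<in> M)"
      then obtain n m r n' m' r' where *: "m \<in> M" "f ^ n = m + r * x" "m' \<in> M" "f ^ n' = m' + r' * y"
        using power[of x] power[of y] by blast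
      then have "f ^ (n + n') = (m' + r' * y) * m + (r * x) * m' + (r * r') * (x * y)"
        by (simp add: power_add algebra_simps)
      also have "\<dots> \<in> M"
        by (intro add_mem mult_mem * that)
      finally show False
        using M(3) by blast
    qed
  qed
  then show ?thesis
    using that[of M] M(2) M(3)[of 1] by simp
qed

section \<open>Division of polynomials modulo a prime ideal\<close>

lemma map_poly_rhom:
  assumes "rhom \<psi>"
  shows "rhom (map_poly \<psi>)"
proof -
  interpret rhom \<psi> by fact
  show ?thesis
    by unfold_locales (auto simp: poly_eq_iff coeff_map_poly zero one add coeff_mult sum mult Polynomial.coeff_1)
qed

lemma rhom_poly: "rhom s \<Longrightarrow> s (poly q x) = poly (map_poly s q) (s x)"
  by (induction q) (simp_all add: rhom.zero rhom.add rhom.mult map_poly_pCons)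

context type_prime_ideal
begin

text \<open>\<open>d\<close> is the degree of the image of \<open>q\<close> over the quotient by
  \<open>J\<close>, expressed without forming the quotient. No \<open>d\<close> qualifies if all
  coefficients lie in \<open>J\<close>.\<close>

definition leading_at :: "'a poly \<Rightarrow> nat \<Rightarrow> bool" where
  "leading_at q d \<longleftrightarrow> Polynomial.coeff q d \<notin> J \<and> (\<forall>i>d. Polynomial.coeff q i \<in> J)"

lemma leading_at_exists:
  assumes "Polynomial.coeff q i \<notin> J"
  obtains d where "leading_at q d"
proof -
  define S where "S = {i. Polynomial.coeff q i \<notin> J}"
  have "S \<subseteq> {..Polynomial.degree q}"
    using zero_mem by (auto simp: S_def intro: le_degree)
  then have fin: "finite S" and ne: "S \<noteq> {}"
    using finite_subset assms by (auto simp: S_def)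
  have "leading_at q (Max S)"
    using Max_in[OF fin ne] Max_ge[OF fin] by (auto simp: leading_at_def S_def not_le[symmetric])
  then show ?thesis
    using that by blast
qed

lemma poly_mem: "(\<And>i. Polynomial.coeff q i \<in> J) \<Longrightarrow> poly q x \<in> J"
  by (auto simp: poly_altdef intro!: sum_mem mult_mem_right)

text \<open>Division with remainder modulo \<open>J\<close> over the subring \<open>R\<close>. The
  leading coefficient of \<open>r\<close> need not be a unit, so every reduction step multiplies by
  it once, which produces the power. The degree bound on \<open>s\<close> is used later to
  contradict a minimality.\<close>

lemma pseudo_division:
  fixes R :: "'a set"
  assumes R: "\<And>a b. a \<in> R \<Longrightarrow> b \<in> R \<Longrightarrow> a - b \<in> R" "\<And>a b. a \<in> R \<Longrightarrow> b \<in> R \<Longrightarrow> a + b \<in> R"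
      "\<And>a b. a \<in> R \<Longrightarrow> b \<in> R \<Longrightarrow> a * b \<in> R" "0 \<in> R" "1 \<in> R"
    and r: "\<And>i. Polynomial.coeff r i \<in> R" "leading_at r d"
    and q: "\<And>i. Polynomial.coeff q i \<in> R" "\<And>i. i \<ge> n \<Longrightarrow> Polynomial.coeff q i \<in> J"
  shows "\<exists>k s. (\<forall>i. Polynomial.coeff s i \<in> R) \<and> (\<forall>i. i + d \<ge> n \<longrightarrow> Polynomial.coeff s i = 0) \<and>
    (\<forall>i\<ge>d. Polynomial.coeff (Polynomial.smult (Polynomial.coeff r d ^ k) q - s * r) i \<in> J)"
  using q
proof (induction n arbitrary: q)
  case 0
  then show ?case
    using R(4) by (intro exI[of _ 0]) auto
next
  case (Suc m)
  show ?case
  proof (cases "d \<le> m")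
    case False
    then show ?thesis
      using Suc.prems R(4) by (intro exI[of _ 0]) auto
  next
    case True
    define c where "c = Polynomial.coeff r d"
    define a where "a = Polynomial.coeff q m"
    define q' where "q' = Polynomial.smult c q - Polynomial.monom a (m - d) * r"
    have cR: "c \<in> R" and aR: "a \<in> R"
      using r(1) Suc.prems(1) by (simp_all add: c_def a_def)
    have coeff_q': "Polynomial.coeff q' i = c * Polynomial.coeff q i - (if m - d \<le> i then a * Polynomial.coeff r (i - (m - d)) else 0)" for i
      by (simp add: q'_def coeff_monom_mult)
    have "Polynomial.coeff q' i \<in> R" for i
      unfolding coeff_q' using R(1,3,4) cR aR Suc.prems(1) r(1) by simp
    moreover have "Polynomial.coeff q' i \<in> J" if "i \<ge> m" for i
    proof (cases "i = m")
      case True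
      then show ?thesis
        using \<open>d \<le> m\<close> by (simp add: coeff_q' a_def c_def zero_mem mult.commute)
    next
      case False
      then have "Polynomial.coeff q i \<in> J" "i - (m - d) > d"
        using Suc.prems(2)[of i] that \<open>d \<le> m\<close> by auto
      then show ?thesis
        using r(2) by (simp add: coeff_q' leading_at_def diff_mem mult_mem zero_mem)
    qed
    ultimately obtain k s where s: "\<And>i. Polynomial.coeff s i \<in> R" "\<And>i. i + d \<ge> m \<Longrightarrow> Polynomial.coeff s i = 0"
      "\<And>i. i \<ge> d \<Longrightarrow> Polynomial.coeff (Polynomial.smult (c ^ k) q' - s * r) i \<in> J"
      using Suc.IH[of q'] unfolding c_def by blast
    define s' where "s' = Polynomial.smult (c ^ k) (Polynomial.monom a (m - d)) + s"
    have "Polynomial.smult (c ^ Suc k) q - s' * r = Polynomial.smult (c ^ k) q' - s * r"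
      by (simp add: q'_def s'_def algebra_simps Polynomial.smult_diff_right Polynomial.smult_add_left)
    moreover have "c ^ k \<in> R"
      by (induction k) (simp_all add: R cR)
    then have "Polynomial.coeff s' i \<in> R" for i
      using R s(1) aR by (simp add: s'_def)
    moreover have "Polynomial.coeff s' i = 0" if "i + d \<ge> Suc m" for i
      using that s(2)[of i] True by (auto simp: s'_def)
    ultimately show ?thesis
      using s(3) unfolding c_def by (intro exI[of _ "Suc k"] exI[of _ s']) simp
  qed
qed

end

text \<open>
  Elimination of one variable \<open>x\<close>. If \<open>x\<close> is transcendental over \<open>R\<close> modulo \<open>J\<close>, then almost
  every value extends \<open>\<psi>\<close>. Otherwise the values are the roots of a polynomial \<open>p\<close> of minimal
  degree, and \<open>u\<close> is invertible modulo \<open>p\<close> up to a factor in \<open>R\<close>.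
\<close>
lemma (in type_prime_ideal) extend_point:
  fixes R :: "'a set" and x :: 'a
  assumes R: "\<And>a b. a \<in> R \<Longrightarrow> b \<in> R \<Longrightarrow> a - b \<in> R" "\<And>a b. a \<in> R \<Longrightarrow> b \<in> R \<Longrightarrow> a + b \<in> R"
      "\<And>a b. a \<in> R \<Longrightarrow> b \<in> R \<Longrightarrow> a * b \<in> R" "0 \<in> R" "1 \<in> R"
    and u: "\<And>i. Polynomial.coeff u i \<in> R" "poly u x \<notin> J"
  shows "\<exists>u'\<in>R - J. \<forall>\<psi> :: 'a \<Rightarrow> 'b::alg_closed_field. rhom \<psi> \<longrightarrow> (\<forall>r\<in>R \<inter> J. \<psi> r = 0) \<longrightarrow> \<psi> u' \<noteq> 0 \<longrightarrow>
    (\<exists>\<beta>. (\<forall>q. (\<forall>i. Polynomial.coeff q i \<in> R) \<longrightarrow> poly q x \<in> J \<longrightarrow> poly (map_poly \<psi> q) \<beta> = 0) \<and>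
      poly (map_poly \<psi> u) \<beta> \<noteq> 0)"
proof -
  \<comment> \<open>\<open>RX\<close> is the polynomial ring over \<open>R\<close>, and
    \<open>JX\<close> consists of the relations that \<open>x\<close> satisfies over
    \<open>R\<close> modulo \<open>J\<close>.\<close>
  define RX where "RX = {q. \<forall>i. Polynomial.coeff q i \<in> R}"
  define JX where "JX = {q \<in> RX. poly q x \<in> J}"
  have R_sum: "(\<Sum>i\<in>S. g i) \<in> R" if "\<And>i. i \<in> S \<Longrightarrow> g i \<in> R" for S :: "nat set" and g
    using that by (induction S rule: infinite_finite_induct) (auto simp: R)
  have RX: "p - q \<in> RX" "p + q \<in> RX" "p * q \<in> RX" if "p \<in> RX" "q \<in> RX" for p q
    using that by (auto simp: RX_def R coeff_mult intro!: R_sum)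
  have R_power: "a ^ k \<in> R" if "a \<in> R" for a k
    using that by (induction k) (simp_all add: R)
  have RX_smult: "Polynomial.smult a q \<in> RX" if "a \<in> R" "q \<in> RX" for a q
    using that by (simp add: RX_def R)
  have uRX: "u \<in> RX"
    using u by (simp add: RX_def)
  have eval: "rhom (\<lambda>q. poly (map_poly \<psi> q) \<beta>)" if "rhom \<psi>" for \<psi> :: "'a \<Rightarrow> 'b" and \<beta>
    using rhom_comp[OF map_poly_rhom[OF that] poly_rhom[of \<beta>]] by (simp add: comp_def)
  have eval_smult: "poly (map_poly \<psi> (Polynomial.smult a q)) \<beta> = \<psi> a * poly (map_poly \<psi> q) \<beta>" if "rhom \<psi>" for \<psi> :: "'a \<Rightarrow> 'b" and \<beta> a q
  proof -
    have "map_poly \<psi> (Polynomial.smult a q) = Polynomial.smult (\<psi> a) (map_poly \<psi> q)"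
      by (simp add: poly_eq_iff coeff_map_poly rhom.zero[OF that] rhom.mult[OF that])
    then show ?thesis
      by simp
  qed
  have eval_zero: "poly (map_poly \<psi> q) \<beta> = 0"
    if "rhom \<psi>" "\<forall>r\<in>R \<inter> J. \<psi> r = 0" "q \<in> RX" "\<And>i. Polynomial.coeff q i \<in> J" for \<psi> :: "'a \<Rightarrow> 'b" and \<beta> q
  proof -
    have "map_poly \<psi> q = 0"
      using that by (auto simp: poly_eq_iff coeff_map_poly rhom.zero[OF that(1)] RX_def)
    then show ?thesis
      by simp
  qed
  show ?thesis
  proof (cases "\<forall>q\<in>JX. \<forall>i. Polynomial.coeff q i \<in> J")
    case True
    obtain i where i: "Polynomial.coeff u i \<notin> J"
      using u(2) poly_mem by blast
    show ?thesis
    proof (intro bexI[of _ "Polynomial.coeff u i"] allI impI)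
      show "Polynomial.coeff u i \<in> R - J"
        using i u by simp
      fix \<psi> :: "'a \<Rightarrow> 'b"
      assume \<psi>: "rhom \<psi>" "\<forall>r\<in>R \<inter> J. \<psi> r = 0" "\<psi> (Polynomial.coeff u i) \<noteq> 0"
      then have "map_poly \<psi> u \<noteq> 0"
        by (auto simp: poly_eq_iff coeff_map_poly rhom.zero)
      then have "finite {\<beta>. poly (map_poly \<psi> u) \<beta> = 0}"
        by (rule poly_roots_finite)
      moreover have "infinite (UNIV :: 'b set)"
      proof
        assume fin: "finite (UNIV :: 'b set)"
        \<comment> \<open>Over a finite field this polynomial takes the value 1 everywhere although
          its degree is positive, against algebraic closedness.\<close>
        define P :: "'b poly" where "P = (\<Prod>a\<in>UNIV. [:- a, 1:]) + 1"
        have "Polynomial.degree (\<Prod>a\<in>(UNIV :: 'b set). [:- a, 1:]) = card (UNIV :: 'b set)"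
          by (subst degree_prod_eq_sum_degree) simp_all
        moreover have "card (UNIV :: 'b set) > 0"
          using fin by (simp add: card_gt_0_iff)
        ultimately have "Polynomial.degree P > 0"
          unfolding P_def by (subst degree_add_eq_left) simp_all
        then obtain b where "poly P b = 0"
          using alg_closed_imp_poly_has_root by blast
        moreover have "poly P b = 1"
          using fin by (simp add: P_def poly_prod)
        ultimately show False
          by simp
      qed
      ultimately obtain \<beta> where "poly (map_poly \<psi> u) \<beta> \<noteq> 0"
        using finite_subset[of UNIV "{\<beta>. poly (map_poly \<psi> u) \<beta> = 0}"] by auto
      moreover have "poly (map_poly \<psi> q) \<beta> = 0" if "\<forall>i. Polynomial.coeff q i \<in> R" "poly q x \<in> J" for q
        using that True by (intro eval_zero[OF \<psi>(1,2)]) (simp_all add: JX_def RX_def)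
      ultimately show "\<exists>\<beta>. (\<forall>q. (\<forall>i. Polynomial.coeff q i \<in> R) \<longrightarrow> poly q x \<in> J \<longrightarrow> poly (map_poly \<psi> q) \<beta> = 0) \<and>
          poly (map_poly \<psi> u) \<beta> \<noteq> 0"
        by blast
    qed
  next
    case False
    then obtain q d where "q \<in> JX" "leading_at q d"
      using leading_at_exists by blast
    \<comment> \<open>The least degree of a nontrivial relation; \<open>p\<close> serves as a
      minimal polynomial of \<open>x\<close>.\<close>
    define d where "d = (LEAST d. \<exists>q\<in>JX. leading_at q d)"
    have "\<exists>q\<in>JX. leading_at q d"
      unfolding d_def by (rule LeastI_ex) (use \<open>q \<in> JX\<close> \<open>leading_at q _\<close> in blast)
    then obtain p where p: "p \<in> JX" "leading_at p d"
      by blast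
    have d_min: "d \<le> e" if "q \<in> JX" "leading_at q e" for q e
      unfolding d_def by (rule Least_le) (use that in blast)
    have JX_small: "Polynomial.coeff q i \<in> J" if "q \<in> JX" "\<And>i. i \<ge> d \<Longrightarrow> Polynomial.coeff q i \<in> J" for q i
    proof (rule ccontr)
      assume "Polynomial.coeff q i \<notin> J"
      then obtain e where e: "leading_at q e"
        by (rule leading_at_exists)
      then show False
        using d_min[OF that(1) e] that(2)[of e] by (simp add: leading_at_def)
    qed
    have pRX: "p \<in> RX" and px: "poly p x \<in> J"
      using p(1) by (simp_all add: JX_def)
    define c where "c = Polynomial.coeff p d"
    have c: "c \<in> R" "c \<notin> J"
      using pRX p(2) by (simp_all add: c_def RX_def leading_at_def)
    have "d > 0"
    proof (rule ccontr)
      assume "\<not> d > 0"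
      then have *: "Polynomial.coeff p i \<in> J" if "i > 0" for i
        using p(2) that by (simp add: leading_at_def)
      have "poly (p - [:Polynomial.coeff p 0:]) x \<in> J"
        by (rule poly_mem) (use * zero_mem in \<open>auto simp: Polynomial.coeff_pCons split: nat.split\<close>)
      then have "poly p x - Polynomial.coeff p 0 \<in> J"
        by simp
      then show False
        using px p(2) mem_cong[of "poly p x" "Polynomial.coeff p 0"] \<open>\<not> d > 0\<close> by (simp add: leading_at_def)
    qed
    have div: "\<exists>k s. s \<in> RX \<and> (\<forall>i. i + e \<ge> n \<longrightarrow> Polynomial.coeff s i = 0) \<and>
        (\<forall>i\<ge>e. Polynomial.coeff (Polynomial.smult (Polynomial.coeff r e ^ k) q - s * r) i \<in> J)"
      if "r \<in> RX" "leading_at r e" "q \<in> RX" "\<And>i. i \<ge> n \<Longrightarrow> Polynomial.coeff q i \<in> J" for r e q n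
    proof -
      have "\<And>i. Polynomial.coeff r i \<in> R" "\<And>i. Polynomial.coeff q i \<in> R"
        using that(1,3) by (simp_all add: RX_def)
      from pseudo_division[OF R this(1) that(2) this(2) that(4)] show ?thesis
        by (simp add: RX_def)
    qed
    have divp: "\<exists>k s. s \<in> RX \<and> (\<forall>i\<ge>d. Polynomial.coeff (Polynomial.smult (c ^ k) q - s * p) i \<in> J)" if "q \<in> RX" for q
    proof -
      have "Polynomial.coeff q i \<in> J" if "i \<ge> Suc (Polynomial.degree q)" for i
        using that by (simp add: coeff_eq_0 zero_mem)
      from div[OF pRX p(2) \<open>q \<in> RX\<close> this] show ?thesis
        unfolding c_def by blast
    qed
    \<comment> \<open>The multiples of \<open>u\<close> modulo the relations of \<open>x\<close>. An
      element of least degree in \<open>S\<close> acts as a greatest common divisor of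
      \<open>u\<close> and \<open>p\<close>; it turns out to be constant modulo
      \<open>J\<close>.\<close>
    define S where "S = {r \<in> RX. \<exists>t\<in>RX. r - t * u \<in> JX}"
    have JX_mult: "t * q \<in> JX" if "q \<in> JX" "t \<in> RX" for q t
      using that by (simp add: JX_def RX mult_mem)
    have JX_add: "q + q' \<in> JX" "q - q' \<in> JX" if "q \<in> JX" "q' \<in> JX" for q q'
      using that by (simp_all add: JX_def RX add_mem diff_mem)
    have JX_smult: "Polynomial.smult a q \<in> JX" if "a \<in> R" "q \<in> JX" for a q
      using that by (simp add: JX_def RX_smult mult_mem)
    have "\<exists>r e. r \<in> S \<and> leading_at r e \<and> e < d"
    proof -
      obtain k s where s: "s \<in> RX" "\<And>i. i \<ge> d \<Longrightarrow> Polynomial.coeff (Polynomial.smult (c ^ k) u - s * p) i \<in> J"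
        using divp[OF uRX] by blast
      define r where "r = Polynomial.smult (c ^ k) u - s * p"
      have rRX: "r \<in> RX"
        unfolding r_def by (intro RX RX_smult R_power c uRX s pRX)
      have "poly r x \<notin> J"
      proof
        assume "poly r x \<in> J"
        then have "poly r x + poly s x * poly p x \<in> J"
          using px by (intro add_mem mult_mem)
        then have "c ^ k * poly u x \<in> J"
          by (simp add: r_def)
        then show False
          using prime power_notin[OF c(2)] u(2) by blast
      qed
      then obtain i where "Polynomial.coeff r i \<notin> J"
        using poly_mem by blast
      then obtain e where e: "leading_at r e"
        by (rule leading_at_exists)
      have "e < d"
        using e s(2)[of e] unfolding r_def leading_at_def by (meson not_le)
      moreover have "r - [:c ^ k:] * u \<in> JX"
      proof -
        have "r - [:c ^ k:] * u = [:- 1:] * (s * p)"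
          by (simp add: r_def)
        moreover have "[:- 1:] \<in> RX"
          using R(1)[OF R(4,5)] R(4) by (auto simp: RX_def Polynomial.coeff_pCons split: nat.split)
        ultimately show ?thesis
          using JX_mult p(1) s(1) by metis
      qed
      moreover have "[:c ^ k:] \<in> RX"
        using R_power[OF c(1)] R(4) by (auto simp: RX_def Polynomial.coeff_pCons split: nat.split)
      ultimately show ?thesis
        using e rRX unfolding S_def by blast
    qed
    then obtain e0 where e0: "\<exists>r\<in>S. leading_at r e0" "e0 < d"
      by blast
    define e where "e = (LEAST e. \<exists>r\<in>S. leading_at r e)"
    have "\<exists>r\<in>S. leading_at r e"
      unfolding e_def by (rule LeastI_ex) (use e0 in blast)
    then obtain r where r: "r \<in> S" "leading_at r e"
      by blast
    have e_min: "e \<le> e'" if "q \<in> S" "leading_at q e'" for q e'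
      unfolding e_def by (rule Least_le) (use that in blast)
    have "e < d"
      using e0 e_min by fastforce
    obtain t where t: "t \<in> RX" "r - t * u \<in> JX" and rRX: "r \<in> RX"
      using r(1) by (auto simp: S_def)
    \<comment> \<open>If e were positive, the remainder of \<open>p\<close> on division by
      \<open>r\<close> would belong to \<open>S\<close> and have degree below e, so it vanishes
      modulo \<open>J\<close>. Then s r vanishes at \<open>x\<close>, whereas \<open>r\<close> does
      not because its degree is below d. Hence \<open>s\<close> is a nontrivial relation of degree
      at most d - e, against the choice of d.\<close>
    have "e = 0"
    proof (rule ccontr)
      assume "e \<noteq> 0"
      define b where "b = Polynomial.coeff r e"
      have b: "b \<in> R" "b \<notin> J"
        using rRX r(2) by (simp_all add: b_def RX_def leading_at_def)
      have "\<And>i. i \<ge> Suc d \<Longrightarrow> Polynomial.coeff p i \<in> J"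
        using p(2) by (simp add: leading_at_def)
      from div[OF rRX r(2) pRX this] obtain k s where s: "s \<in> RX" "\<And>i. i + e \<ge> Suc d \<Longrightarrow> Polynomial.coeff s i = 0"
        "\<And>i. i \<ge> e \<Longrightarrow> Polynomial.coeff (Polynomial.smult (b ^ k) p - s * r) i \<in> J"
        unfolding b_def by blast
      define r' where "r' = Polynomial.smult (b ^ k) p - s * r"
      have r'RX: "r' \<in> RX"
        unfolding r'_def by (intro RX RX_smult R_power b pRX s rRX)
      have "r' - (- s * t) * u = Polynomial.smult (b ^ k) p - s * (r - t * u)"
        by (simp add: r'_def algebra_simps)
      also have "\<dots> \<in> JX"
        by (intro JX_add JX_smult JX_mult R_power b p t s)
      finally have "r' - (- s * t) * u \<in> JX" .
      moreover have "0 \<in> RX"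
        using R(4) by (simp add: RX_def)
      then have "- s * t \<in> RX"
        using RX(1)[OF _ RX(3)[OF s(1) t(1)], of 0] by simp
      ultimately have "r' \<in> S"
        using r'RX unfolding S_def by blast
      have r'J: "Polynomial.coeff r' i \<in> J" for i
      proof (rule ccontr)
        assume "Polynomial.coeff r' i \<notin> J"
        then obtain e' where e': "leading_at r' e'"
          by (rule leading_at_exists)
        then show False
          using e_min[OF \<open>r' \<in> S\<close> e'] s(3)[of e'] by (simp add: leading_at_def r'_def)
      qed
      then have "poly r' x \<in> J"
        by (rule poly_mem)
      then have "b ^ k * poly p x - poly r' x \<in> J"
        using px by (intro diff_mem mult_mem)
      then have "poly s x * poly r x \<in> J"
        by (simp add: r'_def)
      moreover have "poly r x \<notin> J"
        using d_min[of r e] rRX r(2) \<open>e < d\<close> by (auto simp: JX_def)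
      ultimately have "s \<in> JX"
        using prime s(1) by (auto simp: JX_def)
      have "\<exists>i. Polynomial.coeff s i \<notin> J"
      proof (rule ccontr)
        assume "\<not> ?thesis"
        then have "Polynomial.coeff (s * r) d \<in> J"
          by (auto simp: coeff_mult intro!: sum_mem mult_mem_right)
        then have "b ^ k * c \<in> J"
          using add_mem[OF r'J[of d], of "Polynomial.coeff (s * r) d"] by (simp add: r'_def c_def)
        then show False
          using prime power_notin[OF b(2)] c(2) by blast
      qed
      then obtain d' where d': "leading_at s d'"
        using leading_at_exists by blast
      then have "d' \<ge> d"
        using d_min \<open>s \<in> JX\<close> by blast
      then show False
        using s(2)[of d'] d' \<open>e \<noteq> 0\<close> zero_mem by (simp add: leading_at_def)
    qed
    define r0 where "r0 = Polynomial.coeff r 0"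
    have r0: "r0 \<in> R" "r0 \<notin> J" "\<And>i. i > 0 \<Longrightarrow> Polynomial.coeff r i \<in> J"
      using r(2) rRX \<open>e = 0\<close> by (simp_all add: r0_def RX_def leading_at_def)
    show ?thesis
    \<comment> \<open>If \<open>c\<close> survives under \<psi>, the image of \<open>p\<close> has
      positive degree and hence a root. If \<open>r0\<close> survives, then \<open>u\<close> is
      nonzero at this root, because \<open>r0\<close> is a multiple of \<open>u\<close> modulo the
      relations.\<close>
    proof (intro bexI[of _ "c * r0"] allI impI)
      show "c * r0 \<in> R - J"
        using c r0 R(3) prime by blast
      fix \<psi> :: "'a \<Rightarrow> 'b"
      assume \<psi>: "rhom \<psi>" "\<forall>r\<in>R \<inter> J. \<psi> r = 0" "\<psi> (c * r0) \<noteq> 0"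
      then have nz: "\<psi> c \<noteq> 0" "\<psi> r0 \<noteq> 0"
        by (auto simp: rhom.mult[OF \<psi>(1)])
      have "Polynomial.coeff (map_poly \<psi> p) d \<noteq> 0"
        using nz by (simp add: coeff_map_poly rhom.zero[OF \<psi>(1)] c_def)
      then have "Polynomial.degree (map_poly \<psi> p) > 0"
        using \<open>d > 0\<close> le_degree by fastforce
      then obtain \<beta> where \<beta>: "poly (map_poly \<psi> p) \<beta> = 0"
        using alg_closed_imp_poly_has_root by blast
      note ev = eval[OF \<psi>(1), of \<beta>]
      have van: "poly (map_poly \<psi> q) \<beta> = 0" if q: "q \<in> JX" for q
      proof -
        have qRX: "q \<in> RX"
          using q by (simp add: JX_def)
        obtain k s where s: "s \<in> RX" "\<And>i. i \<ge> d \<Longrightarrow> Polynomial.coeff (Polynomial.smult (c ^ k) q - s * p) i \<in> J"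
          using divp[OF qRX] by blast
        have mem: "Polynomial.smult (c ^ k) q - s * p \<in> JX"
          by (intro JX_add JX_smult JX_mult R_power c q p s)
        have "poly (map_poly \<psi> (Polynomial.smult (c ^ k) q - s * p)) \<beta> = 0"
          by (rule eval_zero[OF \<psi>(1,2)]) (use mem JX_small[OF mem s(2)] in \<open>auto simp: JX_def\<close>)
        then have "\<psi> (c ^ k) * poly (map_poly \<psi> q) \<beta> = 0"
          by (simp add: rhom.diff[OF ev] rhom.mult[OF ev] eval_smult[OF \<psi>(1)] \<beta>)
        then show ?thesis
          using nz(1) by (simp add: rhom.power[OF \<psi>(1)])
      qed
      have "poly (map_poly \<psi> (r - [:r0:])) \<beta> = 0"
      proof (rule eval_zero[OF \<psi>(1,2)])
        show "r - [:r0:] \<in> RX"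
          using rRX r0 R by (auto simp: RX_def Polynomial.coeff_pCons split: nat.split)
        show "Polynomial.coeff (r - [:r0:]) i \<in> J" for i
          using r0 zero_mem by (cases i) (simp_all add: r0_def)
      qed
      then have "poly (map_poly \<psi> r) \<beta> = \<psi> r0"
        by (simp add: rhom.diff[OF ev] map_poly_pCons rhom.zero[OF \<psi>(1)])
      moreover have "poly (map_poly \<psi> (r - t * u)) \<beta> = 0"
        by (rule van[OF t(2)])
      ultimately have "poly (map_poly \<psi> u) \<beta> \<noteq> 0"
        using nz(2) by (auto simp: rhom.diff[OF ev] rhom.mult[OF ev])
      with van show "\<exists>\<beta>. (\<forall>q. (\<forall>i. Polynomial.coeff q i \<in> R) \<longrightarrow> poly q x \<in> J \<longrightarrow> poly (map_poly \<psi> q) \<beta> = 0) \<and>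
          poly (map_poly \<psi> u) \<beta> \<noteq> 0"
        by (intro exI[of _ \<beta>]) (simp add: JX_def RX_def)
    qed
  qed
qed

section \<open>Elimination of all variables, with polynomials in fewer variables as subrings\<close>

inductive_set polys_in :: "'v set \<Rightarrow> ('v, 'k::comm_ring_1) mpoly set" for V where
  Const: "Const c \<in> polys_in V"
| add: "p \<in> polys_in V \<Longrightarrow> q \<in> polys_in V \<Longrightarrow> p + q \<in> polys_in V"
| Var: "p \<in> polys_in V \<Longrightarrow> v \<in> V \<Longrightarrow> p * Var v \<in> polys_in V"

lemma polys_in_UNIV: "p \<in> polys_in UNIV"
  by (induction p rule: mpoly_induct) (auto intro: polys_in.intros)

lemma polys_in_empty: "p \<in> polys_in {} \<Longrightarrow> \<exists>c. p = Const c"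
  by (induction rule: polys_in.induct) (auto simp: rhom.add[OF Const_rhom, symmetric])

lemma polys_in_mult:
  assumes "p \<in> polys_in V" "q \<in> polys_in V"
  shows "p * q \<in> polys_in V"
proof -
  have "p * Const c \<in> polys_in V" for c
    using assms(1)
  proof (induction rule: polys_in.induct)
    case (Const b)
    then show ?case
      using polys_in.Const[of "b * c"] by (simp add: rhom.mult[OF Const_rhom])
  next
    case (add p q)
    then show ?case
      by (simp add: distrib_right polys_in.add)
  next
    case (Var p v)
    then show ?case
      using polys_in.Var[of "p * Const c" V v] by (simp add: mult_ac)
  qed
  with assms(2) show ?thesis
  proof (induction rule: polys_in.induct)
    case (add p q)
    then show ?case
      by (simp add: distrib_left polys_in.add)
  next
    case (Var q v)
    then show ?case
      using polys_in.Var[of "p * q" V v] by (simp add: mult_ac)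
  qed simp
qed

lemma polys_in_diff:
  assumes "p \<in> polys_in V" "q \<in> polys_in V"
  shows "p - q \<in> polys_in V"
proof -
  have "p + Const (- 1) * q \<in> polys_in V"
    by (intro polys_in.intros polys_in_mult assms)
  then show ?thesis
    by (simp add: rhom.uminus[OF Const_rhom])
qed

lemma polys_in_insert:
  assumes "p \<in> polys_in (insert v V)"
  shows "\<exists>q. (\<forall>i. Polynomial.coeff q i \<in> polys_in V) \<and> p = poly q (Var v)"
  using assms
proof (induction rule: polys_in.induct)
  case (Const c)
  have "Polynomial.coeff [:Const c:] i \<in> polys_in V" for i
    using polys_in.Const[of c V] polys_in.Const[of 0 V] by (cases i) simp_all
  then show ?case
    by (intro exI[of _ "[:Const c:]"]) simp
next
  case (add p p')
  then obtain q q' where "\<forall>i. Polynomial.coeff q i \<in> polys_in V" "p = poly q (Var v)"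
    "\<forall>i. Polynomial.coeff q' i \<in> polys_in V" "p' = poly q' (Var v)"
    by blast
  then show ?case
    by (intro exI[of _ "q + q'"]) (simp add: polys_in.add)
next
  case (Var p w)
  then obtain q where q: "\<And>i. Polynomial.coeff q i \<in> polys_in V" "p = poly q (Var v)"
    by blast
  show ?case
  proof (cases "w = v")
    case True
    have "Polynomial.coeff (pCons 0 q) i \<in> polys_in V" for i
      using q(1) polys_in.Const[of 0 V] by (cases i) simp_all
    then show ?thesis
      using True q(2) by (intro exI[of _ "pCons 0 q"]) (simp add: mult.commute)
  next
    case False
    then have "w \<in> V"
      using Var by simp
    then have "Var w \<in> polys_in V"
      using polys_in.Var[OF polys_in.Const[of 1 V]] by simp
    from polys_in_mult[OF this q(1)] have "Polynomial.coeff (Polynomial.smult (Var w) q) i \<in> polys_in V" for i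
      by simp
    then show ?thesis
      using q(2) by (intro exI[of _ "Polynomial.smult (Var w) q"]) (simp add: mult.commute)
  qed
qed

lemma subst_update:
  assumes "rhom \<iota>" "p \<in> polys_in V" "v \<notin> V"
  shows "subst \<iota> (a(v := \<beta>)) p = subst \<iota> a p"
  using assms(2)
proof (induction rule: polys_in.induct)
  case (Var p w)
  then show ?case
    using assms by (auto simp: rhom.mult[OF subst_rhom[OF assms(1)]])
qed (simp_all add: assms(1) rhom.add[OF subst_rhom[OF assms(1)]])

text \<open>Induction on the set of variables: \<open>extend_point\<close> trades \<open>u\<close>
  for a polynomial \<open>u'\<close> without the variable \<open>v\<close>, and a point where
  \<open>u'\<close> is nonzero extends to \<open>v\<close>. Without variables only nonzero constants
  are left, which no proper ideal contains.\<close>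

lemma prime_ideal_has_point:
  fixes J :: "('v, 'k::field) mpoly set" and \<iota> :: "'k \<Rightarrow> 'b::alg_closed_field"
  assumes "type_prime_ideal J" and \<iota>: "rhom \<iota>" and "finite V" and "u \<in> polys_in V - J"
  shows "\<exists>a. (\<forall>q\<in>polys_in V \<inter> J. subst \<iota> a q = 0) \<and> subst \<iota> a u \<noteq> 0"
  using assms(3,4)
proof (induction V arbitrary: u rule: finite_induct)
  interpret type_prime_ideal J
    by fact
  {
    case empty
    have unit: "Const c \<notin> J" if "c \<noteq> 0" for c
    proof
      assume "Const c \<in> J"
      then have "Const (inverse c) * Const c \<in> J"
        by (rule mult_mem)
      then show False
        using that one_notin by (simp add: rhom.mult[OF Const_rhom, symmetric])
    qed
    obtain c where c: "u = Const c" "c \<noteq> 0"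
      using empty polys_in_empty[of u] zero_mem by (metis Const_0 Diff_iff)
    have "\<iota> c * \<iota> (inverse c) = 1"
      using c(2) by (simp add: rhom.mult[OF \<iota>, symmetric] rhom.one[OF \<iota>])
    then have "\<iota> c \<noteq> 0"
      by auto
    moreover have "subst \<iota> a q = 0" if q: "q \<in> polys_in {} \<inter> J" for a q
    proof -
      obtain b where b: "q = Const b"
        using q polys_in_empty by blast
      then have "b = 0"
        using unit q by auto
      then show ?thesis
        by (simp only: b subst_Const[OF \<iota>] rhom.zero[OF \<iota>])
    qed
    ultimately show ?case
      by (simp add: c(1) \<iota>)
  next
    case (insert v V)
    obtain qu where qu: "\<And>i. Polynomial.coeff qu i \<in> polys_in V" "u = poly qu (Var v)"
      using insert.prems polys_in_insert[of u v V] by blast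
    have zero_one: "0 \<in> polys_in V" "1 \<in> (polys_in V :: ('v, 'k) mpoly set)"
      using polys_in.Const[of 0 V] polys_in.Const[of 1 V] by simp_all
    obtain u' where u': "u' \<in> polys_in V - J"
      and ext: "\<And>\<psi> :: ('v, 'k) mpoly \<Rightarrow> 'b. rhom \<psi> \<Longrightarrow> (\<forall>r\<in>polys_in V \<inter> J. \<psi> r = 0) \<Longrightarrow> \<psi> u' \<noteq> 0 \<Longrightarrow>
        \<exists>\<beta>. (\<forall>q. (\<forall>i. Polynomial.coeff q i \<in> polys_in V) \<longrightarrow> poly q (Var v) \<in> J \<longrightarrow> poly (map_poly \<psi> q) \<beta> = 0) \<and>
          poly (map_poly \<psi> qu) \<beta> \<noteq> 0"
      using extend_point[OF polys_in_diff polys_in.add polys_in_mult zero_one qu(1), of "Var v", where 'b = 'b]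
        insert.prems qu(2) by blast
    obtain a where a: "\<forall>q\<in>polys_in V \<inter> J. subst \<iota> a q = 0" "subst \<iota> a u' \<noteq> 0"
      using insert.IH[OF u'] by blast
    obtain \<beta> where \<beta>: "\<And>q. (\<forall>i. Polynomial.coeff q i \<in> polys_in V) \<Longrightarrow> poly q (Var v) \<in> J \<Longrightarrow> poly (map_poly (subst \<iota> a) q) \<beta> = 0"
      "poly (map_poly (subst \<iota> a) qu) \<beta> \<noteq> 0"
      using ext[OF subst_rhom[OF \<iota>] a] by blast
    have eval: "subst \<iota> (a(v := \<beta>)) (poly q (Var v)) = poly (map_poly (subst \<iota> a) q) \<beta>"
      if q: "\<forall>i. Polynomial.coeff q i \<in> polys_in V" for q
    proof -
      have "subst \<iota> (a(v := \<beta>)) (Polynomial.coeff q i) = subst \<iota> a (Polynomial.coeff q i)" for i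
        using q insert.hyps(2) by (intro subst_update[OF \<iota>, where V = V]) auto
      then have "map_poly (subst \<iota> (a(v := \<beta>))) q = map_poly (subst \<iota> a) q"
        by (simp add: poly_eq_iff coeff_map_poly rhom.zero[OF subst_rhom[OF \<iota>]])
      then show ?thesis
        using rhom_poly[OF subst_rhom[OF \<iota>, of "a(v := \<beta>)"], of q "Var v"] by (simp add: \<iota>)
    qed
    have "subst \<iota> (a(v := \<beta>)) q = 0" if q: "q \<in> polys_in (insert v V) \<inter> J" for q
    proof -
      obtain q' where q': "\<forall>i. Polynomial.coeff q' i \<in> polys_in V" "q = poly q' (Var v)"
        using polys_in_insert[of q v V] q by auto
      then show ?thesis
        using \<beta>(1)[OF q'(1)] q by (simp add: eval[OF q'(1)])
    qed
    moreover have "subst \<iota> (a(v := \<beta>)) u \<noteq> 0"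
      using \<beta>(2) eval qu by simp
    ultimately show ?case
      by blast
  }
qed

theorem nullstellensatz:
  fixes I :: "('v::finite, 'k::field) mpoly set" and \<iota> :: "'k \<Rightarrow> 'b::alg_closed_field"
  assumes "type_ideal I" "rhom \<iota>" "\<And>n :: nat. f ^ n \<notin> I"
  obtains a where "\<And>q. q \<in> I \<Longrightarrow> subst \<iota> a q = 0" "subst \<iota> a f \<noteq> 0"
proof -
  obtain J where J: "type_prime_ideal J" "I \<subseteq> J" "f \<notin> J"
    using prime_ideal_avoiding_powers[OF assms(1,3)] .
  obtain a where "\<forall>q\<in>polys_in UNIV \<inter> J. subst \<iota> a q = 0" "subst \<iota> a f \<noteq> 0"
    using prime_ideal_has_point[OF J(1) assms(2), of UNIV f] J(3) polys_in_UNIV by auto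
  then show ?thesis
    using that[of a] J(2) polys_in_UNIV by blast
qed

section \<open>Commuting matrices over an algebraically closed field\<close>

definition poly_apply :: "'a::field^'n^'n \<Rightarrow> 'a poly \<Rightarrow> 'a^'n \<Rightarrow> 'a^'n" where
  "poly_apply A p w = (\<Sum>i\<le>Polynomial.degree p. Polynomial.coeff p i *s (((*v) A ^^ i) w))"

lemma poly_apply_superset:
  assumes "Polynomial.degree p \<le> N"
  shows "poly_apply A p w = (\<Sum>i\<le>N. Polynomial.coeff p i *s (((*v) A ^^ i) w))"
  unfolding poly_apply_def using assms
  by (intro sum.mono_neutral_left) (auto simp: coeff_eq_0 not_le)

lemma power_apply_diff:
  "((*v) A ^^ i) (A *v w - c *s w) = ((*v) A ^^ Suc i) w - c *s ((*v) A ^^ i) (w :: 'a::field^'n)"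
  by (induction i) (simp_all add: matrix_vector_mult_diff_distrib vector_scalar_commute)

lemma poly_apply_root:
  fixes A :: "'a::field^'n^'n"
  shows "poly_apply A ([:- c, 1:] * q) w = poly_apply A q (A *v w - c *s w)"
proof -
  define N where "N = Polynomial.degree q"
  define x where "x i = ((*v) A ^^ i) w" for i
  have deg: "Polynomial.degree ([:- c, 1:] * q) \<le> Suc N"
    using degree_mult_le[of "[:- c, 1:]" q] by (simp add: N_def)
  have coeff: "Polynomial.coeff ([:- c, 1:] * q) i =
      (case i of 0 \<Rightarrow> 0 | Suc i \<Rightarrow> Polynomial.coeff q i) - c * Polynomial.coeff q i" for i
    by (cases i) simp_all
  have last: "Polynomial.coeff q (Suc N) = 0"
    by (simp add: N_def coeff_eq_0)
  have "poly_apply A ([:- c, 1:] * q) w =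
      (\<Sum>i\<le>Suc N. (case i of 0 \<Rightarrow> 0 | Suc i \<Rightarrow> Polynomial.coeff q i) *s x i) - (\<Sum>i\<le>Suc N. (c * Polynomial.coeff q i) *s x i)"
    unfolding poly_apply_superset[OF deg] x_def[symmetric] coeff by (simp only: vec.scale_left_diff_distrib sum_subtractf)
  also have "(\<Sum>i\<le>Suc N. (case i of 0 \<Rightarrow> 0 | Suc i \<Rightarrow> Polynomial.coeff q i) *s x i) =
      (\<Sum>i\<le>N. Polynomial.coeff q i *s x (Suc i))"
    by (subst sum.atMost_Suc_shift) simp
  also have "(\<Sum>i\<le>Suc N. (c * Polynomial.coeff q i) *s x i) = (\<Sum>i\<le>N. Polynomial.coeff q i *s (c *s x i))"
    by (simp add: last mult.commute)
  also have "(\<Sum>i\<le>N. Polynomial.coeff q i *s x (Suc i)) - (\<Sum>i\<le>N. Polynomial.coeff q i *s (c *s x i)) =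
      (\<Sum>i\<le>N. Polynomial.coeff q i *s (x (Suc i) - c *s x i))"
    by (simp only: vec.scale_right_diff_distrib sum_subtractf)
  also have "\<dots> = poly_apply A q (A *v w - c *s w)"
    unfolding poly_apply_def N_def[symmetric] power_apply_diff x_def ..
  finally show ?thesis .
qed

lemma annihilating_poly:
  fixes A :: "'a::field^'n^'n"
  shows "\<exists>p. p \<noteq> 0 \<and> poly_apply A p w = 0"
proof -
  define x where "x i = ((*v) A ^^ i) w" for i
  define n where "n = CARD('n)"
  have sum_apply: "poly_apply A (\<Sum>i\<le>n. Polynomial.monom (c i) i) w = (\<Sum>i\<le>n. c i *s x i)" for c
  proof -
    have "Polynomial.degree (\<Sum>i\<le>n. Polynomial.monom (c i) i) \<le> n"
      by (rule degree_sum_le) (auto intro: order.trans[OF degree_monom_le])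
    moreover have "Polynomial.coeff (\<Sum>i\<le>n. Polynomial.monom (c i) i) j = (if j \<le> n then c j else 0)" for j
      by (simp add: Polynomial.coeff_sum)
    ultimately show ?thesis
      by (subst poly_apply_superset[where N = n]) (simp_all add: x_def)
  qed
  have "\<exists>c. (\<exists>i\<le>n. c i \<noteq> 0) \<and> (\<Sum>i\<le>n. c i *s x i) = 0"
  \<comment> \<open>Dependence is a property of the set of vectors, so a repetition among the n + 1
    iterates is turned into a relation by hand.\<close>
  proof (cases "inj_on x {..n}")
    case True
    then have "card (x ` {..n}) = Suc n"
      by (simp add: card_image)
    then have "vec.dependent (x ` {..n})"
      using vec.independent_card_le_dim[of "x ` {..n}" UNIV] by (auto simp: n_def vec.dim_UNIV card_cart_basis)
    then obtain u where u: "(\<Sum>v\<in>x ` {..n}. u v *s v) = 0" "\<exists>v\<in>x ` {..n}. u v \<noteq> 0"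
      by (auto simp: vec.dependent_finite)
    then have "(\<Sum>i\<le>n. u (x i) *s x i) = 0"
      by (simp add: sum.reindex[OF True])
    then show ?thesis
      using u(2) by (intro exI[of _ "u \<circ> x"]) auto
  next
    case False
    then obtain i j where ij: "i \<le> n" "j \<le> n" "i \<noteq> j" "x i = x j"
      by (auto simp: inj_on_def)
    define c where "c l = (if l = i then 1 else if l = j then - 1 else 0 :: 'a)" for l
    have "(\<Sum>l\<le>n. c l *s x l) = (\<Sum>l\<in>{i, j}. c l *s x l)"
      using ij by (intro sum.mono_neutral_right) (auto simp: c_def)
    also have "\<dots> = 0"
      using ij by (simp add: c_def)
    finally show ?thesis
      using ij by (intro exI[of _ c]) (auto simp: c_def)
  qed
  then obtain c i where c: "i \<le> n" "c i \<noteq> 0" "(\<Sum>i\<le>n. c i *s x i) = 0"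
    by blast
  have "Polynomial.coeff (\<Sum>i\<le>n. Polynomial.monom (c i) i) i = c i"
    using c(1) by (simp add: Polynomial.coeff_sum)
  then have "(\<Sum>i\<le>n. Polynomial.monom (c i) i) \<noteq> 0"
    using c(2) by auto
  then show ?thesis
    using sum_apply[of c] c(3) by auto
qed

text \<open>An eigenvector of the operator induced on U modulo W. Some polynomial in
  \<open>A\<close> maps \<open>w\<close> into \<open>W\<close>; its linear factors are applied to
  \<open>w\<close> one by one, and the last vector outside \<open>W\<close> is the one
  sought.\<close>

lemma relative_eigenvector:
  fixes A :: "'a::alg_closed_field^'n^'n"
  assumes U: "vec.subspace U" "\<And>x. x \<in> U \<Longrightarrow> A *v x \<in> U" and W: "vec.subspace W" and w: "w \<in> U - W"
  shows "\<exists>c. \<exists>v\<in>U - W. A *v v - c *s v \<in> W"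
proof -
  obtain p where p: "p \<noteq> 0" "poly_apply A p w \<in> W"
    using annihilating_poly[of A w] vec.subspace_0[OF W] by auto
  from p w show ?thesis
  proof (induction "Polynomial.degree p" arbitrary: p w)
    case 0
    then obtain a where a: "p = [:a:]" "a \<noteq> 0"
      by (metis degree_eq_zeroE pCons_0_0)
    have "inverse a *s (a *s w) \<in> W"
      by (rule vec.subspace_scale[OF W]) (use 0 a(1) in \<open>simp add: poly_apply_def\<close>)
    moreover have "inverse a *s (a *s w) = w"
      using a(2) by (simp only: vector_smult_assoc) simp
    ultimately show ?case
      using 0 by (metis DiffD2)
  next
    case (Suc d)
    then obtain c where "poly p c = 0"
      using alg_closed_imp_poly_has_root[of p] by auto
    then obtain q where q: "p = [:- c, 1:] * q"
      by (auto simp: poly_eq_0_iff_dvd elim: dvdE)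
    then have "q \<noteq> 0"
      using Suc.prems by auto
    then have "Polynomial.degree ([:- c, 1:] * q) = Suc (Polynomial.degree q)"
      by (subst degree_mult_eq) simp_all
    then have deg: "d = Polynomial.degree q"
      using Suc.hyps(2) unfolding q by linarith
    show ?case
    proof (cases "A *v w - c *s w \<in> W")
      case False
      have "A *v w - c *s w \<in> U - W"
        using False Suc.prems(3) U by (auto intro: vec.subspace_diff vec.subspace_scale)
      moreover have "poly_apply A q (A *v w - c *s w) \<in> W"
        using Suc.prems(2) by (simp only: q poly_apply_root)
      ultimately show ?thesis
        by (intro Suc.hyps(1)[OF deg \<open>q \<noteq> 0\<close>])
    qed (use Suc.prems in blast)
  qed
qed

text \<open>Among the stable subspaces strictly above \<open>W\<close> one of least dimension is
  taken. The vectors in it on which a given \<open>M k\<close> acts as a scalar modulo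
  \<open>W\<close> form a stable subspace, by commutation, and it is strictly above
  \<open>W\<close>; minimality makes it everything, for each k.\<close>

lemma common_relative_eigenvector:
  fixes M :: "'m \<Rightarrow> 'a::alg_closed_field^'n^'n"
  assumes comm: "\<And>k h. M k ** M h = M h ** M k"
    and W: "vec.subspace W" "\<And>k x. x \<in> W \<Longrightarrow> M k *v x \<in> W" "W \<noteq> UNIV"
  shows "\<exists>v. v \<notin> W \<and> (\<forall>k. \<exists>c. M k *v v - c *s v \<in> W)"
proof -
  define P where "P U \<longleftrightarrow> vec.subspace U \<and> W \<subset> U \<and> (\<forall>k. \<forall>x\<in>U. M k *v x \<in> U)" for U
  have "P UNIV"
    using W by (auto simp: P_def vec.subspace_UNIV)
  then obtain U where U: "P U" and min: "\<And>U'. P U' \<Longrightarrow> vec.dim U \<le> vec.dim U'"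
    using ex_has_least_nat[of P UNIV vec.dim] by blast
  obtain v where v: "v \<in> U - W"
    using U by (auto simp: P_def)
  have "\<exists>c. M k *v v - c *s v \<in> W" for k
  proof -
    obtain c w where w: "w \<in> U - W" "M k *v w - c *s w \<in> W"
      using relative_eigenvector[of U "M k" W v] U W(1) v by (auto simp: P_def)
    define U' where "U' = {x \<in> U. M k *v x - c *s x \<in> W}"
    have "vec.subspace U'"
      unfolding vec.subspace_def U'_def
    proof (intro conjI ballI allI)
      show "0 \<in> {x \<in> U. M k *v x - c *s x \<in> W}"
        using U W(1) by (simp add: P_def vec.subspace_0)
      fix x y assume xy: "x \<in> {x \<in> U. M k *v x - c *s x \<in> W}" "y \<in> {x \<in> U. M k *v x - c *s x \<in> W}"
      have "M k *v (x + y) - c *s (x + y) = (M k *v x - c *s x) + (M k *v y - c *s y)"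
        by (simp add: matrix_vector_right_distrib vec.scale_right_distrib)
      also have "\<dots> \<in> W"
        using xy by (intro vec.subspace_add[OF W(1)]) auto
      finally show "x + y \<in> {x \<in> U. M k *v x - c *s x \<in> W}"
        using xy U by (auto simp: P_def intro: vec.subspace_add)
    next
      fix a x assume x: "x \<in> {x \<in> U. M k *v x - c *s x \<in> W}"
      have "M k *v (a *s x) - c *s (a *s x) = a *s (M k *v x - c *s x)"
        by (simp add: vector_scalar_commute vec.scale_right_diff_distrib mult.commute)
      also have "\<dots> \<in> W"
        using x by (intro vec.subspace_scale[OF W(1)]) auto
      finally show "a *s x \<in> {x \<in> U. M k *v x - c *s x \<in> W}"
        using x U by (auto simp: P_def intro: vec.subspace_scale)
    qed
    moreover have "W \<subseteq> U'"
      using U W by (auto simp: P_def U'_def intro: vec.subspace_diff vec.subspace_scale)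
    then have "W \<subset> U'"
      using w by (auto simp: U'_def)
    moreover have "M h *v x \<in> U'" if x: "x \<in> U'" for h x
    proof -
      have "M k *v (M h *v x) - c *s (M h *v x) = M h *v (M k *v x - c *s x)"
        using comm[of k h] by (simp add: matrix_vector_mul_assoc matrix_vector_mult_diff_distrib vector_scalar_commute)
      then show ?thesis
        using x U W(2) by (auto simp: U'_def P_def)
    qed
    ultimately have "P U'"
      by (simp add: P_def)
    then have "vec.dim U \<le> vec.dim U'"
      by (rule min)
    then have "U' = U"
      using \<open>P U'\<close> U by (intro vec.subspace_dim_equal) (auto simp: P_def U'_def)
    then show ?thesis
      using v by (auto simp: U'_def)
  qed
  then show ?thesis
    using v by blast
qed

lemma flag_exists:
  fixes M :: "'m \<Rightarrow> 'a::alg_closed_field^'n^'n"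
  assumes comm: "\<And>k h. M k ** M h = M h ** M k" and "l \<le> CARD('n)"
  shows "\<exists>x :: nat \<Rightarrow> 'a^'n. \<forall>i<l. x i \<notin> vec.span (x ` {..<i}) \<and> (\<forall>k. M k *v x i \<in> vec.span (x ` {..i}))"
  using assms(2)
proof (induction l)
  case 0
  then show ?case
    by simp
next
  case (Suc l)
  then obtain x :: "nat \<Rightarrow> 'a^'n" where x: "\<And>i. i < l \<Longrightarrow> x i \<notin> vec.span (x ` {..<i})"
    "\<And>i k. i < l \<Longrightarrow> M k *v x i \<in> vec.span (x ` {..i})"
    by auto
  define W where "W = vec.span (x ` {..<l})"
  have "vec.subspace W"
    by (simp add: W_def)
  moreover have "M k *v y \<in> W" if y: "y \<in> W" for k y
    using y unfolding W_def
  proof (induction rule: vec.span_induct_alt)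
    case base
    then show ?case
      by (simp add: vec.span_zero)
  next
    case (step c y z)
    then obtain i where i: "i < l" "y = x i"
      by blast
    have "vec.span (x ` {..i}) \<subseteq> vec.span (x ` {..<l})"
      using i by (intro vec.span_mono) auto
    then have "M k *v y \<in> vec.span (x ` {..<l})"
      using x(2)[OF i(1)] i(2) by blast
    then show ?case
      using step by (simp add: matrix_vector_right_distrib vector_scalar_commute vec.span_add vec.span_scale)
  qed
  moreover have "W \<noteq> UNIV"
  proof
    assume "W = UNIV"
    then have "CARD('n) \<le> card (x ` {..<l})"
      using vec.dim_le_card[of UNIV "x ` {..<l}"] by (simp add: W_def vec.dim_UNIV card_cart_basis)
    also have "\<dots> \<le> l"
      using card_image_le[of "{..<l}" x] by simp
    finally show False
      using Suc.prems by simp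
  qed
  ultimately obtain v where v: "v \<notin> W" "\<And>k. \<exists>c. M k *v v - c *s v \<in> W"
    using common_relative_eigenvector[of M W, OF comm] by blast
  define x' where "x' = x(l := v)"
  have img: "x' ` {..<i} = x ` {..<i}" if "i \<le> l" for i
    using that by (auto simp: x'_def)
  have img': "x' ` {..i} = x ` {..i}" if "i < l" for i
    using that by (auto simp: x'_def)
  have "x' i \<notin> vec.span (x' ` {..<i}) \<and> (\<forall>k. M k *v x' i \<in> vec.span (x' ` {..i}))" if "i < Suc l" for i
  proof (cases "i = l")
    case True
    have W_sub: "W \<subseteq> vec.span (x' ` {..l})"
      unfolding W_def img[of l, simplified, symmetric] by (intro vec.span_mono) auto
    have "M k *v v \<in> vec.span (x' ` {..l})" for k
    proof -
      obtain c where c: "M k *v v - c *s v \<in> W"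
        using v(2) by blast
      have "v \<in> vec.span (x' ` {..l})"
        by (rule vec.span_base) (auto simp: x'_def image_iff intro!: bexI[of _ l])
      then have "(M k *v v - c *s v) + c *s v \<in> vec.span (x' ` {..l})"
        using c W_sub by (intro vec.span_add vec.span_scale) auto
      then show ?thesis
        by simp
    qed
    moreover have "x' l = v"
      by (simp add: x'_def)
    ultimately show ?thesis
      using v(1) True img[of l] by (simp add: W_def)
  next
    case False
    then have "i < l" "x' i = x i"
      using that by (simp_all add: x'_def)
    then show ?thesis
      using x img img' by simp
  qed
  then show ?case
    by blast
qed

text \<open>The columns of \<open>g\<close> are the vectors of a stable flag. The index type carries
  no order, so the numbering \<open>e\<close> of the columns supplies the one in which the
  conjugates are upper triangular and later the exponents of a torus element.\<close>

lemma simultaneous_triangularisation: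
  fixes M :: "'m \<Rightarrow> 'a::alg_closed_field^'n^'n"
  assumes comm: "\<And>k h. M k ** M h = M h ** M k"
  obtains g h :: "'a^'n^'n" and e :: "'n \<Rightarrow> nat"
    where "g ** h = mat 1" "h ** g = mat 1" "inj e" "\<And>k i j. e i > e j \<Longrightarrow> (h ** M k ** g) $ i $ j = 0"
proof -
  define n where "n = CARD('n)"
  obtain x :: "nat \<Rightarrow> 'a^'n" where x: "\<And>i. i < n \<Longrightarrow> x i \<notin> vec.span (x ` {..<i})"
    "\<And>i k. i < n \<Longrightarrow> M k *v x i \<in> vec.span (x ` {..i})"
    using flag_exists[where M = M and l = n, OF comm] by (auto simp: n_def)
  have indep: "vec.independent (x ` {..<l}) \<and> inj_on x {..<l}" if "l \<le> n" for l
    using that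
  proof (induction l)
    case (Suc l)
    then have *: "x l \<notin> vec.span (x ` {..<l})" "vec.independent (x ` {..<l})" "inj_on x {..<l}"
      using x by auto
    then have "x l \<notin> x ` {..<l}"
      using vec.span_superset[of "x ` {..<l}"] by (meson subsetD)
    moreover have "vec.independent (insert (x l) (x ` {..<l}))"
      using * by (intro vec.independent_insertI)
    ultimately show ?case
      using *(3) by (simp add: lessThan_Suc)
  qed (simp add: vec.independent_empty)
  have "UNIV \<subseteq> vec.span (x ` {..<n})"
  proof (rule vec.card_ge_dim_independent)
    show "vec.dim (UNIV :: ('a^'n) set) \<le> card (x ` {..<n})"
      using indep[of n] by (simp add: card_image n_def vec.dim_UNIV card_cart_basis)
  qed (use indep[of n] in auto)
  then have span: "vec.span (x ` {..<n}) = UNIV"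
    by blast
  obtain e where e: "bij_betw e (UNIV :: 'n set) {..<n}"
    using ex_bij_betw_finite_nat[of "UNIV :: 'n set"] by (auto simp: n_def atLeast0LessThan)
  define g :: "'a^'n^'n" where "g = (\<chi> i j. x (e j) $ i)"
  have col: "column j g = x (e j)" for j
    by (simp add: g_def column_def vec_eq_iff)
  have "columns g = x ` {..<n}"
  proof -
    have "columns g = (\<lambda>j. x (e j)) ` UNIV"
      by (auto simp: columns_def col)
    also have "\<dots> = x ` (e ` UNIV)"
      by (simp add: image_image)
    finally show ?thesis
      using e by (simp add: bij_betw_def)
  qed
  then obtain h where h: "g ** h = mat 1"
    using matrix_right_invertible_span_columns[of g] span by auto
  then have hg: "h ** g = mat 1"
    using matrix_left_right_inverse by blast
  have hx: "(h *v x (e j)) $ i = of_bool (i = j)" for i j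
  proof -
    have "(h *v column j g) $ i = (h ** g) $ i $ j"
      by (simp add: matrix_vector_mult_def matrix_matrix_mult_def column_def)
    then show ?thesis
      by (simp add: hg col mat_def)
  qed
  have zero: "(h *v y) $ i = 0" if "y \<in> vec.span (x ` {..d})" "d < e i" for y d i
    using that(1)
  proof (induction rule: vec.span_induct_alt)
    case base
    then show ?case
      by simp
  next
    case (step c y z)
    then obtain b where b: "b \<le> d" "y = x b"
      by blast
    have "e i < n"
      using e by (auto simp: bij_betw_def)
    then have "b \<in> e ` UNIV"
      using b that(2) e by (simp add: bij_betw_def)
    then obtain j where j: "b = e j"
      by blast
    then have "i \<noteq> j"
      using b that(2) by auto
    then have "(h *v y) $ i = 0"
      by (simp add: b j hx)
    then show ?case
      using step by (simp add: matrix_vector_right_distrib vector_scalar_commute)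
  qed
  have "(h ** M k ** g) $ i $ j = 0" if "e i > e j" for k i j
  proof -
    have "(h ** M k ** g) $ i $ j = (h *v (M k *v column j g)) $ i"
      by (simp add: matrix_vector_mul_assoc) (simp add: matrix_vector_mult_def matrix_matrix_mult_def column_def)
    also have "\<dots> = 0"
    proof (rule zero[OF _ that])
      have "e j < n"
        using e by (auto simp: bij_betw_def)
      then show "M k *v column j g \<in> vec.span (x ` {..e j})"
        using x(2) by (simp add: col)
    qed
    finally show ?thesis .
  qed
  moreover have "inj e"
    using e by (simp add: bij_betw_def)
  ultimately show ?thesis
    using that h hg by blast
qed

section \<open>Points of the commuting scheme\<close>

definition eval_at :: "('k \<Rightarrow> 'b::comm_ring_1) \<Rightarrow> ('m \<Rightarrow> 'b^'n^'n) \<Rightarrow> ('n::finite, 'm::finite, 'k::comm_ring_1) gen_poly \<Rightarrow> 'b" where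
  "eval_at \<iota> M = subst \<iota> (\<lambda>(k, i, j). M k $ i $ j)"

lemma eval_at_rhom: "rhom \<iota> \<Longrightarrow> rhom (eval_at \<iota> M)"
  unfolding eval_at_def by (rule subst_rhom)

lemma eval_at_generic: "rhom \<iota> \<Longrightarrow> map_matrix (eval_at \<iota> M) (generic_matrix k) = M k"
  by (simp add: vec_eq_iff generic_matrix_def eval_at_def)

lemma eval_at_Const: "rhom \<iota> \<Longrightarrow> eval_at \<iota> M (Const c) = \<iota> c"
  by (simp add: eval_at_def)

lemma gen_poly_hom_eqI:
  fixes \<phi> \<psi> :: "('n::finite, 'm::finite, 'k::comm_ring_1) gen_poly \<Rightarrow> 'b::comm_ring_1"
  assumes "rhom \<phi>" "rhom \<psi>" "\<And>c. \<phi> (Const c) = \<psi> (Const c)"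
    "\<And>k. map_matrix \<phi> (generic_matrix k) = map_matrix \<psi> (generic_matrix k)"
  shows "\<phi> = \<psi>"
proof (rule mpoly_hom_eqI[OF assms(1-3)])
  fix v :: "'m \<times> 'n \<times> 'n"
  obtain k i j where v: "v = (k, i, j)"
    by (cases v)
  have "map_matrix \<phi> (generic_matrix k) $ i $ j = map_matrix \<psi> (generic_matrix k) $ i $ j"
    by (simp only: assms(4))
  then show "\<phi> (Var v) = \<psi> (Var v)"
    by (simp add: v generic_matrix_def)
qed

lemma eval_at_GL_act:
  fixes f :: "('n::finite, 'm::finite, 'k::comm_ring_1) gen_poly"
  assumes "rhom \<iota>"
  shows "eval_at \<iota> M (GL_act g f) = eval_at \<iota> (\<lambda>k. map_matrix \<iota> (matrix_inv g) ** M k ** map_matrix \<iota> g) f"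
proof -
  note e = eval_at_rhom[OF assms, of M]
  have const: "map_matrix (eval_at \<iota> M) (map_matrix Const A) = map_matrix \<iota> A" for A :: "'k^'n^'n"
    by (simp add: vec_eq_iff eval_at_Const[OF assms])
  have "eval_at \<iota> M \<circ> GL_act g = eval_at \<iota> (\<lambda>k. map_matrix \<iota> (matrix_inv g) ** M k ** map_matrix \<iota> g)"
    by (rule gen_poly_hom_eqI)
      (simp_all add: rhom_comp GL_act_rhom eval_at_rhom assms eval_at_Const eval_at_generic GL_act_generic
        rhom.map_matrix_mult[OF e] const flip: map_matrix_map_matrix)
  then show ?thesis
    by (metis comp_apply)
qed

lemma eval_at_diag:
  fixes f :: "('n::finite, 'm::finite, 'k::comm_ring_1) gen_poly"
  assumes "rhom \<iota>"
  shows "eval_at \<iota> (\<lambda>k. diag_mat (d k)) f = subst \<iota> (\<lambda>(i, k). d k i) (Delta f)"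
proof -
  note s = subst_rhom[OF assms, of "\<lambda>(i, k). d k i"]
  have "eval_at \<iota> (\<lambda>k. diag_mat (d k)) = subst \<iota> (\<lambda>(i, k). d k i) \<circ> (Delta :: ('n, 'm, 'k) gen_poly \<Rightarrow> _)"
  proof (rule gen_poly_hom_eqI)
    show "map_matrix (eval_at \<iota> (\<lambda>k. diag_mat (d k))) (generic_matrix k) =
        map_matrix (subst \<iota> (\<lambda>(i, k). d k i) \<circ> Delta) (generic_matrix k :: ('n, 'm, 'k) gen_poly^'n^'n)" for k
      unfolding map_matrix_map_matrix[symmetric] Delta_generic eval_at_generic[OF assms]
      by (simp add: vec_eq_iff diag_mat_def assms rhom.zero[OF s])
  qed (simp_all add: rhom_comp eval_at_rhom Delta_rhom s assms eval_at_Const)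
  then show ?thesis
    by (metis comp_apply)
qed

text \<open>\<open>h\<close> is a rational function with a power of \<open>d\<close> as denominator.
  Values at zeros of \<open>d\<close> are left free, so the entries of \<open>matrix_inv\<close>
  qualify even where the matrix is singular.\<close>

definition rational_in :: "'b::field poly \<Rightarrow> ('b \<Rightarrow> 'b) \<Rightarrow> bool" where
  "rational_in d h \<longleftrightarrow> (\<exists>N p. \<forall>s. poly d s \<noteq> 0 \<longrightarrow> poly d s ^ N * h s = poly p s)"

lemma rational_in_const: "rational_in d (\<lambda>_. c)"
  unfolding rational_in_def by (intro exI[of _ 0] exI[of _ "[:c:]"]) simp

lemma rational_in_add:
  assumes "rational_in d h" "rational_in d h'"
  shows "rational_in d (\<lambda>s. h s + h' s)"
proof -
  obtain N p N' p' where np: "\<And>s. poly d s \<noteq> 0 \<Longrightarrow> poly d s ^ N * h s = poly p s"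
    "\<And>s. poly d s \<noteq> 0 \<Longrightarrow> poly d s ^ N' * h' s = poly p' s"
    using assms unfolding rational_in_def by blast
  then have "poly d s ^ (N + N') * (h s + h' s) = poly (d ^ N' * p + d ^ N * p') s" if "poly d s \<noteq> 0" for s
    by (simp add: np[OF that, symmetric] power_add algebra_simps)
  then show ?thesis
    unfolding rational_in_def by blast
qed

lemma rational_in_mult:
  assumes "rational_in d h" "rational_in d h'"
  shows "rational_in d (\<lambda>s. h s * h' s)"
proof -
  obtain N p N' p' where np: "\<And>s. poly d s \<noteq> 0 \<Longrightarrow> poly d s ^ N * h s = poly p s"
    "\<And>s. poly d s \<noteq> 0 \<Longrightarrow> poly d s ^ N' * h' s = poly p' s"
    using assms unfolding rational_in_def by blast
  then have "poly d s ^ (N + N') * (h s * h' s) = poly (p * p') s" if "poly d s \<noteq> 0" for s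
    by (simp add: np[OF that, symmetric] power_add mult_ac)
  then show ?thesis
    unfolding rational_in_def by blast
qed

lemma rational_in_sum: "(\<And>i. i \<in> S \<Longrightarrow> rational_in d (h i)) \<Longrightarrow> rational_in d (\<lambda>s. \<Sum>i\<in>S. h i s)"
  by (induction S rule: infinite_finite_induct) (simp_all add: rational_in_const rational_in_add)

lemma rational_in_poly: "rational_in d (poly p)"
  unfolding rational_in_def by (intro exI[of _ 0] exI[of _ p]) simp

lemma rational_in_eval_at:
  fixes f :: "('n::finite, 'm::finite, 'k::comm_ring_1) gen_poly" and M :: "'b \<Rightarrow> 'm \<Rightarrow> 'b::field^'n^'n"
  assumes \<iota>: "rhom \<iota>" and "\<And>k i j. rational_in d (\<lambda>s. M s k $ i $ j)"
  shows "rational_in d (\<lambda>s. eval_at \<iota> (M s) f)"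
proof (induction f rule: mpoly_induct)
  case (Const c)
  then show ?case
    by (simp add: eval_at_Const[OF \<iota>] rational_in_const)
next
  case (add p q)
  then show ?case
    by (simp add: rhom.add[OF eval_at_rhom[OF \<iota>]] rational_in_add)
next
  case (Var p v)
  obtain k i j where "v = (k, i, j)"
    by (cases v)
  then have "eval_at \<iota> (M s) (Var v) = M s k $ i $ j" for s
    by (simp add: eval_at_def \<iota>)
  then show ?case
    using rational_in_mult[OF Var assms(2)[of k i j]] by (simp add: rhom.mult[OF eval_at_rhom[OF \<iota>]])
qed

text \<open>After clearing denominators, \<open>p\<close> and c times a power of \<open>d\<close>
  are polynomials that agree at infinitely many points.\<close>

lemma rational_in_eq_const:
  assumes "rational_in d h" "infinite {s. poly d s \<noteq> 0 \<and> h s = c}" "poly d s \<noteq> 0"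
  shows "h s = c"
proof -
  obtain N p where p: "\<And>s. poly d s \<noteq> 0 \<Longrightarrow> poly d s ^ N * h s = poly p s"
    using assms(1) unfolding rational_in_def by blast
  have "{s. poly d s \<noteq> 0 \<and> h s = c} \<subseteq> {s. poly (p - Polynomial.smult c (d ^ N)) s = 0}"
    by (auto simp: p[symmetric])
  then have "p - Polynomial.smult c (d ^ N) = 0"
    using assms(2) poly_roots_finite finite_subset by blast
  then have "poly p s = c * poly d s ^ N"
    by (metis diff_eq_eq add_0 poly_smult poly_power)
  then show ?thesis
    using p[OF assms(3)] assms(3) by simp
qed

text \<open>Cramer's rule. It shows that the entries of the inverse are rational in the entries of
  \<open>g\<close> with the determinant as denominator.\<close>

lemma inverse_entry_det:
  fixes g h :: "'b::field^'n^'n"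
  assumes "g ** h = mat 1"
  shows "h $ i $ j * det g = det (\<chi> a b. if b = i then of_bool (a = j) else g $ a $ b)"
proof -
  have "(g *v column j h) $ a = of_bool (a = j)" for a
  proof -
    have "(g *v column j h) $ a = (g ** h) $ a $ j"
      by (simp add: matrix_vector_mult_def matrix_matrix_mult_def column_def)
    then show ?thesis
      by (simp add: assms mat_def)
  qed
  then have "(\<chi> a b. if b = i then (g *v column j h) $ a else g $ a $ b) =
      (\<chi> a b. if b = i then of_bool (a = j) else g $ a $ b)"
    by (simp add: vec_eq_iff)
  then show ?thesis
    using cramer_lemma[of i g "column j h"] by (simp add: column_def)
qed

text \<open>
  Invariance under \<open>GL(n, \<kappa>)\<close> implies invariance under \<open>GL(n)\<close> of an extension field: the entries
  of \<open>g\<close> are released one at a time, each time comparing rational functions on an infinite set.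
\<close>
lemma eval_at_invariant:
  fixes f :: "('n::finite, 'm::finite, 'k::field) gen_poly" and \<iota> :: "'k \<Rightarrow> 'b::field"
  assumes \<iota>: "rhom \<iota>" and inf: "infinite (UNIV :: 'k set)"
    and inv: "\<And>g :: 'k^'n^'n. g \<in> GL \<Longrightarrow>
      eval_at \<iota> (\<lambda>k. map_matrix \<iota> (matrix_inv g) ** M k ** map_matrix \<iota> g) f = c"
    and "g ** h = mat 1"
  shows "eval_at \<iota> (\<lambda>k. h ** M k ** g) f = c"
proof -
  have inj: "inj \<iota>"
  proof (rule injI)
    fix a b assume ab: "\<iota> a = \<iota> b"
    show "a = b"
    proof (rule ccontr)
      assume "a \<noteq> b"
      then have "\<iota> ((a - b) * inverse (a - b)) = 1"
        by (simp add: rhom.one[OF \<iota>])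
      then show False
        using ab by (simp add: rhom.mult[OF \<iota>] rhom.diff[OF \<iota>])
    qed
  qed
  have main: "eval_at \<iota> (\<lambda>k. h ** M k ** g) f = c"
    if "finite S" "\<And>i j. (i, j) \<notin> S \<Longrightarrow> g $ i $ j \<in> range \<iota>" "g ** h = mat 1" for S and g h :: "'b^'n^'n"
    using that
  proof (induction S arbitrary: g h rule: finite_induct)
    case empty
    define g0 :: "'k^'n^'n" where "g0 = (\<chi> i j. inv \<iota> (g $ i $ j))"
    have g: "g = map_matrix \<iota> g0"
      using empty(1) by (simp add: g0_def vec_eq_iff f_inv_into_f)
    have "det g \<noteq> 0"
      using arg_cong[OF empty(2), of det] by (auto simp: det_mul)
    then have "det g0 \<noteq> 0"
      using rhom.det[OF \<iota>, of g0] by (auto simp: g rhom.zero[OF \<iota>])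
    then have g0: "g0 \<in> GL"
      by (simp add: GL_def invertible_det_nz)
    have "map_matrix \<iota> (matrix_inv g0) ** map_matrix \<iota> g0 = mat 1"
      by (simp add: rhom.map_matrix_mult[OF \<iota>, symmetric] rhom.map_matrix_one[OF \<iota>] matrix_inv_GL[OF g0])
    then have "map_matrix \<iota> (matrix_inv g0) = h"
      using empty(2) g by (metis matrix_mul_assoc matrix_mul_lid matrix_mul_rid)
    then show ?case
      using inv[OF g0] g by simp
  next
    case (insert x S)
    obtain i0 j0 where x: "x = (i0, j0)"
      by (cases x)
    \<comment> \<open>The released entry becomes an indeterminate. The determinant \<open>d\<close>
      of this matrix is a nonzero polynomial, since its value at the original entry is
      \<open>det g\<close>.\<close>
    define P :: "'b poly^'n^'n" where "P = (\<chi> i j. if i = i0 \<and> j = j0 then [:0, 1:] else [:g $ i $ j:])"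
    define G where "G s = map_matrix (\<lambda>p. poly p s) P" for s
    define d where "d = det P"
    have Gnth: "G s $ i $ j = (if i = i0 \<and> j = j0 then s else g $ i $ j)" for s i j
      by (simp add: G_def P_def)
    have d: "poly d s = det (G s)" for s
      by (simp add: d_def G_def rhom.det[OF poly_rhom])
    define H where "H s = matrix_inv (G s)" for s
    have GH: "G s ** H s = mat 1" if "poly d s \<noteq> 0" for s
      using that matrix_inv_GL(1)[of "G s"] by (simp add: H_def d GL_def invertible_det_nz)
    have G0: "G (g $ i0 $ j0) = g"
      by (simp add: vec_eq_iff Gnth)
    have d0: "poly d (g $ i0 $ j0) \<noteq> 0"
      using arg_cong[OF insert.prems(2), of det] by (auto simp: d G0 det_mul)
    have H0: "H (g $ i0 $ j0) = h"
      using GH[OF d0] insert.prems(2) matrix_left_right_inverse[of g h]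
      by (metis G0 matrix_mul_assoc matrix_mul_lid matrix_mul_rid)
    have ratH: "rational_in d (\<lambda>s. H s $ i $ j)" for i j
    proof -
      define Q :: "'b poly^'n^'n" where "Q = (\<chi> a b. if b = i then of_bool (a = j) else P $ a $ b)"
      have "map_matrix (\<lambda>p. poly p s) Q = (\<chi> a b. if b = i then of_bool (a = j) else G s $ a $ b)" for s
        by (simp add: vec_eq_iff Q_def G_def)
      then have "poly d s ^ 1 * H s $ i $ j = poly (det Q) s" if "poly d s \<noteq> 0" for s
        using inverse_entry_det[OF GH[OF that], of i j] rhom.det[OF poly_rhom[of s], of Q] by (simp add: d mult.commute)
      then show ?thesis
        unfolding rational_in_def by blast
    qed
    have ratG: "rational_in d (\<lambda>s. G s $ i $ j)" for i j
      using rational_in_poly[of d "P $ i $ j"] by (simp add: G_def)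
    have "rational_in d (\<lambda>s. (H s ** M k ** G s) $ i $ j)" for k i j
      unfolding matrix_matrix_mult_def
      by (simp add: rational_in_sum rational_in_mult rational_in_const ratH ratG)
    then have "rational_in d (\<lambda>s. eval_at \<iota> (\<lambda>k. H s ** M k ** G s) f)"
      by (intro rational_in_eval_at[OF \<iota>])
    moreover have "infinite {s. poly d s \<noteq> 0 \<and> eval_at \<iota> (\<lambda>k. H s ** M k ** G s) f = c}"
    proof -
      \<comment> \<open>For s in the small field the entry is no longer exceptional, so the
        induction hypothesis applies; there are infinitely many such s, and all but finitely many
        give an invertible matrix.\<close>
      have "eval_at \<iota> (\<lambda>k. H s ** M k ** G s) f = c" if s: "s \<in> range \<iota>" "poly d s \<noteq> 0" for s
      proof (rule insert.IH[OF _ GH[OF s(2)]])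
        show "G s $ i $ j \<in> range \<iota>" if "(i, j) \<notin> S" for i j
          using that s(1) insert.prems(1)[of i j] by (auto simp: Gnth x)
      qed
      then have "range \<iota> - {s. poly d s = 0} \<subseteq> {s. poly d s \<noteq> 0 \<and> eval_at \<iota> (\<lambda>k. H s ** M k ** G s) f = c}"
        by auto
      moreover have "d \<noteq> 0"
        using d0 by auto
      then have "infinite (range \<iota> - {s. poly d s = 0})"
        using inf inj by (intro Diff_infinite_finite poly_roots_finite) (simp_all add: finite_image_iff)
      ultimately show ?thesis
        using finite_subset by blast
    qed
    ultimately have "eval_at \<iota> (\<lambda>k. H (g $ i0 $ j0) ** M k ** G (g $ i0 $ j0)) f = c"
      using d0 by (rule rational_in_eq_const)
    then show ?case
      by (simp add: G0 H0)
  qed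
  show ?thesis
    using main[of UNIV g h] assms(4) by simp
qed

text \<open>A triangular tuple degenerates to its diagonal under the torus elements \<open>diag (s\<^sup>e\<^sup>(\<^sup>i\<^sup>))\<close>.\<close>
lemma eval_at_triangular:
  fixes f :: "('n::finite, 'm::finite, 'k::field) gen_poly" and \<iota> :: "'k \<Rightarrow> 'b::field" and e :: "'n \<Rightarrow> nat"
  assumes \<iota>: "rhom \<iota>" and inf: "infinite (UNIV :: 'b set)"
    and inv: "\<And>g h. g ** h = mat 1 \<Longrightarrow> eval_at \<iota> (\<lambda>k. h ** U k ** g) f = c"
    and "inj e" and upper: "\<And>k i j. e i > e j \<Longrightarrow> U k $ i $ j = 0"
    and "Delta f = 0"
  shows "c = 0"
proof -
  \<comment> \<open>Conjugation by the torus element multiplies the entry (i, j) by s to the power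
    \<open>e j - e i\<close>. For a triangular tuple negative powers meet only zero entries, so the
    expression makes sense at s = 0 as well.\<close>
  define T :: "'b \<Rightarrow> 'm \<Rightarrow> 'b^'n^'n" where "T s k = (\<chi> i j. if e i \<le> e j then U k $ i $ j * s ^ (e j - e i) else 0)" for s k
  have "eval_at \<iota> (T s) f = c" if "s \<noteq> 0" for s
  proof -
    define g h :: "'b^'n^'n" where "g = diag_mat (\<lambda>i. s ^ e i)" and "h = diag_mat (\<lambda>i. inverse s ^ e i)"
    have gh: "g ** h = mat 1"
      using that by (simp add: g_def h_def diag_mat_mult diag_mat_one flip: power_mult_distrib)
    have "(h ** U k ** g) $ i $ j = T s k $ i $ j" for k i j
    proof -
      have left: "(diag_mat a ** A) $ i $ j = a i * A $ i $ j" and right: "(A ** diag_mat a) $ i $ j = A $ i $ j * a j"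
        for a :: "'n \<Rightarrow> 'b" and A :: "'b^'n^'n" and i j
        by (simp_all add: diag_mat_def matrix_matrix_mult_def if_distrib[of "\<lambda>x. x * _"] if_distrib[of "\<lambda>x. _ * x"] cong: if_cong)
      have "inverse s ^ e i * s ^ e j = s ^ (e j - e i)" if "e i \<le> e j"
        using that \<open>s \<noteq> 0\<close> by (simp add: power_diff power_inverse field_simps)
      then show ?thesis
        using upper[of j i k] by (auto simp: g_def h_def left right T_def not_le mult_ac)
    qed
    then have "(\<lambda>k. h ** U k ** g) = T s"
      by (simp add: fun_eq_iff vec_eq_iff)
    then show ?thesis
      using inv[OF gh] by simp
  qed
  then have "- {0} \<subseteq> {s. poly 1 s \<noteq> 0 \<and> eval_at \<iota> (T s) f = c}"
    by auto
  then have "infinite {s. poly 1 s \<noteq> 0 \<and> eval_at \<iota> (T s) f = c}"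
    using infinite_remove[OF inf, of 0] by (auto simp: Compl_eq_Diff_UNIV dest: infinite_super)
  moreover have "rational_in 1 (\<lambda>s. eval_at \<iota> (T s) f)"
  proof (rule rational_in_eval_at[OF \<iota>])
    fix k i j
    show "rational_in 1 (\<lambda>s. T s k $ i $ j)"
      using rational_in_poly[of 1 "Polynomial.monom (U k $ i $ j) (e j - e i)"] rational_in_const[of 1 0]
      by (cases "e i \<le> e j") (simp_all add: T_def poly_monom[abs_def])
  qed
  ultimately have "eval_at \<iota> (T 0) f = c"
    by (intro rational_in_eq_const[where d = 1]) simp_all
  \<comment> \<open>At s = 0 only the entries with \<open>e i = e j\<close> survive, and these are
    the diagonal ones because \<open>e\<close> is injective.\<close>
  moreover have "T 0 = (\<lambda>k. diag_mat (\<lambda>i. U k $ i $ i))"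
    using \<open>inj e\<close> by (auto simp: T_def diag_mat_def vec_eq_iff power_0_left fun_eq_iff dest: injD)
  ultimately show "c = 0"
    by (simp add: eval_at_diag[OF \<iota>] \<open>Delta f = 0\<close> rhom.zero[OF subst_rhom[OF \<iota>]])
qed

lemma to_ac_rhom: "rhom to_ac"
  by unfold_locales simp_all

theorem Delta_kernel_of_invariants_reduced:
  fixes f :: "('n::finite, 'm::finite, 'k::field) gen_poly"
  assumes inf: "infinite (UNIV :: 'k set)"
    and inv: "\<And>g. g \<in> GL \<Longrightarrow> \<exists>r :: nat. (GL_act g f - f) ^ r \<in> comm_ideal"
    and "Delta f = 0"
  shows "\<exists>r :: nat. f ^ r \<in> comm_ideal"
proof (rule ccontr)
  assume "\<not> ?thesis"
  then obtain a :: "'m \<times> 'n \<times> 'n \<Rightarrow> 'k alg_closure" where a: "\<And>q. q \<in> comm_ideal \<Longrightarrow> subst to_ac a q = 0" "subst to_ac a f \<noteq> 0"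
    using nullstellensatz[OF comm.type_ideal_axioms to_ac_rhom] by metis
  define M where "M k = (\<chi> i j. a (k, i, j))" for k
  have a_eq: "subst to_ac a = eval_at to_ac M"
    by (simp add: eval_at_def M_def fun_eq_iff split_def)
  have comm: "M k ** M h = M h ** M k" for k h
  proof -
    note ev = eval_at_rhom[OF to_ac_rhom, of M]
    have "(M k ** M h - M h ** M k) $ i $ j = 0" for i j
    proof -
      have "map_matrix (eval_at to_ac M) (generic_matrix k ** generic_matrix h - generic_matrix h ** generic_matrix k) =
          M k ** M h - M h ** M k"
        by (simp add: rhom.map_matrix_diff[OF ev] rhom.map_matrix_mult[OF ev] eval_at_generic[OF to_ac_rhom])
      from arg_cong[OF this, of "\<lambda>A. A $ i $ j"] show ?thesis
        using a(1)[OF commutator_in_comm_ideal[of k h i j]] by (simp only: a_eq map_matrix_nth)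
    qed
    then show ?thesis
      by (simp add: vec_eq_iff)
  qed
  have vanish: "eval_at to_ac M' q = 0" if "q \<in> comm_ideal" "\<And>k h. M' k ** M' h = M' h ** M' k"
    for M' :: "'m \<Rightarrow> 'k alg_closure^'n^'n" and q
    by (rule rhom_vanishes_on_comm_ideal[OF eval_at_rhom[OF to_ac_rhom] that(1)])
      (simp add: eval_at_generic[OF to_ac_rhom] that(2))
  define c where "c = eval_at to_ac M f"
  have inv_base: "eval_at to_ac (\<lambda>k. map_matrix to_ac (matrix_inv g) ** M k ** map_matrix to_ac g) f = c"
    if g: "g \<in> GL" for g
  proof -
    obtain r where "(GL_act g f - f) ^ r \<in> comm_ideal"
      using inv[OF g] by blast
    then have "eval_at to_ac M ((GL_act g f - f) ^ r) = 0"
      by (rule vanish) (rule comm)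
    \<comment> \<open>The values lie in a field, so the vanishing of the power gives the vanishing
      of its base.\<close>
    then have "eval_at to_ac M (GL_act g f) = eval_at to_ac M f"
      by (simp add: rhom.power[OF eval_at_rhom[OF to_ac_rhom]] rhom.diff[OF eval_at_rhom[OF to_ac_rhom]])
    then show ?thesis
      by (simp add: eval_at_GL_act[OF to_ac_rhom] c_def)
  qed
  have inv_all: "eval_at to_ac (\<lambda>k. h ** M k ** g) f = c" if "g ** h = mat 1" for g h :: "'k alg_closure^'n^'n"
    by (rule eval_at_invariant[OF to_ac_rhom inf inv_base that])
  have "c = 0"
  proof (rule simultaneous_triangularisation[of M, OF comm])
    fix g h :: "'k alg_closure^'n^'n" and e :: "'n \<Rightarrow> nat"
    assume tri: "g ** h = mat 1" "h ** g = mat 1" "inj e"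
      and upper: "\<And>k i j. e i > e j \<Longrightarrow> (h ** M k ** g) $ i $ j = 0"
    show ?thesis
    proof (rule eval_at_triangular[OF to_ac_rhom _ _ tri(3)])
      have "inj (to_ac :: 'k \<Rightarrow> 'k alg_closure)"
        by (auto intro!: injI)
      then show "infinite (UNIV :: 'k alg_closure set)"
        using inf finite_imageD[of to_ac UNIV] finite_subset[OF subset_UNIV, of "range to_ac"] by blast
      show "eval_at to_ac (\<lambda>k. h' ** (h ** M k ** g) ** g') f = c" if "g' ** h' = mat 1" for g' h'
      proof -
        have "(g ** g') ** (h' ** h) = g ** (g' ** h') ** h"
          by (simp add: matrix_mul_assoc)
        then have "(g ** g') ** (h' ** h) = mat 1"
          by (simp add: that tri(1))
        from inv_all[OF this] show ?thesis
          by (simp add: matrix_mul_assoc)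
      qed
    qed (use upper assms(3) in auto)
  qed
  then show False
    using a(2) by (simp add: a_eq c_def)
qed

section \<open>Symmetric tensors\<close>

interpretation tens: type_ideal "multilinear_ideal :: ('n::finite, 'm::finite, 'k::comm_ring_1) families set"
proof (rule type_ideal.intro)
  interpret R: cring "type_ring :: ('n, 'm, 'k) families ring"
    by (rule type_ring_cring)
  show "ideal (multilinear_ideal :: ('n, 'm, 'k) families set) type_ring"
    unfolding multilinear_ideal_def families_ring_def by (rule R.genideal_ideal) simp
qed

lemma pure_add_mem:
    "(pure (f(i := p + q)) - (pure (f(i := p)) + pure (f(i := q))) :: ('n::finite, 'm::finite, 'k::comm_ring_1) families)
      \<in> multilinear_ideal"
  and pure_scale_mem:
    "(pure (f(i := Const c * p)) - Const c * pure (f(i := p)) :: ('n, 'm, 'k) families) \<in> multilinear_ideal"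
proof -
  interpret R: cring "type_ring :: ('n, 'm, 'k) families ring"
    by (rule type_ring_cring)
  show "(pure (f(i := p + q)) - (pure (f(i := p)) + pure (f(i := q))) :: ('n, 'm, 'k) families) \<in> multilinear_ideal"
    unfolding multilinear_ideal_def families_ring_def by (rule subsetD[OF R.genideal_self], simp) blast
  show "(pure (f(i := Const c * p)) - Const c * pure (f(i := p)) :: ('n, 'm, 'k) families) \<in> multilinear_ideal"
    unfolding multilinear_ideal_def families_ring_def by (rule subsetD[OF R.genideal_self], simp) blast
qed

lemma multilinear_ideal_least:
  fixes J :: "('n::finite, 'm::finite, 'k::comm_ring_1) families set"
  assumes "type_ideal J"
    "\<And>f i p q. pure (f(i := p + q)) - (pure (f(i := p)) + pure (f(i := q))) \<in> J"
    "\<And>f i c p. pure (f(i := Const c * p)) - Const c * pure (f(i := p)) \<in> J"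
    "x \<in> multilinear_ideal"
  shows "x \<in> J"
proof -
  interpret R: cring "type_ring :: ('n, 'm, 'k) families ring"
    by (rule type_ring_cring)
  have "multilinear_ideal \<subseteq> J"
    unfolding multilinear_ideal_def families_ring_def
    by (rule R.genideal_minimal) (use assms(1,2,3) in \<open>auto simp: type_ideal_def\<close>)
  with assms(4) show ?thesis
    by blast
qed

definition factor :: "'n \<Rightarrow> ('m, 'k::comm_ring_1) mpoly \<Rightarrow> ('n::finite, 'm::finite, 'k) diag_poly" where
  "factor i = subst Const (\<lambda>k. Var (i, k))"

lemma factor_rhom: "rhom (factor i)"
  unfolding factor_def by (rule subst_rhom[OF Const_rhom])

lemma factor_Const: "factor i (Const c) = Const c"
  and factor_Var: "factor i (Var k) = Var (i, k)"
  by (simp_all add: factor_def Const_rhom)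

text \<open>\<open>to_tensor\<close> before the passage to cosets. It is a homomorphism into the
  monoid algebra, which permits the use of the induction principles for polynomials.\<close>

definition tensor_of :: "('n::finite, 'm::finite, 'k::comm_ring_1) diag_poly \<Rightarrow> ('n, 'm, 'k) families" where
  "tensor_of = subst Const (\<lambda>(i, k). pure ((\<lambda>_. 1)(i := Var k)))"

lemma tensor_of_rhom: "rhom tensor_of"
  unfolding tensor_of_def by (rule subst_rhom[OF Const_rhom])

lemma tensor_of_Const: "tensor_of (Const c) = Const c"
  and tensor_of_Var: "tensor_of (Var (i, k)) = pure ((\<lambda>_. 1)(i := Var k))"
  by (simp_all add: tensor_of_def Const_rhom)

text \<open>A pure tensor goes to the product over i of its factors, the i-th one written in the
  variables of row i. It is a left inverse of \<open>tensor_of\<close>, and a right inverse modulo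
  the multilinearity relations.\<close>

definition of_tensor :: "('n::finite, 'm::finite, 'k::comm_ring_1) families \<Rightarrow> ('n, 'm, 'k) diag_poly" where
  "of_tensor = lift Const (\<lambda>s. \<Prod>i\<in>UNIV. factor i (entry s i))"

lemma of_tensor_rhom: "rhom of_tensor"
  unfolding of_tensor_def
  by (rule lift_rhom[OF Const_rhom])
    (simp_all add: zero_family_def plus_family_def rhom.one[OF factor_rhom] rhom.mult[OF factor_rhom] prod.distrib)

lemma of_tensor_Const: "of_tensor (Const c) = Const c"
  by (simp add: of_tensor_def Const_def[of c] lift_single zero_family_def rhom.one[OF factor_rhom])

lemma of_tensor_pure: "of_tensor (pure f) = (\<Prod>i\<in>UNIV. factor i (f i))"
  by (simp add: of_tensor_def pure_def lift_single)

lemma prod_fun_upd: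
  "(\<Prod>j\<in>UNIV. h j ((f(i := p)) j)) = (\<Prod>j\<in>UNIV - {i}. h j (f j)) * (h i p :: 'a::comm_monoid_mult)"
  for i :: "'n::finite"
proof -
  have "(\<Prod>j\<in>UNIV - {i}. h j ((f(i := p)) j)) = (\<Prod>j\<in>UNIV - {i}. h j (f j))"
    by (rule prod.cong) auto
  then show ?thesis
    by (subst prod.remove[of _ i]) (simp_all add: mult.commute)
qed

lemma of_tensor_multilinear_ideal:
  assumes "z \<in> multilinear_ideal"
  shows "of_tensor z = 0"
proof -
  note hom = rhom.diff[OF of_tensor_rhom] rhom.add[OF of_tensor_rhom] rhom.mult[OF of_tensor_rhom]
    of_tensor_pure of_tensor_Const prod_fun_upd[of factor] rhom.add[OF factor_rhom] rhom.mult[OF factor_rhom] factor_Const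
  have "z \<in> {z. of_tensor z \<in> {0}}"
    by (rule multilinear_ideal_least[OF type_ideal_vimage[OF of_tensor_rhom type_ideal_zero] _ _ assms])
      (simp_all only: mem_Collect_eq hom, simp_all add: algebra_simps)
  then show ?thesis
    by simp
qed

lemma of_tensor_tensor_of: "of_tensor (tensor_of p) = (p :: ('n::finite, 'm::finite, 'k::comm_ring_1) diag_poly)"
proof -
  have "of_tensor (tensor_of (Var (i, k))) = (Var (i, k) :: ('n, 'm, 'k) diag_poly)" for i k
    using prod_fun_upd[of factor "\<lambda>_. 1" i "Var k"]
    by (simp add: tensor_of_Var of_tensor_pure rhom.one[OF factor_rhom] factor_Var)
  then have "of_tensor \<circ> tensor_of = (id :: ('n, 'm, 'k) diag_poly \<Rightarrow> _)"
    by (intro mpoly_hom_eqI rhom_comp tensor_of_rhom of_tensor_rhom)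
      (auto simp: rhom_def tensor_of_Const of_tensor_Const)
  then show ?thesis
    by (simp add: fun_eq_iff)
qed

lemma pure_mult: "pure f * pure g = pure (\<lambda>i. f i * g i)"
  by (simp add: pure_def mult_single plus_family_def)

lemma pure_one: "pure (\<lambda>_. 1) = 1"
  by (simp add: pure_def flip: zero_family_def)

lemma pure_eq_prod: "pure f = (\<Prod>i\<in>UNIV. pure ((\<lambda>_. 1)(i := f i)))"
proof -
  have "(\<Prod>i\<in>S. pure ((\<lambda>_. 1)(i := f i))) = pure (\<lambda>i. if i \<in> S then f i else 1)" if "finite S" for S
    using that
  proof (induction S)
    case empty
    then show ?case
      by (simp add: pure_one)
  next
    case (insert i S)
    then show ?case
      by (simp add: pure_mult) (rule arg_cong[of _ _ pure], auto)
  qed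
  from this[of UNIV] show ?thesis
    by simp
qed

text \<open>\<open>pure\<close> is not additive, but modulo the relations the embedding of a single
  factor is a homomorphism; it is therefore determined by the constants and the variables, on which
  it agrees with \<open>tensor_of\<close>.\<close>

lemma pure_factor_mem:
  "(pure ((\<lambda>_. 1)(i := p)) - tensor_of (factor i p) :: ('n::finite, 'm::finite, 'k::comm_ring_1) families)
    \<in> multilinear_ideal"
proof (induction p rule: mpoly_induct)
  case (Const c)
  have "pure ((\<lambda>_. 1)(i := Const c * 1)) - Const c * pure ((\<lambda>_. 1)(i := 1)) \<in> (multilinear_ideal :: ('n, 'm, 'k) families set)"
    by (rule pure_scale_mem)
  then show ?case
    by (simp add: factor_Const tensor_of_Const pure_one fun_upd_idem del: fun_upd_apply)
next
  case (add p q)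
  have "(pure ((\<lambda>_. 1)(i := p)) + pure ((\<lambda>_. 1)(i := q))) - (tensor_of (factor i p) + tensor_of (factor i q))
      \<in> (multilinear_ideal :: ('n, 'm, 'k) families set)"
    using tens.add_mem[OF add] by (simp only: add_diff_add)
  from tens.diff_trans[OF pure_add_mem this] show ?case
    by (simp only: rhom.add[OF factor_rhom] rhom.add[OF tensor_of_rhom])
next
  case (Var p k)
  have "pure ((\<lambda>_. 1)(i := p * Var k)) = pure ((\<lambda>_. 1)(i := p)) * (pure ((\<lambda>_. 1)(i := Var k)) :: ('n, 'm, 'k) families)"
    unfolding pure_mult by (rule arg_cong[of _ _ pure]) auto
  then have "pure ((\<lambda>_. 1)(i := p * Var k)) - tensor_of (factor i (p * Var k)) =
      (pure ((\<lambda>_. 1)(i := p)) - tensor_of (factor i p)) * (pure ((\<lambda>_. 1)(i := Var k)) :: ('n, 'm, 'k) families)"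
    by (simp add: rhom.mult[OF factor_rhom] rhom.mult[OF tensor_of_rhom] factor_Var tensor_of_Var algebra_simps)
  then show ?case
    using tens.mult_mem_right[OF Var] by (simp only:)
qed

lemma tensor_of_of_tensor:
  "(z - tensor_of (of_tensor z) :: ('n::finite, 'm::finite, 'k::comm_ring_1) families) \<in> multilinear_ideal"
proof (induction z rule: poly_mapping_single_induct)
  case 0
  then show ?case
    by (simp add: rhom.zero[OF of_tensor_rhom] rhom.zero[OF tensor_of_rhom] tens.zero_mem)
next
  case (add z t c)
  have eq: "Poly_Mapping.single t c = Const c * pure (entry t)"
    by (simp add: single_eq_Const_mult[of t c] pure_def)
  have "pure (entry t) - tensor_of (of_tensor (pure (entry t))) \<in> (multilinear_ideal :: ('n, 'm, 'k) families set)"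
    unfolding of_tensor_pure rhom.prod[OF tensor_of_rhom]
    by (subst (1) pure_eq_prod) (intro tens.diff_prod pure_factor_mem)
  from tens.mult_mem[OF this, of "Const c"]
  have "Poly_Mapping.single t c - tensor_of (of_tensor (Poly_Mapping.single t c)) \<in> (multilinear_ideal :: ('n, 'm, 'k) families set)"
    by (simp add: eq rhom.mult[OF of_tensor_rhom] rhom.mult[OF tensor_of_rhom] of_tensor_Const tensor_of_Const algebra_simps)
  from tens.add_mem[OF add this] show ?case
    by (simp add: rhom.add[OF of_tensor_rhom] rhom.add[OF tensor_of_rhom] algebra_simps)
qed

lemma families_act_eq_lift:
  "families_act \<sigma> = lift Const (\<lambda>t. pure (entry t \<circ> inv_into UNIV \<sigma>))"
  by (simp add: fun_eq_iff families_act_def lift_def pure_def flip: single_eq_Const_mult)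

lemma families_act_rhom: "rhom (families_act \<sigma>)"
  unfolding families_act_eq_lift
  by (rule lift_rhom[OF Const_rhom])
    (simp_all add: zero_family_def plus_family_def pure_one pure_mult comp_def)

lemma families_act_pure: "families_act \<sigma> (pure f) = pure (f \<circ> inv_into UNIV \<sigma>)"
  by (simp add: families_act_eq_lift pure_def[of f] lift_single)

lemma families_act_Const: "families_act \<sigma> (Const c) = Const c"
  by (simp add: families_act_eq_lift Const_def[of c] lift_single zero_family_def comp_def pure_one)

text \<open>Permuting the factors takes a multilinearity relation in position i to the same relation
  in position \<sigma> i.\<close>

lemma families_act_multilinear_ideal:
  fixes z :: "('n::finite, 'm::finite, 'k::comm_ring_1) families"
  assumes "\<sigma> \<in> Sym" and "z \<in> multilinear_ideal"
  shows "families_act \<sigma> z \<in> multilinear_ideal"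
proof -
  have "bij \<sigma>"
    using assms(1) by (simp add: Sym_def permutes_bij)
  then have upd: "f(i := p) \<circ> inv_into UNIV \<sigma> = (f \<circ> inv_into UNIV \<sigma>)(\<sigma> i := p)" for f :: "'n \<Rightarrow> ('m, 'k) mpoly" and i p
    by (auto simp: fun_eq_iff bij_inv_eq_iff bij_is_inj inv_f_f)
  have "z \<in> {z. families_act \<sigma> z \<in> multilinear_ideal}"
    by (rule multilinear_ideal_least[OF type_ideal_vimage[OF families_act_rhom tens.type_ideal_axioms] _ _ assms(2)])
      (simp_all only: mem_Collect_eq rhom.diff[OF families_act_rhom] rhom.add[OF families_act_rhom] rhom.mult[OF families_act_rhom]
        families_act_pure families_act_Const upd pure_add_mem pure_scale_mem)
  then show ?thesis
    by simp
qed

lemma families_act_inverse: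
  assumes "bij \<sigma>"
  shows "families_act (inv_into UNIV \<sigma>) (families_act \<sigma> z) = (z :: ('n::finite, 'm::finite, 'k::comm_ring_1) families)"
proof (induction z rule: poly_mapping_single_induct)
  case 0
  then show ?case
    by (simp add: rhom.zero[OF families_act_rhom])
next
  case (add z t c)
  have "Poly_Mapping.single t c = Const c * pure (entry t)"
    by (simp add: single_eq_Const_mult[of t c] pure_def)
  moreover have "families_act (inv_into UNIV \<sigma>) (families_act \<sigma> (pure f)) = (pure f :: ('n, 'm, 'k) families)" for f
    using assms by (simp add: families_act_pure comp_assoc inv_inv_eq bij_is_inj)
  ultimately show ?case
    by (simp add: rhom.add[OF families_act_rhom] rhom.mult[OF families_act_rhom] families_act_Const add)
qed

lemma tensor_act_coset:
  fixes z :: "('n::finite, 'm::finite, 'k::comm_ring_1) families"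
  assumes \<sigma>: "\<sigma> \<in> Sym"
  shows "tensor_act \<sigma> (tens.coset z) = tens.coset (families_act \<sigma> z)"
proof -
  have b: "bij \<sigma>"
    using \<sigma> by (simp add: Sym_def permutes_bij)
  have \<sigma>': "inv_into UNIV \<sigma> \<in> Sym"
    using \<sigma> by (simp add: Sym_def permutes_inv)
  have "families_act \<sigma> (families_act (inv_into UNIV \<sigma>) z) = z" for z :: "('n, 'm, 'k) families"
    using families_act_inverse[OF bij_imp_bij_inv[OF b], of z] by (simp add: inv_inv_eq[OF b])
  note tens.image_coset[OF families_act_rhom this families_act_multilinear_ideal[OF \<sigma>]
      families_act_multilinear_ideal[OF \<sigma>'] families_act_rhom families_act_inverse[OF b]]
  then show ?thesis
    by (simp add: tensor_act_def)
qed

lemma families_act_tensor_of: "families_act \<sigma> (tensor_of p) = tensor_of (Sym_act \<sigma> p)"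
  if "\<sigma> \<in> Sym" for p :: "('n::finite, 'm::finite, 'k::comm_ring_1) diag_poly"
proof -
  have b: "bij \<sigma>"
    using that by (simp add: Sym_def permutes_bij)
  have "(\<lambda>_. 1)(i := Var k) \<circ> inv_into UNIV \<sigma> = (\<lambda>_. 1)(\<sigma> i := Var k :: ('m, 'k) mpoly)" for i k
    using b by (auto simp: fun_eq_iff bij_inv_eq_iff bij_is_inj inv_f_f)
  then have "families_act \<sigma> \<circ> tensor_of = tensor_of \<circ> (Sym_act \<sigma> :: _ \<Rightarrow> ('n, 'm, 'k) diag_poly)"
    by (intro mpoly_hom_eqI rhom_comp families_act_rhom tensor_of_rhom Sym_act_rhom)
      (auto simp: tensor_of_Const families_act_Const Sym_act_Const tensor_of_Var families_act_pure Sym_act_Var)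
  then show ?thesis
    by (simp add: fun_eq_iff)
qed

lemma to_tensor_eq: "to_tensor p = tens.coset (tensor_of p)"
  by (simp add: to_tensor_def tensor_of_def families_ring_def)

lemma to_tensor_inject: "to_tensor p = to_tensor q \<longleftrightarrow> p = q"
proof
  assume "to_tensor p = to_tensor q"
  then have "tensor_of p - tensor_of q \<in> multilinear_ideal"
    by (simp add: to_tensor_eq tens.coset_eq_iff)
  then have "of_tensor (tensor_of p - tensor_of q) = 0"
    by (rule of_tensor_multilinear_ideal)
  then show "p = q"
    by (simp add: rhom.diff[OF of_tensor_rhom] of_tensor_tensor_of)
qed simp

lemma tensor_ring_eq: "tensor_ring = type_ring Quot multilinear_ideal"
  by (simp add: tensor_ring_def families_ring_def)

lemma tensor_act_to_tensor: "\<sigma> \<in> Sym \<Longrightarrow> tensor_act \<sigma> (to_tensor p) = to_tensor (Sym_act \<sigma> p)"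
  by (simp add: to_tensor_eq tensor_act_coset families_act_tensor_of)

lemma to_tensor_surj:
  assumes "c \<in> carrier (tensor_ring :: ('n::finite, 'm::finite, 'k::comm_ring_1) families set ring)"
  obtains p where "c = to_tensor p"
proof -
  obtain z where "c = tens.coset z"
    using assms by (auto simp: tensor_ring_eq tens.quot_carrier)
  then have "c = to_tensor (of_tensor z)"
    using tensor_of_of_tensor[of z] by (simp add: to_tensor_eq tens.coset_eq_iff)
  then show thesis
    by (rule that)
qed

text \<open>The map is bijective onto the whole tensor power and equivariant, so it matches the
  invariants on both sides.\<close>

theorem to_tensor_alg_iso:
  "(to_tensor :: ('n::finite, 'm::finite, 'k::comm_ring_1) diag_poly \<Rightarrow> _) \<in> alg_iso Const D_inv tensor_const TS_ring"
proof -
  have carr: "(to_tensor p :: ('n, 'm, 'k) families set) \<in> carrier tensor_ring" for p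
    by (simp add: tensor_ring_eq tens.quot_carrier to_tensor_eq)
  have "to_tensor ` carrier D_inv = carrier (TS_ring :: ('n, 'm, 'k) families set ring)"
  proof (intro equalityI subsetI)
    fix c :: "('n, 'm, 'k) families set"
    assume "c \<in> to_tensor ` carrier D_inv"
    then show "c \<in> carrier TS_ring"
      by (auto simp: fixed_ring_def TS_ring_def carr tensor_act_to_tensor)
  next
    fix c :: "('n, 'm, 'k) families set"
    assume c: "c \<in> carrier TS_ring"
    then obtain p where p: "c = to_tensor p"
      using to_tensor_surj[of c] by (auto simp: TS_ring_def fixed_ring_def)
    have "Sym_act \<sigma> p = p" if "\<sigma> \<in> Sym" for \<sigma>
    proof -
      have "tensor_act \<sigma> c = c"
        using c that by (auto simp: TS_ring_def fixed_ring_def)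
      then show ?thesis
        by (simp add: p tensor_act_to_tensor[OF that] to_tensor_inject)
    qed
    then show "c \<in> to_tensor ` carrier D_inv"
      by (auto simp: p fixed_ring_def D_ring_def)
  qed
  then have "bij_betw to_tensor (carrier D_inv) (carrier (TS_ring :: ('n, 'm, 'k) families set ring))"
    by (simp add: bij_betw_def inj_on_def to_tensor_inject)
  moreover have "to_tensor \<in> ring_hom D_inv (TS_ring :: ('n, 'm, 'k) families set ring)"
  proof (rule ring_hom_memI)
    fix p :: "('n, 'm, 'k) diag_poly"
    assume "p \<in> carrier D_inv"
    then show "to_tensor p \<in> carrier TS_ring"
      by (auto simp: fixed_ring_def TS_ring_def carr tensor_act_to_tensor)
  qed (simp_all add: fixed_ring_def TS_ring_def D_ring_def tensor_ring_eq to_tensor_eq tens.quot_mult tens.quot_add tens.quot_one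
      rhom.add[OF tensor_of_rhom] rhom.mult[OF tensor_of_rhom] rhom.one[OF tensor_of_rhom])
  moreover have "to_tensor (Const c) = (tensor_const c :: ('n, 'm, 'k) families set)" for c
    by (simp add: to_tensor_eq tensor_of_Const tensor_const_def families_ring_def)
  ultimately show ?thesis
    by (simp add: alg_iso_def ring_iso_def)
qed

section \<open>The nilradical\<close>

text \<open>The absence of zero divisors rests on leading monomials and hence on an order of the
  variables. An injective renaming into the natural numbers supplies one, and it can be undone by a
  second substitution.\<close>

lemma mpoly_power_eq_0:
  fixes p :: "('v::finite, 'k::field) mpoly"
  assumes "p ^ r = 0"
  shows "p = 0"
proof -
  obtain \<nu> :: "'v \<Rightarrow> nat" where "inj \<nu>"
    using finite_imp_inj_to_nat_seg[OF finite] by blast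
  define up :: "('v, 'k) mpoly \<Rightarrow> (nat, 'k) mpoly" where "up = subst Const (\<lambda>v. Var (\<nu> v))"
  define down :: "(nat, 'k) mpoly \<Rightarrow> ('v, 'k) mpoly" where "down = subst Const (\<lambda>n. Var (inv_into UNIV \<nu> n))"
  have hom: "rhom up" "rhom down"
    by (simp_all add: up_def down_def subst_rhom Const_rhom)
  have "down \<circ> up = id"
  proof (intro mpoly_hom_eqI rhom_comp hom)
    show "rhom (id :: ('v, 'k) mpoly \<Rightarrow> _)"
      by unfold_locales simp_all
  qed (simp_all add: up_def down_def Const_rhom inv_f_f[OF \<open>inj \<nu>\<close>])
  then have "down (up p) = p"
    by (simp add: fun_eq_iff)
  moreover have "up p ^ r = 0"
    using assms by (simp add: rhom.zero[OF hom(1)] flip: rhom.power[OF hom(1)])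
  then have "up p = 0"
    by simp
  ultimately show ?thesis
    by (simp add: rhom.zero[OF hom(2)])
qed

section \<open>The radical of an ideal and the reduced quotient\<close>

context type_ideal
begin

text \<open>The radical of \<open>J\<close>. Through it the nilradical of the quotient and the
  quotient by that are described by representatives in the original ring.\<close>

definition nil :: "'a set" where
  "nil = {x. \<exists>r :: nat. x ^ r \<in> J}"

lemma power_mem_mono: "x ^ r \<in> J \<Longrightarrow> r \<le> s \<Longrightarrow> x ^ s \<in> J"
  using mult_mem[of "x ^ r" "x ^ (s - r)"] by (simp flip: power_add)

lemma nil_type_ideal: "type_ideal nil"
proof (intro type_ideal.intro idealI_type)
  have "0 ^ 1 \<in> J"
    by (simp add: zero_mem)
  then show "0 \<in> nil"
    unfolding nil_def by blast
next
  fix x y assume "x \<in> nil" "y \<in> nil"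
  then obtain r s where rs: "x ^ r \<in> J" "y ^ s \<in> J"
    by (auto simp: nil_def)
  \<comment> \<open>In each binomial term of degree r + s, either the exponent of x is at least r or
    that of y is at least s.\<close>
  have "of_nat ((r + s) choose k) * x ^ k * y ^ (r + s - k) \<in> J" for k
  proof (cases "r \<le> k")
    case True
    then show ?thesis
      using power_mem_mono[OF rs(1)] by (intro mult_mem mult_mem_right) auto
  next
    case False
    then show ?thesis
      using power_mem_mono[OF rs(2)] by (intro mult_mem) auto
  qed
  then have "(x + y) ^ (r + s) \<in> J"
    by (simp add: binomial_ring sum_mem)
  then show "x + y \<in> nil"
    unfolding nil_def by blast
next
  fix x z assume "x \<in> nil"
  then show "z * x \<in> nil"
    by (auto simp: nil_def power_mult_distrib intro: mult_mem)
qed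

lemma quot_cring: "cring (type_ring Quot J)"
  by (rule ideal.quotient_is_cring[OF is_ideal type_ring_cring])

lemma nilradical_quot: "nilradical (type_ring Quot J) = coset ` nil"
proof -
  have "coset x \<in> nilradical (type_ring Quot J) \<longleftrightarrow> x \<in> nil" for x
    by (simp add: nilradical_def quot_carrier quot_pow quot_zero coset_eq_iff nil_def rangeI)
  moreover have "nilradical (type_ring Quot J) \<subseteq> range coset"
    by (auto simp: nilradical_def quot_carrier)
  ultimately show ?thesis
    by blast
qed

lemma quot_a_inv: "\<ominus>\<^bsub>type_ring Quot J\<^esub> coset x = coset (- x)"
proof -
  interpret Q: cring "type_ring Quot J"
    by (rule quot_cring)
  show ?thesis
    by (rule Q.minus_equality) (simp_all add: quot_add quot_zero quot_carrier rangeI)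
qed

lemma nilradical_ideal: "ideal (nilradical (type_ring Quot J)) (type_ring Quot J)"
proof -
  interpret Q: cring "type_ring Quot J"
    by (rule quot_cring)
  interpret N: type_ideal nil
    by (rule nil_type_ideal)
  show ?thesis
    unfolding nilradical_quot
  proof (rule idealI[OF Q.ring_axioms])
    show "subgroup (coset ` nil) (add_monoid (type_ring Quot J))"
    proof
      show "m_inv (add_monoid (type_ring Quot J)) C \<in> coset ` nil" if "C \<in> coset ` nil" for C
        using that quot_a_inv by (auto simp: a_inv_def N.uminus_mem)
    qed (auto simp: quot_carrier quot_add quot_zero N.zero_mem N.add_mem)
  qed (auto simp: quot_carrier quot_mult N.mult_mem N.mult_mem_right)
qed

definition red :: "'a \<Rightarrow> 'a set set" where
  "red x = nilradical (type_ring Quot J) +>\<^bsub>type_ring Quot J\<^esub> coset x"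

lemma mem_red: "C \<in> red x \<longleftrightarrow> (\<exists>y. C = coset y \<and> y - x \<in> nil)"
proof -
  have "C \<in> red x \<longleftrightarrow> (\<exists>h\<in>nilradical (type_ring Quot J). C = h \<oplus>\<^bsub>type_ring Quot J\<^esub> coset x)"
    unfolding red_def a_r_coset_def[of "type_ring Quot J"] r_coset_def[of "add_monoid (type_ring Quot J)"] by simp
  also have "\<dots> \<longleftrightarrow> (\<exists>z\<in>nil. C = coset (z + x))"
    by (simp add: nilradical_quot quot_add)
  also have "\<dots> \<longleftrightarrow> (\<exists>y. C = coset y \<and> y - x \<in> nil)"
    by (metis add_diff_cancel diff_add_cancel)
  finally show ?thesis .
qed

lemma red_eq_iff: "red x = red y \<longleftrightarrow> x - y \<in> nil"
proof
  interpret N: type_ideal nil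
    by (rule nil_type_ideal)
  assume "red x = red y"
  then have "coset x \<in> red y"
    using mem_red[of "coset x" x] N.zero_mem by auto
  then obtain z where z: "x - z \<in> J" "z - y \<in> nil"
    by (auto simp: mem_red coset_eq_iff)
  have "(x - z) ^ 1 \<in> J"
    using z(1) by simp
  then have "x - z \<in> nil"
    unfolding nil_def by blast
  then show "x - y \<in> nil"
    using z(2) by (rule N.diff_trans)
next
  interpret N: type_ideal nil
    by (rule nil_type_ideal)
  assume "x - y \<in> nil"
  then show "red x = red y"
    using N.diff_trans N.diff_sym unfolding set_eq_iff mem_red by metis
qed

lemma red_carrier: "carrier (type_ring Quot J Quot nilradical (type_ring Quot J)) = range red"
proof -
  have carr: "carrier (R Quot I) = (\<lambda>x. I +>\<^bsub>R\<^esub> x) ` carrier R" for R :: "'c ring" and I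
    by (auto simp: FactRing_def A_RCOSETS_def RCOSETS_def a_r_coset_def)
  show ?thesis
    unfolding carr[of "type_ring Quot J"] quot_carrier by (simp add: image_image red_def)
qed

lemma red_mult: "mult (type_ring Quot J Quot nilradical (type_ring Quot J)) (red x) (red y) = red (x * y)"
  and red_add: "add (type_ring Quot J Quot nilradical (type_ring Quot J)) (red x) (red y) = red (x + y)"
  and red_one: "one (type_ring Quot J Quot nilradical (type_ring Quot J)) = red 1"
proof -
  have carr: "coset z \<in> carrier (type_ring Quot J)" for z
    by (simp add: quot_carrier rangeI)
  note hom = ideal.rcos_ring_hom[OF nilradical_ideal]
  show "mult (type_ring Quot J Quot nilradical (type_ring Quot J)) (red x) (red y) = red (x * y)"
    using ring_hom_mult[OF hom carr carr, of x y] by (simp only: red_def quot_mult)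
  show "add (type_ring Quot J Quot nilradical (type_ring Quot J)) (red x) (red y) = red (x + y)"
    using ring_hom_add[OF hom carr carr, of x y] by (simp only: red_def quot_add)
  show "one (type_ring Quot J Quot nilradical (type_ring Quot J)) = red 1"
    using ring_hom_one[OF hom] by (simp only: red_def quot_one)
qed

end

section \<open>Restriction to diagonal matrices on the quotients\<close>

lemma Delta_nil: "x \<in> comm.nil \<Longrightarrow> Delta x = (0 :: ('n::finite, 'm::finite, 'k::field) diag_poly)"
  by (auto simp: comm.nil_def rhom.power[OF Delta_rhom] dest!: Delta_comm_ideal intro: mpoly_power_eq_0)

lemma GL_act_nil: "g \<in> GL \<Longrightarrow> x \<in> comm.nil \<Longrightarrow> GL_act g x \<in> comm.nil"
  unfolding comm.nil_def by (auto simp flip: rhom.power[OF GL_act_rhom] dest: GL_act_comm_ideal)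

lemma AP_ring_eq: "AP_ring = type_ring Quot comm_ideal"
  by (simp add: AP_ring_def A_ring_def)

lemma AP_const_eq: "AP_const c = comm.coset (Const c)"
  by (simp add: AP_const_def A_ring_def)

lemma AP_red_ring_eq: "AP_red_ring = type_ring Quot comm_ideal Quot nilradical (type_ring Quot comm_ideal)"
  by (simp add: AP_red_ring_def AP_ring_eq)

lemma AP_red_const_eq: "AP_red_const c = comm.red (Const c)"
  by (simp add: AP_red_const_def comm.red_def AP_ring_eq AP_const_eq)

lemma GL_act_inverse':
  "g \<in> GL \<Longrightarrow> GL_act (matrix_inv g) (GL_act g f) = (f :: ('n::finite, 'm::finite, 'k::comm_ring_1) gen_poly)"
  using GL_act_inverse[OF matrix_inv_in_GL, of g f] by (simp add: matrix_inv_matrix_inv)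

lemma AP_act_coset:
  fixes x :: "('n::finite, 'm::finite, 'k::comm_ring_1) gen_poly"
  assumes "g \<in> GL"
  shows "AP_act g (comm.coset x) = comm.coset (GL_act g x)"
  unfolding AP_act_def
  by (rule comm.image_coset[OF GL_act_rhom GL_act_inverse[OF assms] GL_act_comm_ideal[OF assms]
        GL_act_comm_ideal[OF matrix_inv_in_GL[OF assms]] GL_act_rhom GL_act_inverse'[OF assms]])

lemma Delta_P_coset: "Delta_P (comm.coset x) = Delta x"
  unfolding Delta_P_def
  by (rule comm.on_cosets_coset) (metis Delta_comm_ideal Delta_rhom rhom.diff eq_iff_diff_eq_0)

lemma AP_red_act_red:
  fixes x :: "('n::finite, 'm::finite, 'k::comm_ring_1) gen_poly"
  assumes g: "g \<in> GL"
  shows "AP_red_act g (comm.red x) = comm.red (GL_act g x)"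
  unfolding AP_red_act_def
proof (intro equalityI subsetI)
  fix C assume "C \<in> AP_act g ` comm.red x"
  then obtain y where "C = comm.coset (GL_act g y)" "y - x \<in> comm.nil"
    by (auto simp: comm.mem_red AP_act_coset[OF g])
  then show "C \<in> comm.red (GL_act g x)"
    using GL_act_nil[OF g, of "y - x"] by (auto simp: comm.mem_red rhom.diff[OF GL_act_rhom])
next
  fix C assume "C \<in> comm.red (GL_act g x)"
  then obtain y where y: "C = comm.coset y" "y - GL_act g x \<in> comm.nil"
    by (auto simp: comm.mem_red)
  define z where "z = GL_act (matrix_inv g) y"
  have "z - x \<in> comm.nil"
    using GL_act_nil[OF matrix_inv_in_GL[OF g] y(2)] by (simp add: z_def rhom.diff[OF GL_act_rhom] GL_act_inverse'[OF g])
  moreover have "C = AP_act g (comm.coset z)"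
    by (simp add: AP_act_coset[OF g] z_def GL_act_inverse[OF g] y(1))
  ultimately show "C \<in> AP_act g ` comm.red x"
    using comm.mem_red by blast
qed

lemma Delta_red_red: "Delta_red (comm.red x) = Delta x"
  for x :: "('n::finite, 'm::finite, 'k::field) gen_poly"
proof -
  interpret N: type_ideal "comm.nil :: ('n, 'm, 'k) gen_poly set"
    by (rule comm.nil_type_ideal)
  have "Delta y = Delta x" if "y - x \<in> comm.nil" for y
    using Delta_nil[OF that] by (simp add: rhom.diff[OF Delta_rhom])
  then have "Delta_P ` comm.red x \<subseteq> {Delta x}"
    by (auto simp: comm.mem_red Delta_P_coset)
  moreover have "comm.coset x \<in> comm.red x"
    unfolding comm.mem_red by (rule exI[of _ x]) (simp add: N.zero_mem)
  then have "Delta x \<in> Delta_P ` comm.red x"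
    using imageI[of "comm.coset x" "comm.red x" Delta_P] by (simp only: Delta_P_coset)
  ultimately have "Delta_P ` comm.red x = {Delta x}"
    unfolding set_eq_subset insert_subset by simp
  then show ?thesis
    by (simp add: Delta_red_def on_cosets_def)
qed

lemma carrier_D_inv: "p \<in> carrier D_inv \<longleftrightarrow> (\<forall>\<sigma>\<in>Sym. Sym_act \<sigma> p = p)"
  by (simp add: fixed_ring_def D_ring_def)

text \<open>One lift serves the polynomial ring and both quotients, because it is invariant exactly
  and not only modulo an ideal.\<close>

lemma D_inv_lift_invariant:
  fixes p :: "('n::finite, 'm::finite, 'k::comm_ring_1) diag_poly"
  assumes "p \<in> carrier D_inv"
  obtains f where "\<forall>g\<in>GL. GL_act g f = f" "Delta f = p"
proof -
  have "\<exists>f. (\<forall>g\<in>GL. GL_act g f = f) \<and> Delta f = p"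
    by (rule Delta_surj_invariants) (use assms in \<open>simp add: carrier_D_inv\<close>)
  then show thesis
    by (elim exE conjE) (rule that)
qed

lemma Delta_alg_hom: "Delta \<in> alg_hom Const A_inv Const D_inv"
  unfolding alg_hom_def
proof (intro CollectI conjI ring_hom_memI)
  show "Delta p \<in> carrier D_inv" if "p \<in> carrier A_inv" for p
    using that unfolding carrier_D_inv by (auto simp: fixed_ring_def intro: Delta_invariant)
qed (simp_all add: fixed_ring_def A_ring_def D_ring_def rhom.add[OF Delta_rhom] rhom.mult[OF Delta_rhom] rhom.one[OF Delta_rhom])

lemma Delta_image: "Delta ` carrier A_inv = (carrier D_inv :: ('n::finite, 'm::finite, 'k::comm_ring_1) diag_poly set)"
proof (intro equalityI subsetI)
  fix p :: "('n, 'm, 'k) diag_poly"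
  show "p \<in> carrier D_inv" if "p \<in> Delta ` carrier A_inv"
    using that unfolding carrier_D_inv by (auto simp: fixed_ring_def intro: Delta_invariant)
  assume "p \<in> carrier D_inv"
  then obtain f :: "('n, 'm, 'k) gen_poly" where f: "\<forall>g\<in>GL. GL_act g f = f" "Delta f = p"
    by (rule D_inv_lift_invariant)
  then show "p \<in> Delta ` carrier A_inv"
    by (auto simp: fixed_ring_def A_ring_def)
qed

lemma carrier_AP_inv:
  "carrier AP_inv = comm.coset ` {a :: ('n::finite, 'm::finite, 'k::comm_ring_1) gen_poly. \<forall>g\<in>GL. GL_act g a - a \<in> comm_ideal}"
proof -
  have "comm.coset a \<in> carrier AP_inv \<longleftrightarrow> (\<forall>g\<in>GL. GL_act g a - a \<in> comm_ideal)" for a :: "('n, 'm, 'k) gen_poly"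
    by (simp add: fixed_ring_def AP_ring_eq comm.quot_carrier AP_act_coset comm.coset_eq_iff rangeI)
  moreover have "carrier AP_inv \<subseteq> range (comm.coset :: ('n, 'm, 'k) gen_poly \<Rightarrow> _)"
    by (auto simp: fixed_ring_def AP_ring_eq comm.quot_carrier)
  ultimately show ?thesis
    by blast
qed

text \<open>The hypothesis is weak enough to cover invariance modulo the commutator ideal and, over
  a field, modulo its radical, since \<open>Delta\<close> kills either one.\<close>

lemma Delta_invariant_mod:
  fixes f :: "('n::finite, 'm::finite, 'k::comm_ring_1) gen_poly"
  assumes "\<And>g. g \<in> GL \<Longrightarrow> Delta (GL_act g f - f) = (0 :: ('n, 'm, 'k) diag_poly)"
  shows "Delta f \<in> carrier D_inv"
  unfolding carrier_D_inv
proof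
  fix \<sigma> :: "'n \<Rightarrow> 'n" assume "\<sigma> \<in> Sym"
  then have "\<sigma> permutes UNIV"
    by (simp add: Sym_def)
  then show "Sym_act \<sigma> (Delta f) = Delta f"
    using assms[OF perm_mat_GL(1)] Delta_GL_act[of \<sigma> f] by (simp add: rhom.diff[OF Delta_rhom])
qed

lemma Delta_P_alg_hom:
  "(Delta_P :: ('n::finite, 'm::finite, 'k::comm_ring_1) gen_poly set \<Rightarrow> _) \<in> alg_hom AP_const AP_inv Const D_inv"
  unfolding alg_hom_def
proof (intro CollectI conjI ring_hom_memI)
  show "Delta_P C \<in> carrier D_inv" if "C \<in> carrier AP_inv" for C :: "('n, 'm, 'k) gen_poly set"
    using that by (auto simp: carrier_AP_inv Delta_P_coset intro!: Delta_invariant_mod Delta_comm_ideal)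
qed (auto simp: comm.quot_carrier fixed_ring_def AP_ring_eq D_ring_def AP_const_eq Delta_P_coset comm.quot_mult comm.quot_add
    comm.quot_one rhom.add[OF Delta_rhom] rhom.mult[OF Delta_rhom] rhom.one[OF Delta_rhom])

lemma Delta_P_image: "Delta_P ` carrier AP_inv = (carrier D_inv :: ('n::finite, 'm::finite, 'k::comm_ring_1) diag_poly set)"
proof (intro equalityI subsetI)
  fix p :: "('n, 'm, 'k) diag_poly"
  show "p \<in> carrier D_inv" if "p \<in> Delta_P ` carrier AP_inv"
    using that by (auto simp: carrier_AP_inv Delta_P_coset intro!: Delta_invariant_mod Delta_comm_ideal)
  assume "p \<in> carrier D_inv"
  then obtain f :: "('n, 'm, 'k) gen_poly" where f: "\<forall>g\<in>GL. GL_act g f = f" "Delta f = p"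
    by (rule D_inv_lift_invariant)
  then have "comm.coset f \<in> carrier AP_inv"
    unfolding carrier_AP_inv by (intro imageI) (simp add: comm.zero_mem)
  then show "p \<in> Delta_P ` carrier AP_inv"
    using Delta_P_coset[of f] f(2) by (metis imageI)
qed

lemma Delta_P_alg_iso:
  "(Delta_P :: ('n::finite, 'm::finite, 'k::field_char_0) gen_poly set \<Rightarrow> _) \<in> alg_iso AP_const AP_inv Const D_inv"
proof -
  have "inj_on Delta_P (carrier (AP_inv :: ('n, 'm, 'k) gen_poly set ring))"
  proof (rule inj_onI)
    fix C C' :: "('n, 'm, 'k) gen_poly set"
    assume "C \<in> carrier AP_inv" "C' \<in> carrier AP_inv" and eq: "Delta_P C = Delta_P C'"
    then obtain a b where C: "C = comm.coset a" "C' = comm.coset b"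
      and inv: "\<And>g. g \<in> GL \<Longrightarrow> GL_act g a - a \<in> comm_ideal" "\<And>g. g \<in> GL \<Longrightarrow> GL_act g b - b \<in> comm_ideal"
      unfolding carrier_AP_inv by blast
    have "GL_act g (a - b) - (a - b) \<in> comm_ideal" if "g \<in> GL" for g
      using comm.diff_mem[OF inv[OF that]] by (simp add: rhom.diff[OF GL_act_rhom] algebra_simps)
    then have "a - b \<in> comm_ideal"
      by (rule Delta_kernel_of_invariants) (use eq in \<open>simp_all add: C Delta_P_coset rhom.diff[OF Delta_rhom]\<close>)
    then show "C = C'"
      by (simp add: C comm.coset_eq_iff)
  qed
  then show ?thesis
    using Delta_P_alg_hom[where 'n = 'n and 'm = 'm and 'k = 'k] Delta_P_image[where 'n = 'n and 'm = 'm and 'k = 'k]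
    by (simp add: alg_iso_def alg_hom_def ring_iso_def bij_betw_def)
qed

lemma carrier_AP_red_inv:
  "carrier AP_red_inv = comm.red ` {a :: ('n::finite, 'm::finite, 'k::comm_ring_1) gen_poly. \<forall>g\<in>GL. GL_act g a - a \<in> comm.nil}"
proof -
  have "comm.red a \<in> carrier AP_red_inv \<longleftrightarrow> (\<forall>g\<in>GL. GL_act g a - a \<in> comm.nil)" for a :: "('n, 'm, 'k) gen_poly"
    by (simp add: fixed_ring_def AP_red_ring_eq comm.red_carrier AP_red_act_red comm.red_eq_iff rangeI)
  moreover have "carrier AP_red_inv \<subseteq> range (comm.red :: ('n, 'm, 'k) gen_poly \<Rightarrow> _)"
    by (auto simp: fixed_ring_def AP_red_ring_eq comm.red_carrier)
  ultimately show ?thesis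
    by blast
qed

lemma Delta_red_alg_iso:
  assumes inf: "infinite (UNIV :: 'k::field set)"
  shows "(Delta_red :: ('n::finite, 'm::finite, 'k) gen_poly set set \<Rightarrow> _) \<in> alg_iso AP_red_const AP_red_inv Const D_inv"
proof -
  interpret N: type_ideal "comm.nil :: ('n, 'm, 'k) gen_poly set"
    by (rule comm.nil_type_ideal)
  have inj: "inj_on Delta_red (carrier (AP_red_inv :: ('n, 'm, 'k) gen_poly set set ring))"
  proof (rule inj_onI)
    fix C C' :: "('n, 'm, 'k) gen_poly set set"
    assume "C \<in> carrier AP_red_inv" "C' \<in> carrier AP_red_inv" and eq: "Delta_red C = Delta_red C'"
    then obtain a b where C: "C = comm.red a" "C' = comm.red b"
      and inv: "\<And>g. g \<in> GL \<Longrightarrow> GL_act g a - a \<in> comm.nil" "\<And>g. g \<in> GL \<Longrightarrow> GL_act g b - b \<in> comm.nil"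
      unfolding carrier_AP_red_inv by blast
    have "GL_act g (a - b) - (a - b) \<in> comm.nil" if "g \<in> GL" for g
      using N.diff_mem[OF inv[OF that]] by (simp add: rhom.diff[OF GL_act_rhom] algebra_simps)
    then have "\<exists>r :: nat. (GL_act g (a - b) - (a - b)) ^ r \<in> comm_ideal" if "g \<in> GL" for g
      using that by (simp add: comm.nil_def)
    moreover have "Delta (a - b) = 0"
      using eq by (simp add: C Delta_red_red rhom.diff[OF Delta_rhom])
    ultimately have "\<exists>r :: nat. (a - b) ^ r \<in> comm_ideal"
      by (rule Delta_kernel_of_invariants_reduced[OF inf])
    then show "C = C'"
      by (simp add: C comm.red_eq_iff comm.nil_def)
  qed
  have maps: "Delta_red C \<in> carrier D_inv" if "C \<in> carrier AP_red_inv" for C :: "('n, 'm, 'k) gen_poly set set"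
    using that by (auto simp: carrier_AP_red_inv Delta_red_red intro!: Delta_invariant_mod Delta_nil)
  have "p \<in> Delta_red ` carrier AP_red_inv" if p: "p \<in> carrier D_inv" for p :: "('n, 'm, 'k) diag_poly"
  proof -
    obtain f :: "('n, 'm, 'k) gen_poly" where f: "\<forall>g\<in>GL. GL_act g f = f" "Delta f = p"
      using p by (rule D_inv_lift_invariant)
    then have "comm.red f \<in> carrier AP_red_inv"
      unfolding carrier_AP_red_inv by (intro imageI) (simp add: N.zero_mem)
    then show ?thesis
      using Delta_red_red[of f] f(2) by (metis imageI)
  qed
  with maps inj have "bij_betw Delta_red (carrier AP_red_inv) (carrier (D_inv :: ('n, 'm, 'k) diag_poly ring))"
    by (auto simp: bij_betw_def)
  moreover have "Delta_red \<in> ring_hom AP_red_inv (D_inv :: ('n, 'm, 'k) diag_poly ring)"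
    by (rule ring_hom_memI[OF maps])
      (auto simp: comm.red_carrier fixed_ring_def AP_red_ring_eq D_ring_def Delta_red_red comm.red_mult comm.red_add
        comm.red_one rhom.add[OF Delta_rhom] rhom.mult[OF Delta_rhom] rhom.one[OF Delta_rhom])
  ultimately show ?thesis
    by (simp add: alg_iso_def ring_iso_def AP_red_const_eq Delta_red_red)
qed

theorem theorem3:
  shows
    "((Delta :: ('n::finite, 'm::finite, 'k::comm_ring_1) gen_poly \<Rightarrow> ('n, 'm, 'k) diag_poly)
        \<in> alg_hom Const A_inv Const D_inv \<and>
      (Delta :: ('n, 'm, 'k) gen_poly \<Rightarrow> ('n, 'm, 'k) diag_poly) ` carrier A_inv
        = carrier D_inv \<and>
      (to_tensor :: ('n, 'm, 'k) diag_poly \<Rightarrow> ('n, 'm, 'k) families set)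
        \<in> alg_iso Const D_inv tensor_const TS_ring \<and>
      (Delta_P :: ('n, 'm, 'k) gen_poly set \<Rightarrow> ('n, 'm, 'k) diag_poly)
        \<in> alg_hom AP_const AP_inv Const D_inv \<and>
      (Delta_P :: ('n, 'm, 'k) gen_poly set \<Rightarrow> ('n, 'm, 'k) diag_poly) ` carrier AP_inv
        = carrier D_inv) \<and>
     (Delta_P :: ('n, 'm, 'c::field_char_0) gen_poly set \<Rightarrow> ('n, 'm, 'c) diag_poly)
        \<in> alg_iso AP_const AP_inv Const D_inv \<and>
     (infinite (UNIV :: 'f::field set) \<longrightarrow>
       (Delta_red :: ('n, 'm, 'f) gen_poly set set \<Rightarrow> ('n, 'm, 'f) diag_poly)
         \<in> alg_iso AP_red_const AP_red_inv Const D_inv)"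
  by (intro conjI impI Delta_alg_hom Delta_image to_tensor_alg_iso Delta_P_alg_hom Delta_P_image
      Delta_P_alg_iso Delta_red_alg_iso)

end
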